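(* Let $\mathbf{k}$ be a unitary commutative ring, $\lambda\in\mathbf{k}$, and let $A=(A,m_A,\mu_A,\Delta_A,\varepsilon_A)$ be a (commutative) bialgebra over $\mathbf{k}$. With $\mathrm{Sh}(A)$, $\diamond_\lambda$, $\mu_\lambda$, $\Delta_\lambda$, $\varepsilon_\lambda$, $P_\lambda$ as defined in the context, the sextuple $(\mathrm{Sh}(A),\diamond_\lambda,\mu_\lambda,\Delta_\lambda,\varepsilon_\lambda,P_\lambda)$ is a left counital cocycle bialgebra.
   Context: All algebras are unitary, commutative and associative over $\mathbf{k}$; algebra homomorphisms preserve units; tensor products and linear maps are over $\mathbf{k}$. Definitions. A left counital coalgebra is a triple $(C,\Delta,\varepsilon)$ with $C$ a $\mathbf{k}$-module, $\Delta:C\to C\otimes C$ linear and coassociative, and $\varepsilon:C\to\mathbf{k}$ linear with $(\varepsilon\otimes\mathrm{id})\Delta=\beta_\ell$, where $\beta_\ell:C\to\mathbf{k}\otimes C$, $c\mapsto 1\otimes c$. An operated algebra is an algebra with a linear operator on it. A left counital operated bialgebra is $(H,m,\mu,\Delta,\varepsilon,P)$ where $(H,m,\mu,P)$ is an operated algebra ($m$ multiplication, $\mu:\mathbf{k}\to H$ unit, $P:H\to H$ linear), $(H,\Delta,\varepsilon)$ is a left counital coalgebra, and $\Delta:H\to H\otimes H$, $\varepsilon:H\to\mathbf{k}$ are algebra homomorphisms. It is a left counital cocycle bialgebra if moreover $\Delta P=(\mathrm{id}\otimes P)\Delta$. $\lambda$-TD shuffle product. Let $\mathrm{Sh}^+(A)=\bigoplus_{n\ge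 0}A^{\otimes n}$, $A^{\otimes 0}=\mathbf{k}$. The bilinear operation $\odot$ on $\mathrm{Sh}^+(A)$ is defined recursively on pure tensors: if one factor is a scalar $c\in\mathbf{k}=A^{\otimes 0}$, then $\odot$ is scalar multiplication by $c$ on the other factor; if $\mathfrak a=a_1\otimes\mathfrak a'\in A^{\otimes m}$, $\mathfrak b=b_1\otimes\mathfrak b'\in A^{\otimes n}$, $m,n\ge 1$, $\mathfrak a'\in A^{\otimes(m-1)}$, $\mathfrak b'\in A^{\otimes(n-1)}$ (for $m=1$ take $\mathfrak a'=1_{\mathbf k}$, similarly for $\mathfrak b'$; $a\otimes c$ with $c\in\mathbf k$ is identified with $ca$), then $$\mathfrak a\odot\mathfrak b=a_1\otimes(\mathfrak a'\odot\mathfrak b)+b_1\otimes(\mathfrak a\odot\mathfrak b')+\lambda a_1b_1\otimes(\mathfrak a'\odot\mathfrak b')-a_1b_1\otimes\big((\mathfrak a'\odot 1_A)\odot\mathfrak b'\big),$$ where $1_A\in A=A^{\otimes1}$. Structure on $\mathrm{Sh}(A)=A\otimes\mathrm{Sh}^+(A)\cong\bigoplus_{n\ge1}A^{\otimes n}$: the multiplication is $(a_0\otimes\mathfrak a')\diamond_\lambda(b_0\otimes\mathfrak b')=a_0b_0\otimes(\mathfrak a'\odot\mathfrak b')$ extended bilinearly; the unit is $\mu_\lambda:\mathbf{k}\to\mathrm{Sh}(A)$, $c\mapsto c1_A$; $P_\lambda(\mathfrak a)=1_A\otimes\mathfrak a$; $\bullet$ denotes the induced multiplication on $\mathrm{Sh}(A)\otimes\mathrm{Sh}(A)$.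 The comultiplication $\Delta_\lambda:\mathrm{Sh}(A)\to\mathrm{Sh}(A)\otimes\mathrm{Sh}(A)$ is the linear map defined recursively by $\Delta_\lambda(a)=\Delta_A(a)$ for $a\in A$, and $\Delta_\lambda(a_1\otimes\mathfrak a')=\Delta_A(a_1)\bullet\big((\mathrm{id}\otimes P_\lambda)\Delta_\lambda(\mathfrak a')\big)$ for $a_1\in A$, $\mathfrak a'\in A^{\otimes n}$, $n\ge1$. The linear map $\varepsilon_\lambda:\mathrm{Sh}(A)\to\mathbf{k}$ is $\varepsilon_A$ on $A=A^{\otimes 1}$ and $0$ on $A^{\otimes n}$ for $n\ge2$. *)

theory Defs
  imports "HOL-Algebra.Module" "HOL-Algebra.QuotRing"
begin

section \<open>Linear maps and free modules\<close>

definition linear_maps ::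
    "('r, 'x) ring_scheme \<Rightarrow> ('r, 'm, 'y) module_scheme \<Rightarrow> ('r, 'n, 'z) module_scheme \<Rightarrow> ('m \<Rightarrow> 'n) set"
  where "linear_maps R M N =
    {h. h \<in> carrier M \<rightarrow> carrier N \<and>
        (\<forall>x\<in>carrier M. \<forall>y\<in>carrier M. h (x \<oplus>\<^bsub>M\<^esub> y) = h x \<oplus>\<^bsub>N\<^esub> h y) \<and>
        (\<forall>r\<in>carrier R. \<forall>x\<in>carrier M. h (r \<odot>\<^bsub>M\<^esub> x) = r \<odot>\<^bsub>N\<^esub> h x)}"

definition algebra_homs ::
    "('r, 'x) ring_scheme \<Rightarrow> ('r, 'm, 'y) module_scheme \<Rightarrow> ('r, 'n, 'z) module_scheme \<Rightarrow> ('m \<Rightarrow> 'n) set"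
  where "algebra_homs R H K = ring_hom H K \<inter> linear_maps R H K"

definition self_module :: "('r, 'x) ring_scheme \<Rightarrow> ('r, 'r) module"
  where "self_module R = \<lparr>carrier = carrier R, mult = mult R, one = one R,
    zero = zero R, add = add R, smult = mult R\<rparr>"

text \<open>The free module on a set \<open>X\<close> consists of the finitely supported functions \<open>X \<rightarrow> R\<close>, extended
  by zero. It carries no multiplication; where one is needed, the fields \<open>mult\<close> and \<open>one\<close> are
  overwritten by a record update.\<close>

definition free_module :: "('r, 'x) ring_scheme \<Rightarrow> 'i set \<Rightarrow> ('r, 'i \<Rightarrow> 'r) module"
  where "free_module R X = \<lparr>
    carrier = {f. (\<forall>i\<in>X. f i \<in> carrier R) \<and> (\<forall>i. i \<notin> X \<longrightarrow> f i = \<zero>\<^bsub>R\<^esub>) \<and> finite {i. f i \<noteq> \<zero>\<^bsub>R\<^esub>}},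
    mult = undefined, one = undefined,
    zero = (\<lambda>i. \<zero>\<^bsub>R\<^esub>), add = (\<lambda>f g i. f i \<oplus>\<^bsub>R\<^esub> g i), smult = (\<lambda>r f i. r \<otimes>\<^bsub>R\<^esub> f i)\<rparr>"

definition basis_elt :: "('r, 'x) ring_scheme \<Rightarrow> 'i \<Rightarrow> ('i \<Rightarrow> 'r)"
  where "basis_elt R i = (\<lambda>j. if j = i then \<one>\<^bsub>R\<^esub> else \<zero>\<^bsub>R\<^esub>)"

text \<open>The linear extension of \<open>\<phi>\<close> from the basis \<open>X\<close> to the free module, with values in \<open>M\<close>;
  only values of \<open>\<phi>\<close> on the support of the argument matter.\<close>

definition lin_ext ::
    "('r, 'x) ring_scheme \<Rightarrow> ('r, 'm, 'y) module_scheme \<Rightarrow> ('i \<Rightarrow> 'm) \<Rightarrow> ('i \<Rightarrow> 'r) \<Rightarrow> 'm"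
  where "lin_ext R M \<phi> f = finsum M (\<lambda>i. f i \<odot>\<^bsub>M\<^esub> \<phi> i) {i. f i \<noteq> \<zero>\<^bsub>R\<^esub>}"

definition bilin_ext ::
    "('r, 'x) ring_scheme \<Rightarrow> ('r, 'm, 'y) module_scheme \<Rightarrow> ('i \<Rightarrow> 'j \<Rightarrow> 'm) \<Rightarrow>
     ('i \<Rightarrow> 'r) \<Rightarrow> ('j \<Rightarrow> 'r) \<Rightarrow> 'm"
  where "bilin_ext R M \<phi> f g = lin_ext R M (\<lambda>i. lin_ext R M (\<lambda>j. \<phi> i j) g) f"


section \<open>Quotients\<close>

definition submodule_span ::
    "('r, 'x) ring_scheme \<Rightarrow> ('r, 'm, 'y) module_scheme \<Rightarrow> 'm set \<Rightarrow> 'm set"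
  where "submodule_span R M S = \<Inter>{N. submodule N R M \<and> S \<subseteq> N}"

text \<open>The ring part is that of \<^const>\<open>FactRing\<close>; \<open>mult\<close> and \<open>one\<close> are meaningful when \<open>N\<close> is
  an ideal for the multiplication of \<open>M\<close>.\<close>

definition quot_module ::
    "('r, 'm, 'y) module_scheme \<Rightarrow> 'm set \<Rightarrow> ('r, 'm set) module"
  where "quot_module M N = \<lparr>carrier = a_rcosets\<^bsub>M\<^esub> N, mult = rcoset_mult M N,
    one = N +>\<^bsub>M\<^esub> \<one>\<^bsub>M\<^esub>, zero = N, add = set_add M,
    smult = (\<lambda>r X. \<Union>x\<in>X. N +>\<^bsub>M\<^esub> (r \<odot>\<^bsub>M\<^esub> x))\<rparr>"

text \<open>The map induced by \<open>\<phi>\<close> on a quotient of a free module, evaluated at a coset \<open>X\<close>: the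
  common value of the linear extension of \<open>\<phi>\<close> on all elements of \<open>X\<close>.\<close>

definition quot_lift ::
    "('r, 'x) ring_scheme \<Rightarrow> ('r, 'm, 'y) module_scheme \<Rightarrow> ('i \<Rightarrow> 'm) \<Rightarrow> ('i \<Rightarrow> 'r) set \<Rightarrow> 'm"
  where "quot_lift R M \<phi> X = the_elem (lin_ext R M \<phi> ` X)"


section \<open>Tensor products\<close>

definition tensor_rels ::
    "('r, 'x) ring_scheme \<Rightarrow> ('r, 'm, 'y) module_scheme \<Rightarrow> ('r, 'n, 'z) module_scheme \<Rightarrow>
     ('m \<times> 'n \<Rightarrow> 'r) set"
  where "tensor_rels R M N =
    (let F = free_module R (carrier M \<times> carrier N); e = basis_elt R in
     {e (x \<oplus>\<^bsub>M\<^esub> x', y) \<ominus>\<^bsub>F\<^esub> e (x, y) \<ominus>\<^bsub>F\<^esub> e (x', y) | x x' y.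
        x \<in> carrier M \<and> x' \<in> carrier M \<and> y \<in> carrier N} \<union>
     {e (x, y \<oplus>\<^bsub>N\<^esub> y') \<ominus>\<^bsub>F\<^esub> e (x, y) \<ominus>\<^bsub>F\<^esub> e (x, y') | x y y'.
        x \<in> carrier M \<and> y \<in> carrier N \<and> y' \<in> carrier N} \<union>
     {e (r \<odot>\<^bsub>M\<^esub> x, y) \<ominus>\<^bsub>F\<^esub> r \<odot>\<^bsub>F\<^esub> e (x, y) | r x y.
        r \<in> carrier R \<and> x \<in> carrier M \<and> y \<in> carrier N} \<union>
     {e (x, r \<odot>\<^bsub>N\<^esub> y) \<ominus>\<^bsub>F\<^esub> r \<odot>\<^bsub>F\<^esub> e (x, y) | r x y.
        r \<in> carrier R \<and> x \<in> carrier M \<and> y \<in> carrier N})"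

definition tensor_kernel ::
    "('r, 'x) ring_scheme \<Rightarrow> ('r, 'm, 'y) module_scheme \<Rightarrow> ('r, 'n, 'z) module_scheme \<Rightarrow>
     ('m \<times> 'n \<Rightarrow> 'r) set"
  where "tensor_kernel R M N =
    submodule_span R (free_module R (carrier M \<times> carrier N)) (tensor_rels R M N)"

text \<open>When \<open>M\<close> and \<open>N\<close> are algebras, the multiplication below is the usual one,
  \<open>(x \<otimes> y)(x' \<otimes> y') = xx' \<otimes> yy'\<close>; otherwise the fields \<open>mult\<close> and \<open>one\<close> are to be ignored.\<close>

definition tensor ::
    "('r, 'x) ring_scheme \<Rightarrow> ('r, 'm, 'y) module_scheme \<Rightarrow> ('r, 'n, 'z) module_scheme \<Rightarrow>
     ('r, ('m \<times> 'n \<Rightarrow> 'r) set) module"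
  where "tensor R M N =
    (let F = free_module R (carrier M \<times> carrier N) in
     quot_module
       (F\<lparr>mult := bilin_ext R F
            (\<lambda>(x, y) (x', y'). basis_elt R (x \<otimes>\<^bsub>M\<^esub> x', y \<otimes>\<^bsub>N\<^esub> y')),
          one := basis_elt R (\<one>\<^bsub>M\<^esub>, \<one>\<^bsub>N\<^esub>)\<rparr>)
       (tensor_kernel R M N))"

definition pure_tensor ::
    "('r, 'x) ring_scheme \<Rightarrow> ('r, 'm, 'y) module_scheme \<Rightarrow> ('r, 'n, 'z) module_scheme \<Rightarrow>
     'm \<Rightarrow> 'n \<Rightarrow> ('m \<times> 'n \<Rightarrow> 'r) set"
  where "pure_tensor R M N x y =
    tensor_kernel R M N +>\<^bsub>free_module R (carrier M \<times> carrier N)\<^esub> basis_elt R (x, y)"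

text \<open>The map \<open>f \<otimes> g\<close>; \<open>M\<close> and \<open>N\<close> are the codomains of \<open>f\<close> and \<open>g\<close>.\<close>

definition tensor_map ::
    "('r, 'x) ring_scheme \<Rightarrow> ('r, 'm, 'y) module_scheme \<Rightarrow> ('r, 'n, 'z) module_scheme \<Rightarrow>
     ('a \<Rightarrow> 'm) \<Rightarrow> ('b \<Rightarrow> 'n) \<Rightarrow> ('a \<times> 'b \<Rightarrow> 'r) set \<Rightarrow> ('m \<times> 'n \<Rightarrow> 'r) set"
  where "tensor_map R M N f g =
    quot_lift R (tensor R M N) (\<lambda>(x, y). pure_tensor R M N (f x) (g y))"

text \<open>The canonical map \<open>(L \<otimes> M) \<otimes> N \<rightarrow> L \<otimes> (M \<otimes> N)\<close>.\<close>

definition tensor_assoc ::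
    "('r, 'x) ring_scheme \<Rightarrow> ('r, 'l, 'w) module_scheme \<Rightarrow> ('r, 'm, 'y) module_scheme \<Rightarrow>
     ('r, 'n, 'z) module_scheme \<Rightarrow> (('l \<times> 'm \<Rightarrow> 'r) set \<times> 'n \<Rightarrow> 'r) set \<Rightarrow>
     ('l \<times> ('m \<times> 'n \<Rightarrow> 'r) set \<Rightarrow> 'r) set"
  where "tensor_assoc R L M N =
    (let T = tensor R L (tensor R M N) in
     quot_lift R T (\<lambda>(t, z).
       quot_lift R T (\<lambda>(x, y). pure_tensor R L (tensor R M N) x (pure_tensor R M N y z)) t))"


section \<open>Coalgebras and bialgebras\<close>

locale left_counital_coalgebra = module R C
  for R (structure) and C (structure) +
  fixes \<Delta> and \<epsilon>
  assumes comult_linear: "\<Delta> \<in> linear_maps R C (tensor R C C)"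
    and coassoc: "\<And>c. c \<in> carrier C \<Longrightarrow>
      tensor_assoc R C C C (tensor_map R (tensor R C C) C \<Delta> (\<lambda>x. x) (\<Delta> c)) =
      tensor_map R C (tensor R C C) (\<lambda>x. x) \<Delta> (\<Delta> c)"
    and counit_linear: "\<epsilon> \<in> linear_maps R C (self_module R)"
    and left_counit: "\<And>c. c \<in> carrier C \<Longrightarrow>
      tensor_map R (self_module R) C \<epsilon> (\<lambda>x. x) (\<Delta> c) = pure_tensor R (self_module R) C \<one> c"

locale coalgebra = left_counital_coalgebra +
  assumes right_counit: "\<And>c. c \<in> carrier C \<Longrightarrow>
      tensor_map R C (self_module R) (\<lambda>x. x) \<epsilon> (\<Delta> c) = pure_tensor R C (self_module R) c \<one>"

text \<open>The locale \<^locale>\<open>algebra\<close> covers the unital, commutative and associative algebras. The unit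
  map of an algebra \<open>H\<close> is encoded by the field \<open>one\<close>, as \<open>c \<mapsto> c \<odot> \<one>\<close>.\<close>

locale bialgebra = algebra R H + coalgebra R H \<Delta> \<epsilon>
  for R (structure) and H (structure) and \<Delta> and \<epsilon> +
  assumes comult_hom: "\<Delta> \<in> algebra_homs R H (tensor R H H)"
    and counit_hom: "\<epsilon> \<in> algebra_homs R H (self_module R)"

locale operated_algebra = algebra R H
  for R (structure) and H (structure) +
  fixes P
  assumes operator_linear: "P \<in> linear_maps R H H"

locale left_counital_operated_bialgebra =
  operated_algebra R H P + left_counital_coalgebra R H \<Delta> \<epsilon>
  for R (structure) and H (structure) and \<Delta> and \<epsilon> and P +
  assumes comult_hom: "\<Delta> \<in> algebra_homs R H (tensor R H H)"
    and counit_hom: "\<epsilon> \<in> algebra_homs R H (self_module R)"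

locale left_counital_cocycle_bialgebra = left_counital_operated_bialgebra +
  assumes cocycle: "\<And>x. x \<in> carrier H \<Longrightarrow>
      \<Delta> (P x) = tensor_map R H H (\<lambda>y. y) P (\<Delta> x)"


section \<open>The TD shuffle product\<close>

text \<open>A word \<open>[a\<^sub>1, \<dots>, a\<^sub>n]\<close> stands for the pure tensor \<open>a\<^sub>1 \<otimes> \<dots> \<otimes> a\<^sub>n\<close>, the empty word for
  \<open>1 \<in> R = A\<^sup>\<otimes>\<^sup>0\<close>. Formal linear combinations of words represent elements of the direct sum
  of the tensor powers.\<close>

definition word_module ::
    "('r, 'x) ring_scheme \<Rightarrow> ('r, 'a, 'y) module_scheme \<Rightarrow> ('r, 'a list \<Rightarrow> 'r) module"
  where "word_module R A = free_module R (lists (carrier A))"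

definition prefix_letter ::
    "('r, 'x) ring_scheme \<Rightarrow> ('r, 'a, 'y) module_scheme \<Rightarrow> 'a \<Rightarrow> ('a list \<Rightarrow> 'r) \<Rightarrow> ('a list \<Rightarrow> 'r)"
  where "prefix_letter R A a = lin_ext R (word_module R A) (\<lambda>w. basis_elt R (a # w))"

text \<open>The product \<open>\<odot>\<close> of two pure tensors, by the defining recursion.\<close>

function td_shuffle ::
    "('r, 'x) ring_scheme \<Rightarrow> ('r, 'a, 'y) module_scheme \<Rightarrow> 'r \<Rightarrow> 'a list \<Rightarrow> 'a list \<Rightarrow> ('a list \<Rightarrow> 'r)"
  where
    "td_shuffle R A l [] v = basis_elt R v"
  | "td_shuffle R A l (a # u) [] = basis_elt R (a # u)"
  | "td_shuffle R A l (a # u) (b # v) =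
      prefix_letter R A a (td_shuffle R A l u (b # v))
      \<oplus>\<^bsub>word_module R A\<^esub> prefix_letter R A b (td_shuffle R A l (a # u) v)
      \<oplus>\<^bsub>word_module R A\<^esub> l \<odot>\<^bsub>word_module R A\<^esub> prefix_letter R A (a \<otimes>\<^bsub>A\<^esub> b) (td_shuffle R A l u v)
      \<ominus>\<^bsub>word_module R A\<^esub> prefix_letter R A (a \<otimes>\<^bsub>A\<^esub> b)
          (lin_ext R (word_module R A) (\<lambda>w. td_shuffle R A l w v) (td_shuffle R A l u [\<one>\<^bsub>A\<^esub>]))"
  by pat_completeness auto
termination
  by (relation "measures [\<lambda>(R, A, l, u, v). length v, \<lambda>(R, A, l, u, v). length u]") auto


section \<open>The structure on Sh(A)\<close>

definition sh_words :: "('r, 'a, 'y) module_scheme \<Rightarrow> 'a list set"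
  where "sh_words A = {w \<in> lists (carrier A). w \<noteq> []}"

definition sh_rels ::
    "('r, 'x) ring_scheme \<Rightarrow> ('r, 'a, 'y) module_scheme \<Rightarrow> ('a list \<Rightarrow> 'r) set"
  where "sh_rels R A =
    (let F = free_module R (sh_words A); e = basis_elt R in
     {e (u @ (a \<oplus>\<^bsub>A\<^esub> b) # v) \<ominus>\<^bsub>F\<^esub> e (u @ a # v) \<ominus>\<^bsub>F\<^esub> e (u @ b # v) | u a b v.
        u \<in> lists (carrier A) \<and> v \<in> lists (carrier A) \<and> a \<in> carrier A \<and> b \<in> carrier A} \<union>
     {e (u @ (r \<odot>\<^bsub>A\<^esub> a) # v) \<ominus>\<^bsub>F\<^esub> r \<odot>\<^bsub>F\<^esub> e (u @ a # v) | r u a v.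
        r \<in> carrier R \<and> u \<in> lists (carrier A) \<and> v \<in> lists (carrier A) \<and> a \<in> carrier A})"

definition sh_kernel ::
    "('r, 'x) ring_scheme \<Rightarrow> ('r, 'a, 'y) module_scheme \<Rightarrow> ('a list \<Rightarrow> 'r) set"
  where "sh_kernel R A = submodule_span R (free_module R (sh_words A)) (sh_rels R A)"

text \<open>The multilinearity relations are homogeneous in the length of words, so the quotient is the
  direct sum of the tensor powers \<open>A\<^sup>\<otimes>\<^sup>n\<close>, \<open>n \<ge> 1\<close>. The multiplication is induced by
  \<open>(a \<otimes> u) \<diamondop> (b \<otimes> v) = ab \<otimes> (u \<odot> v)\<close>; it is the only component that depends on \<open>l\<close>.\<close>

definition Sh ::
    "('r, 'x) ring_scheme \<Rightarrow> ('r, 'a, 'y) module_scheme \<Rightarrow> 'r \<Rightarrow> ('r, ('a list \<Rightarrow> 'r) set) module"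
  where "Sh R A l =
    (let F = free_module R (sh_words A) in
     quot_module
       (F\<lparr>mult := bilin_ext R F
            (\<lambda>u v. prefix_letter R A (hd u \<otimes>\<^bsub>A\<^esub> hd v) (td_shuffle R A l (tl u) (tl v))),
          one := basis_elt R [\<one>\<^bsub>A\<^esub>]\<rparr>)
       (sh_kernel R A))"

definition sh_pure ::
    "('r, 'x) ring_scheme \<Rightarrow> ('r, 'a, 'y) module_scheme \<Rightarrow> 'a list \<Rightarrow> ('a list \<Rightarrow> 'r) set"
  where "sh_pure R A w = sh_kernel R A +>\<^bsub>free_module R (sh_words A)\<^esub> basis_elt R w"

definition sh_operator ::
    "('r, 'x) ring_scheme \<Rightarrow> ('r, 'a, 'y) module_scheme \<Rightarrow> 'r \<Rightarrow>
     ('a list \<Rightarrow> 'r) set \<Rightarrow> ('a list \<Rightarrow> 'r) set"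
  where "sh_operator R A l = quot_lift R (Sh R A l) (\<lambda>w. sh_pure R A (\<one>\<^bsub>A\<^esub> # w))"

text \<open>The image of \<open>\<Delta>\<^sub>A(a)\<close> under the map \<open>A \<otimes> A \<rightarrow> Sh(A) \<otimes> Sh(A)\<close> induced by the inclusion of
  \<open>A\<close> as the words of length one.\<close>

definition sh_comult_letter ::
    "('r, 'x) ring_scheme \<Rightarrow> ('r, 'a, 'y) module_scheme \<Rightarrow> 'r \<Rightarrow> ('a \<Rightarrow> ('a \<times> 'a \<Rightarrow> 'r) set) \<Rightarrow>
     'a \<Rightarrow> (('a list \<Rightarrow> 'r) set \<times> ('a list \<Rightarrow> 'r) set \<Rightarrow> 'r) set"
  where "sh_comult_letter R A l \<Delta>A a =
    tensor_map R (Sh R A l) (Sh R A l) (\<lambda>x. sh_pure R A [x]) (\<lambda>x. sh_pure R A [x]) (\<Delta>A a)"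

text \<open>The value on the empty word is irrelevant.\<close>

fun sh_comult_word ::
    "('r, 'x) ring_scheme \<Rightarrow> ('r, 'a, 'y) module_scheme \<Rightarrow> 'r \<Rightarrow> ('a \<Rightarrow> ('a \<times> 'a \<Rightarrow> 'r) set) \<Rightarrow>
     'a list \<Rightarrow> (('a list \<Rightarrow> 'r) set \<times> ('a list \<Rightarrow> 'r) set \<Rightarrow> 'r) set"
  where
    "sh_comult_word R A l \<Delta>A [] = \<zero>\<^bsub>tensor R (Sh R A l) (Sh R A l)\<^esub>"
  | "sh_comult_word R A l \<Delta>A [a] = sh_comult_letter R A l \<Delta>A a"
  | "sh_comult_word R A l \<Delta>A (a # b # w) =
      sh_comult_letter R A l \<Delta>A a \<otimes>\<^bsub>tensor R (Sh R A l) (Sh R A l)\<^esub>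
      tensor_map R (Sh R A l) (Sh R A l) (\<lambda>x. x) (sh_operator R A l)
        (sh_comult_word R A l \<Delta>A (b # w))"

definition sh_comult ::
    "('r, 'x) ring_scheme \<Rightarrow> ('r, 'a, 'y) module_scheme \<Rightarrow> 'r \<Rightarrow> ('a \<Rightarrow> ('a \<times> 'a \<Rightarrow> 'r) set) \<Rightarrow>
     ('a list \<Rightarrow> 'r) set \<Rightarrow> (('a list \<Rightarrow> 'r) set \<times> ('a list \<Rightarrow> 'r) set \<Rightarrow> 'r) set"
  where "sh_comult R A l \<Delta>A =
    quot_lift R (tensor R (Sh R A l) (Sh R A l)) (sh_comult_word R A l \<Delta>A)"

definition sh_counit ::
    "('r, 'x) ring_scheme \<Rightarrow> ('a \<Rightarrow> 'r) \<Rightarrow> ('a list \<Rightarrow> 'r) set \<Rightarrow> 'r"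
  where "sh_counit R \<epsilon>A =
    quot_lift R (self_module R) (\<lambda>w. if length w = 1 then \<epsilon>A (hd w) else \<zero>\<^bsub>R\<^esub>)"

end

theory Submission
  imports Defs
begin

text \<open>
  Let \<open>E\<close> be multiplication by \<open>\<lambda> - 1\<^sub>A\<close> in \<open>Sh\<^sup>+(A)\<close>. On words of positive length it is
  \<open>w \<mapsto> - 1\<^sub>A \<otimes> w\<close>, and the recursion becomes \<open>au \<odot> bv = a(u \<odot> bv) + b(au \<odot> v) + ab E(u \<odot> v)\<close>.
  Since \<open>E(x) \<odot> y = E(x \<odot> y)\<close>, expanding \<open>(au \<odot> bv) \<odot> cw\<close> gives an expression symmetric in the three
  factors up to products of shorter words, so associativity follows by induction. All this
  holds already for formal combinations of words, where no tensor relations are imposed; the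
  multilinearity relations then generate an ideal.

  \<open>Sh(A)\<close> is spanned by the letters \<open>\<iota>(a)\<close> and the products \<open>\<iota>(a)P(w)\<close>. With \<open>\<kappa> = P(1) - \<lambda>\<close> one has
  \<open>\<kappa>P(x) = P(P(x))\<close> and \<open>P(x)P(y) = P(xP(y) + P(x)y - \<kappa>xy)\<close>, and the operator \<open>Q = id \<otimes> P\<close> satisfies
  the same identities with \<open>1 \<otimes> \<kappa> = \<Delta>(\<kappa>)\<close>. Together with \<open>\<Delta>(\<iota>(a)P(w)) = \<Delta>(\<iota>(a)) Q(\<Delta>(w))\<close> this makes
  \<open>\<Delta>\<close> multiplicative by induction on words. Both sides of the coassociativity and counit laws
  are then algebra homomorphisms that agree on letters and intertwine \<open>Q\<close> with the same operator.
\<close>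

section \<open>Linear and bilinear maps\<close>

text \<open>The obstacle in the recursion is its last term, a product of three factors nested to one
  side. It hides the symmetry of the recursion in \<open>u\<close> and \<open>v\<close>, and it
  would spread through every computation with associativity. The constant
  \<open>\<lambda> - 1\<close> comes from evaluating the inner factor:
  \<open>u \<odot> 1 = 1u + \<lambda>u\<close> for nonempty \<open>u\<close>, where \<open>1\<close>
  is the unit letter. Hence \<open>\<lambda>(u \<odot> v) - (u \<odot> 1) \<odot> v\<close> is an
  operator applied to \<open>u \<odot> v\<close>, provided that the operator commutes with right
  multiplication. This proviso is read off the recursion by cases, before associativity is
  available, so that nothing is circular.

  Only one counit law can be expected. The operator \<open>id \<otimes> P\<close> leaves the left
  factor alone and so commutes with applying the counit there, whereas applying the counit to the
  right factor kills its image, since \<epsilon> vanishes on the image of \<open>P\<close>.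

  Every map out of a quotient is given by values on generators, so each construction carries the
  burden of showing that relations are respected.\<close>

lemma linear_mapsI:
  assumes "\<And>x. x \<in> carrier M \<Longrightarrow> h x \<in> carrier N"
    and "\<And>x y. \<lbrakk>x \<in> carrier M; y \<in> carrier M\<rbrakk> \<Longrightarrow> h (x \<oplus>\<^bsub>M\<^esub> y) = h x \<oplus>\<^bsub>N\<^esub> h y"
    and "\<And>r x. \<lbrakk>r \<in> carrier R; x \<in> carrier M\<rbrakk> \<Longrightarrow> h (r \<odot>\<^bsub>M\<^esub> x) = r \<odot>\<^bsub>N\<^esub> h x"
  shows "h \<in> linear_maps R M N"
  using assms by (auto simp: linear_maps_def)

lemma linear_mapsD:
  assumes "h \<in> linear_maps R M N"
  shows "x \<in> carrier M \<Longrightarrow> h x \<in> carrier N"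
    and "\<lbrakk>x \<in> carrier M; y \<in> carrier M\<rbrakk> \<Longrightarrow> h (x \<oplus>\<^bsub>M\<^esub> y) = h x \<oplus>\<^bsub>N\<^esub> h y"
    and "\<lbrakk>r \<in> carrier R; x \<in> carrier M\<rbrakk> \<Longrightarrow> h (r \<odot>\<^bsub>M\<^esub> x) = r \<odot>\<^bsub>N\<^esub> h x"
  using assms by (auto simp: linear_maps_def)

lemma (in abelian_group) minus_zero_iff:
  "\<lbrakk>x \<in> carrier G; y \<in> carrier G\<rbrakk> \<Longrightarrow> x \<ominus> y = \<zero> \<longleftrightarrow> x = y"
  by (metis add.inv_solve_right add.r_inv l_zero minus_eq zero_closed)

lemma (in module) a_inv_smult: "x \<in> carrier M \<Longrightarrow> \<ominus>\<^bsub>M\<^esub> x = (\<ominus> \<one>) \<odot>\<^bsub>M\<^esub> x"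
  by (simp add: smult_l_minus)

lemma linear_maps_zero:
  assumes "module R M" "module R N" "h \<in> linear_maps R M N"
  shows "h \<zero>\<^bsub>M\<^esub> = \<zero>\<^bsub>N\<^esub>"
proof -
  interpret M: module R M by fact
  interpret N: module R N by fact
  have "h (\<zero>\<^bsub>R\<^esub> \<odot>\<^bsub>M\<^esub> \<zero>\<^bsub>M\<^esub>) = \<zero>\<^bsub>R\<^esub> \<odot>\<^bsub>N\<^esub> h \<zero>\<^bsub>M\<^esub>"
    by (intro linear_mapsD[OF assms(3)]) auto
  thus ?thesis using linear_mapsD(1)[OF assms(3)] by simp
qed

lemma linear_maps_a_inv:
  assumes "module R M" "module R N" "h \<in> linear_maps R M N" "x \<in> carrier M"
  shows "h (\<ominus>\<^bsub>M\<^esub> x) = \<ominus>\<^bsub>N\<^esub> h x"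
proof -
  interpret M: module R M by fact
  interpret N: module R N by fact
  show ?thesis using assms(4) linear_mapsD[OF assms(3)]
    by (simp add: M.a_inv_smult N.a_inv_smult)
qed

lemma linear_maps_minus:
  assumes "module R M" "module R N" "h \<in> linear_maps R M N" "x \<in> carrier M" "y \<in> carrier M"
  shows "h (x \<ominus>\<^bsub>M\<^esub> y) = h x \<ominus>\<^bsub>N\<^esub> h y"
proof -
  interpret M: module R M by fact
  interpret N: module R N by fact
  show ?thesis using assms linear_mapsD[OF assms(3)]
    by (simp add: a_minus_def linear_maps_a_inv[OF assms(1-3)])
qed

text \<open>Membership in \<open>linear_maps\<close> looks only at values on the carrier, so a
  function may be exchanged for one whose linearity is already known there.\<close>

lemma linear_maps_cong:
  assumes "module R M" "h \<in> linear_maps R M N" "\<And>x. x \<in> carrier M \<Longrightarrow> h' x = h x"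
  shows "h' \<in> linear_maps R M N"
proof -
  interpret M: module R M by fact
  show ?thesis
    by (rule linear_mapsI) (simp_all add: assms(3) linear_mapsD[OF assms(2)])
qed

lemma linear_maps_id: "(\<lambda>x. x) \<in> linear_maps R M M"
  by (rule linear_mapsI) auto

lemma linear_maps_comp:
  "\<lbrakk>f \<in> linear_maps R M N; g \<in> linear_maps R N K\<rbrakk> \<Longrightarrow> (\<lambda>x. g (f x)) \<in> linear_maps R M K"
  by (auto intro!: linear_mapsI simp: linear_mapsD)

lemma linear_maps_add:
  assumes "module R N" "f \<in> linear_maps R M N" "g \<in> linear_maps R M N"
  shows "(\<lambda>x. f x \<oplus>\<^bsub>N\<^esub> g x) \<in> linear_maps R M N"
proof -
  interpret N: module R N by fact
  show ?thesis using linear_mapsD[OF assms(2)] linear_mapsD[OF assms(3)]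
    by (intro linear_mapsI) (auto simp: N.a_ac N.smult_r_distr)
qed

lemma linear_maps_smult:
  assumes "module R N" "f \<in> linear_maps R M N" "r \<in> carrier R"
  shows "(\<lambda>x. r \<odot>\<^bsub>N\<^esub> f x) \<in> linear_maps R M N"
proof -
  interpret N: module R N by fact
  show ?thesis using linear_mapsD[OF assms(2)] assms(3)
    by (intro linear_mapsI) (auto simp: N.smult_r_distr N.smult_assoc1[symmetric] N.R.m_comm)
qed

lemma linear_maps_a_inv_fun:
  assumes "module R N" "f \<in> linear_maps R M N"
  shows "(\<lambda>x. \<ominus>\<^bsub>N\<^esub> f x) \<in> linear_maps R M N"
proof -
  interpret N: module R N by fact
  show ?thesis using linear_mapsD[OF assms(2)]
    by (intro linear_mapsI) (auto simp: N.minus_add N.smult_r_minus)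
qed

lemma linear_maps_minus_fun:
  assumes "module R N" "f \<in> linear_maps R M N" "g \<in> linear_maps R M N"
  shows "(\<lambda>x. f x \<ominus>\<^bsub>N\<^esub> g x) \<in> linear_maps R M N"
  unfolding a_minus_def
  by (intro linear_maps_add linear_maps_a_inv_fun assms)

lemma linear_maps_zero_fun:
  assumes "module R N"
  shows "(\<lambda>x. \<zero>\<^bsub>N\<^esub>) \<in> linear_maps R M N"
proof -
  interpret N: module R N by fact
  show ?thesis by (intro linear_mapsI) auto
qed

text \<open>Curried, so that every partial map is itself an element of \<open>linear_maps\<close>
  and the facts about linear maps apply to one argument at a time.\<close>

definition bilinear_maps where
  "bilinear_maps R M N L = {b. (\<forall>x\<in>carrier M. b x \<in> linear_maps R N L) \<and>
     (\<forall>y\<in>carrier N. (\<lambda>x. b x y) \<in> linear_maps R M L)}"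

lemma bilinear_mapsI:
  assumes "\<And>x. x \<in> carrier M \<Longrightarrow> (\<lambda>y. b x y) \<in> linear_maps R N L"
    and "\<And>y. y \<in> carrier N \<Longrightarrow> (\<lambda>x. b x y) \<in> linear_maps R M L"
  shows "b \<in> bilinear_maps R M N L"
  using assms by (auto simp: bilinear_maps_def)

lemma bilinear_mapsD:
  assumes "b \<in> bilinear_maps R M N L"
  shows "x \<in> carrier M \<Longrightarrow> b x \<in> linear_maps R N L"
    and "y \<in> carrier N \<Longrightarrow> (\<lambda>x. b x y) \<in> linear_maps R M L"
  using assms by (auto simp: bilinear_maps_def)

lemma bilinear_maps_closed:
  assumes "b \<in> bilinear_maps R M N L" "x \<in> carrier M" "y \<in> carrier N"
  shows "b x y \<in> carrier L"
  using linear_mapsD(1)[OF bilinear_mapsD(1)] assms .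

lemma bilinear_maps_comp:
  assumes "b \<in> bilinear_maps R M N L" "f \<in> linear_maps R M' M" "g \<in> linear_maps R N' N"
    "h \<in> linear_maps R L L'"
  shows "(\<lambda>x y. h (b (f x) (g y))) \<in> bilinear_maps R M' N' L'"
proof (rule bilinear_mapsI)
  fix x assume "x \<in> carrier M'"
  hence 1: "b (f x) \<in> linear_maps R N L"
    using bilinear_mapsD(1)[OF assms(1)] linear_mapsD(1)[OF assms(2)] by blast
  show "(\<lambda>y. h (b (f x) (g y))) \<in> linear_maps R N' L'"
    by (rule linear_maps_comp[OF linear_maps_comp[OF assms(3) 1] assms(4)])
next
  fix y assume "y \<in> carrier N'"
  hence 1: "(\<lambda>x. b x (g y)) \<in> linear_maps R M L"
    using bilinear_mapsD(2)[OF assms(1)] linear_mapsD(1)[OF assms(3)] by blast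
  show "(\<lambda>x. h (b (f x) (g y))) \<in> linear_maps R M' L'"
    by (rule linear_maps_comp[OF linear_maps_comp[OF assms(2) 1] assms(4)])
qed

lemma bilinear_maps_flip:
  "b \<in> bilinear_maps R M N L \<Longrightarrow> (\<lambda>x y. b y x) \<in> bilinear_maps R N M L"
  by (auto simp: bilinear_maps_def)

lemma bilinear_maps_add:
  assumes "module R L" "b \<in> bilinear_maps R M N L" "c \<in> bilinear_maps R M N L"
  shows "(\<lambda>x y. b x y \<oplus>\<^bsub>L\<^esub> c x y) \<in> bilinear_maps R M N L"
  by (intro bilinear_mapsI linear_maps_add assms(1) bilinear_mapsD[OF assms(2)]
      bilinear_mapsD[OF assms(3)])

lemma (in algebra) mult_bilinear: "mult M \<in> bilinear_maps R M M M"
proof (intro bilinear_mapsI linear_mapsI)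
  fix x y r assume *: "x \<in> carrier M" "y \<in> carrier M" "r \<in> carrier R"
  show "x \<otimes>\<^bsub>M\<^esub> (r \<odot>\<^bsub>M\<^esub> y) = r \<odot>\<^bsub>M\<^esub> (x \<otimes>\<^bsub>M\<^esub> y)"
    using * smult_assoc2 by (simp add: m_comm)
qed (auto simp: l_distr r_distr smult_assoc2)

section \<open>Spanning sets\<close>

lemma submodule_preimage:
  assumes "module R M" "module R N" "h \<in> linear_maps R M N" "submodule K R N"
  shows "submodule {x \<in> carrier M. h x \<in> K} R M"
proof -
  interpret M: module R M by fact
  interpret N: module R N by fact
  note K = N.submoduleE[OF assms(4)]
  have "\<zero>\<^bsub>N\<^esub> \<in> K" using assms(4) subgroup.one_closed[of K "add_monoid N"]
    by (simp add: submodule_def)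
  thus ?thesis
    using linear_mapsD[OF assms(3)] linear_maps_zero[OF assms(1-3)]
      linear_maps_a_inv[OF assms(1-3)] K
    by (intro M.submoduleI) auto
qed

lemma (in module) submodule_zero: "submodule {\<zero>\<^bsub>M\<^esub>} R M"
  by (rule submoduleI) auto

lemma (in module) submodule_zero_closed: "submodule K R M \<Longrightarrow> \<zero>\<^bsub>M\<^esub> \<in> K"
  using subgroup.one_closed[of K "add_monoid M"] by (simp add: submodule_def)

lemma (in module) submodule_minus_closed:
  "\<lbrakk>submodule K R M; x \<in> K; y \<in> K\<rbrakk> \<Longrightarrow> x \<ominus>\<^bsub>M\<^esub> y \<in> K"
  using submoduleE[of K] by (simp add: a_minus_def)

text \<open>The equalizer is the preimage of the zero submodule under the difference of the two
  maps.\<close>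

lemma submodule_equalizer:
  assumes "module R M" "module R N" "f \<in> linear_maps R M N" "g \<in> linear_maps R M N"
  shows "submodule {x \<in> carrier M. f x = g x} R M"
proof -
  interpret N: module R N by fact
  have "{x \<in> carrier M. f x = g x} = {x \<in> carrier M. f x \<ominus>\<^bsub>N\<^esub> g x \<in> {\<zero>\<^bsub>N\<^esub>}}"
    using linear_mapsD(1)[OF assms(3)] linear_mapsD(1)[OF assms(4)] by (auto simp: N.minus_zero_iff)
  thus ?thesis
    using submodule_preimage[OF assms(1,2) linear_maps_minus_fun[OF assms(2-4)] N.submodule_zero]
    by simp
qed

lemma submodule_spanI: "\<lbrakk>\<And>N. \<lbrakk>submodule N R M; S \<subseteq> N\<rbrakk> \<Longrightarrow> x \<in> N\<rbrakk> \<Longrightarrow> x \<in> submodule_span R M S"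
  by (auto simp: submodule_span_def)

lemma submodule_span_least: "\<lbrakk>submodule N R M; S \<subseteq> N\<rbrakk> \<Longrightarrow> submodule_span R M S \<subseteq> N"
  by (auto simp: submodule_span_def)

lemma submodule_span_superset: "S \<subseteq> submodule_span R M S"
  by (auto simp: submodule_span_def)

lemma (in module) submodule_span_submodule:
  assumes "S \<subseteq> carrier M"
  shows "submodule (submodule_span R M S) R M"
proof (rule submoduleI)
  show "submodule_span R M S \<subseteq> carrier M"
    using assms carrier_is_submodule by (rule submodule_span_least[rotated])
next
  fix a b x
  show "\<zero>\<^bsub>M\<^esub> \<in> submodule_span R M S"
    by (intro submodule_spanI submodule_zero_closed)
  show "\<ominus>\<^bsub>M\<^esub> x \<in> submodule_span R M S" if "x \<in> submodule_span R M S"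
    using that submoduleE(3) unfolding submodule_span_def by blast
  show "x \<oplus>\<^bsub>M\<^esub> b \<in> submodule_span R M S"
    if "x \<in> submodule_span R M S" "b \<in> submodule_span R M S"
    using that submoduleE(5) unfolding submodule_span_def by blast
  show "a \<odot>\<^bsub>M\<^esub> x \<in> submodule_span R M S" if "a \<in> carrier R" "x \<in> submodule_span R M S"
    using that submoduleE(4) unfolding submodule_span_def by blast
qed

definition spans where
  "spans R M S \<longleftrightarrow> S \<subseteq> carrier M \<and> submodule_span R M S = carrier M"

lemma (in module) spansI:
  "\<lbrakk>S \<subseteq> carrier M; \<And>N. \<lbrakk>submodule N R M; S \<subseteq> N\<rbrakk> \<Longrightarrow> carrier M \<subseteq> N\<rbrakk> \<Longrightarrow> spans R M S"
  unfolding spans_def using submodule_span_submodule[of S] submoduleE(1) submodule_span_superset[of S R M]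
  by blast

lemma spansD: "\<lbrakk>spans R M S; submodule N R M; S \<subseteq> N\<rbrakk> \<Longrightarrow> carrier M \<subseteq> N"
  using submodule_span_least[of N R M S] unfolding spans_def by blast

lemma spans_closed: "\<lbrakk>spans R M S; s \<in> S\<rbrakk> \<Longrightarrow> s \<in> carrier M"
  by (auto simp: spans_def)

text \<open>The elements with property \<open>Q\<close> form a submodule; its closure under negation
  comes from \<open>smult\<close> with the scalar \<open>- \<one>\<close>.\<close>

lemma spans_induct [consumes 3, case_names base add smult zero]:
  assumes "module R M" "spans R M S" "x \<in> carrier M"
    and base: "\<And>s. s \<in> S \<Longrightarrow> Q s"
    and add: "\<And>x y. \<lbrakk>x \<in> carrier M; y \<in> carrier M; Q x; Q y\<rbrakk> \<Longrightarrow> Q (x \<oplus>\<^bsub>M\<^esub> y)"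
    and smult: "\<And>r x. \<lbrakk>r \<in> carrier R; x \<in> carrier M; Q x\<rbrakk> \<Longrightarrow> Q (r \<odot>\<^bsub>M\<^esub> x)"
    and zero: "Q \<zero>\<^bsub>M\<^esub>"
  shows "Q x"
proof -
  interpret M: module R M by fact
  have "submodule {x \<in> carrier M. Q x} R M"
  proof (rule M.submoduleI)
    fix a assume "a \<in> {x \<in> carrier M. Q x}"
    thus "\<ominus>\<^bsub>M\<^esub> a \<in> {x \<in> carrier M. Q x}"
      using smult[of "\<ominus>\<^bsub>R\<^esub> \<one>\<^bsub>R\<^esub>" a] by (simp add: M.a_inv_smult)
  qed (use add smult zero in auto)
  moreover have "S \<subseteq> {x \<in> carrier M. Q x}" using base spans_closed[OF assms(2)] by auto
  ultimately have "carrier M \<subseteq> {x \<in> carrier M. Q x}" by (rule spansD[OF assms(2)])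
  thus ?thesis using assms(3) by blast
qed

lemma spans_image:
  assumes "module R M" "module R N" "h \<in> linear_maps R M N" "h ` carrier M = carrier N"
    "spans R M S"
  shows "spans R N (h ` S)"
proof -
  interpret N: module R N by fact
  show ?thesis
  proof (rule N.spansI)
    fix K assume K: "submodule K R N" "h ` S \<subseteq> K"
    have "carrier M \<subseteq> {x \<in> carrier M. h x \<in> K}"
      by (rule spansD[OF assms(5) submodule_preimage[OF assms(1-3) K(1)]])
        (use K(2) spans_closed[OF assms(5)] in auto)
    thus "carrier N \<subseteq> K" unfolding assms(4)[symmetric] by blast
  qed (use spans_closed[OF assms(5)] linear_mapsD(1)[OF assms(3)] in blast)
qed

lemma linear_maps_eqI:
  assumes "module R M" "module R N" "spans R M S" "f \<in> linear_maps R M N" "g \<in> linear_maps R M N"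
    "\<And>s. s \<in> S \<Longrightarrow> f s = g s" "x \<in> carrier M"
  shows "f x = g x"
proof -
  have "carrier M \<subseteq> {x \<in> carrier M. f x = g x}"
    by (rule spansD[OF assms(3) submodule_equalizer[OF assms(1,2,4,5)]])
      (simp add: subset_iff assms(6) spans_closed[OF assms(3)])
  thus ?thesis using assms(7) by blast
qed

lemma bilinear_maps_eqI:
  assumes "module R M" "module R N" "module R L" "spans R M S" "spans R N S'"
    "b \<in> bilinear_maps R M N L" "c \<in> bilinear_maps R M N L"
    "\<And>s t. \<lbrakk>s \<in> S; t \<in> S'\<rbrakk> \<Longrightarrow> b s t = c s t" "x \<in> carrier M" "y \<in> carrier N"
  shows "b x y = c x y"
proof -
  have "b s y = c s y" if "s \<in> S" for s
    by (rule linear_maps_eqI[OF assms(2,3,5) bilinear_mapsD(1)[OF assms(6)]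
        bilinear_mapsD(1)[OF assms(7)]]) (simp_all add: that spans_closed[OF assms(4)] assms(8,10))
  thus ?thesis
    by (rule linear_maps_eqI[OF assms(1,3,4) bilinear_mapsD(2)[OF assms(6,10)]
        bilinear_mapsD(2)[OF assms(7,10)]]) (simp_all add: assms(9))
qed

text \<open>This is the device for ideals: with relations as \<open>S\<close> and their span as
  \<open>K\<close>, products need only be checked for a relation against a spanning element.\<close>

lemma submodule_bilinear:
  assumes "module R M" "module R N" "module R L" "spans R N S'"
    "b \<in> bilinear_maps R M N L" "submodule K R L" "S \<subseteq> carrier M"
    "\<And>s t. \<lbrakk>s \<in> S; t \<in> S'\<rbrakk> \<Longrightarrow> b s t \<in> K"
    "x \<in> submodule_span R M S" "y \<in> carrier N"
  shows "b x y \<in> K"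
proof -
  have 1: "b s y \<in> K" if "s \<in> S" for s
  proof -
    have "carrier N \<subseteq> {y \<in> carrier N. b s y \<in> K}"
      by (rule spansD[OF assms(4) submodule_preimage[OF assms(2,3) bilinear_mapsD(1)[OF assms(5)]
          assms(6)]]) (use that assms(7,8) spans_closed[OF assms(4)] in auto)
    thus ?thesis using assms(10) by blast
  qed
  have "submodule_span R M S \<subseteq> {x \<in> carrier M. b x y \<in> K}"
    by (rule submodule_span_least[OF submodule_preimage[OF assms(1,3)
          bilinear_mapsD(2)[OF assms(5)] assms(6)]]) (use assms(7,10) 1 in auto)
  thus ?thesis using assms(9) by blast
qed

section \<open>Algebra laws and homomorphisms tested on spanning sets\<close>

lemma algebraI_spans:
  assumes M: "module R M" and bil: "mult M \<in> bilinear_maps R M M M" and S: "spans R M S"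
    and one: "\<one>\<^bsub>M\<^esub> \<in> carrier M"
    and assoc: "\<And>x y z. \<lbrakk>x \<in> S; y \<in> S; z \<in> S\<rbrakk> \<Longrightarrow> x \<otimes>\<^bsub>M\<^esub> y \<otimes>\<^bsub>M\<^esub> z = x \<otimes>\<^bsub>M\<^esub> (y \<otimes>\<^bsub>M\<^esub> z)"
    and comm: "\<And>x y. \<lbrakk>x \<in> S; y \<in> S\<rbrakk> \<Longrightarrow> x \<otimes>\<^bsub>M\<^esub> y = y \<otimes>\<^bsub>M\<^esub> x"
    and unit: "\<And>x. x \<in> S \<Longrightarrow> \<one>\<^bsub>M\<^esub> \<otimes>\<^bsub>M\<^esub> x = x"
  shows "algebra R M"
proof -
  interpret M: module R M by fact
  note closed = bilinear_maps_closed[OF bil]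
  note lin1 = bilinear_mapsD(1)[OF bil]
  note lin2 = bilinear_mapsD(2)[OF bil]
  note Sc = spans_closed[OF S]
  have comm': "x \<otimes>\<^bsub>M\<^esub> y = y \<otimes>\<^bsub>M\<^esub> x" if "x \<in> carrier M" "y \<in> carrier M" for x y
    using bilinear_maps_eqI[OF M M M S S bil bilinear_maps_flip[OF bil] comm that] .
  have unit': "\<one>\<^bsub>M\<^esub> \<otimes>\<^bsub>M\<^esub> x = x" if "x \<in> carrier M" for x
    using linear_maps_eqI[OF M M S lin1[OF one] linear_maps_id unit that] .
  \<comment> \<open>Associativity is released from the spanning set one variable at a time; each
    step fixes the other two factors and compares two linear maps.\<close>
  have a1: "x \<otimes>\<^bsub>M\<^esub> y \<otimes>\<^bsub>M\<^esub> z = x \<otimes>\<^bsub>M\<^esub> (y \<otimes>\<^bsub>M\<^esub> z)"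
    if "x \<in> carrier M" "y \<in> S" "z \<in> S" for x y z
    by (rule linear_maps_eqI[OF M M S, where f = "\<lambda>x. x \<otimes>\<^bsub>M\<^esub> y \<otimes>\<^bsub>M\<^esub> z" and g = "\<lambda>x. x \<otimes>\<^bsub>M\<^esub> (y \<otimes>\<^bsub>M\<^esub> z)",
        OF linear_maps_comp[OF lin2[of y] lin2[of z]] lin2])
      (auto simp: Sc that closed assoc)
  have a2: "x \<otimes>\<^bsub>M\<^esub> y \<otimes>\<^bsub>M\<^esub> z = x \<otimes>\<^bsub>M\<^esub> (y \<otimes>\<^bsub>M\<^esub> z)"
    if "x \<in> carrier M" "y \<in> carrier M" "z \<in> S" for x y z
    by (rule linear_maps_eqI[OF M M S, where f = "\<lambda>y. x \<otimes>\<^bsub>M\<^esub> y \<otimes>\<^bsub>M\<^esub> z" and g = "\<lambda>y. x \<otimes>\<^bsub>M\<^esub> (y \<otimes>\<^bsub>M\<^esub> z)",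
        OF linear_maps_comp[OF lin1[of x] lin2[of z]] linear_maps_comp[OF lin2 lin1]])
      (auto simp: Sc that closed a1)
  have a3: "x \<otimes>\<^bsub>M\<^esub> y \<otimes>\<^bsub>M\<^esub> z = x \<otimes>\<^bsub>M\<^esub> (y \<otimes>\<^bsub>M\<^esub> z)"
    if "x \<in> carrier M" "y \<in> carrier M" "z \<in> carrier M" for x y z
    by (rule linear_maps_eqI[OF M M S, where f = "\<lambda>z. x \<otimes>\<^bsub>M\<^esub> y \<otimes>\<^bsub>M\<^esub> z" and g = "\<lambda>z. x \<otimes>\<^bsub>M\<^esub> (y \<otimes>\<^bsub>M\<^esub> z)",
        OF lin1 linear_maps_comp[OF lin1 lin1]])
      (auto simp: Sc that closed a2)
  have "comm_monoid M"
    by (rule comm_monoidI) (fact closed one a3 unit' comm')+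
  moreover have "(x \<oplus>\<^bsub>M\<^esub> y) \<otimes>\<^bsub>M\<^esub> z = x \<otimes>\<^bsub>M\<^esub> z \<oplus>\<^bsub>M\<^esub> y \<otimes>\<^bsub>M\<^esub> z"
    if "x \<in> carrier M" "y \<in> carrier M" "z \<in> carrier M" for x y z
    by (rule linear_mapsD(2)[OF lin2[OF that(3)] that(1,2)])
  ultimately have "cring M"
    by (intro cringI M.abelian_group_axioms)
  moreover have "(r \<odot>\<^bsub>M\<^esub> x) \<otimes>\<^bsub>M\<^esub> y = r \<odot>\<^bsub>M\<^esub> (x \<otimes>\<^bsub>M\<^esub> y)"
    if "r \<in> carrier R" "x \<in> carrier M" "y \<in> carrier M" for r x y
    using linear_mapsD(3)[OF lin2] that by blast
  ultimately show ?thesis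
    by (intro algebraI M.R.cring_axioms)
      (auto simp: M.smult_l_distr M.smult_r_distr M.smult_assoc1)
qed

lemma algebra_homs_spansI:
  assumes M: "algebra R M" and N: "algebra R N" and h: "h \<in> linear_maps R M N" and S: "spans R M S"
    and one: "h \<one>\<^bsub>M\<^esub> = \<one>\<^bsub>N\<^esub>"
    and mult: "\<And>x y. \<lbrakk>x \<in> S; y \<in> S\<rbrakk> \<Longrightarrow> h (x \<otimes>\<^bsub>M\<^esub> y) = h x \<otimes>\<^bsub>N\<^esub> h y"
  shows "h \<in> algebra_homs R M N"
proof -
  interpret M: algebra R M by fact
  interpret N: algebra R N by fact
  have "h (x \<otimes>\<^bsub>M\<^esub> y) = h x \<otimes>\<^bsub>N\<^esub> h y" if "x \<in> carrier M" "y \<in> carrier M" for x y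
    using bilinear_maps_eqI[OF M.module M.module N.module S S
      bilinear_maps_comp[OF M.mult_bilinear linear_maps_id linear_maps_id h]
      bilinear_maps_comp[OF N.mult_bilinear h h linear_maps_id] mult that] .
  thus ?thesis using h one
    by (auto simp: algebra_homs_def intro!: ring_hom_memI linear_mapsD(1,2)[OF h])
qed

lemma algebra_homsD:
  assumes "h \<in> algebra_homs R M N"
  shows "h \<in> linear_maps R M N" "h \<one>\<^bsub>M\<^esub> = \<one>\<^bsub>N\<^esub>"
    "\<lbrakk>x \<in> carrier M; y \<in> carrier M\<rbrakk> \<Longrightarrow> h (x \<otimes>\<^bsub>M\<^esub> y) = h x \<otimes>\<^bsub>N\<^esub> h y"
  using assms by (auto simp: algebra_homs_def ring_hom_def)

section \<open>Free modules\<close>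

text \<open>Functions vanish outside \<open>X\<close>, so their values may be required to lie in the
  ring at all indices; this removes side conditions from later sums.\<close>

lemma free_module_carrier:
  assumes "cring R"
  shows "f \<in> carrier (free_module R X) \<longleftrightarrow>
    (\<forall>i. f i \<in> carrier R) \<and> (\<forall>i. i \<notin> X \<longrightarrow> f i = \<zero>\<^bsub>R\<^esub>) \<and> finite {i. f i \<noteq> \<zero>\<^bsub>R\<^esub>}"
proof -
  interpret cring R by fact
  show ?thesis unfolding free_module_def by simp (metis zero_closed)
qed

lemma free_module_simps:
  "\<zero>\<^bsub>free_module R X\<^esub> = (\<lambda>i. \<zero>\<^bsub>R\<^esub>)"
  "f \<oplus>\<^bsub>free_module R X\<^esub> g = (\<lambda>i. f i \<oplus>\<^bsub>R\<^esub> g i)"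
  "r \<odot>\<^bsub>free_module R X\<^esub> f = (\<lambda>i. r \<otimes>\<^bsub>R\<^esub> f i)"
  by (simp_all add: free_module_def)

lemma module_free_module:
  fixes R (structure)
  assumes "cring R"
  shows "module R (free_module R X)"
proof -
  interpret cring R by fact
  note [simp] = free_module_simps
  note F = free_module_carrier[OF assms, of _ X]
  show ?thesis
  proof (intro moduleI assms abelian_groupI)
    fix f g assume fg: "f \<in> carrier (free_module R X)" "g \<in> carrier (free_module R X)"
    have "finite {i. f i \<oplus> g i \<noteq> \<zero>}"
      by (rule finite_subset[of _ "{i. f i \<noteq> \<zero>} \<union> {i. g i \<noteq> \<zero>}"]) (use fg in \<open>auto simp: F\<close>)
    thus "f \<oplus>\<^bsub>free_module R X\<^esub> g \<in> carrier (free_module R X)"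
      using fg by (simp add: F)
  next
    fix f assume f: "f \<in> carrier (free_module R X)"
    have "{i. \<ominus> f i \<noteq> \<zero>} \<subseteq> {i. f i \<noteq> \<zero>}" by auto
    hence "finite {i. \<ominus> f i \<noteq> \<zero>}" using f by (auto simp: F intro: finite_subset)
    hence "(\<lambda>i. \<ominus> f i) \<in> carrier (free_module R X)" using f by (auto simp: F)
    moreover have "(\<lambda>i. \<ominus> f i) \<oplus>\<^bsub>free_module R X\<^esub> f = \<zero>\<^bsub>free_module R X\<^esub>"
      using f by (auto simp: F l_neg)
    ultimately show "\<exists>g\<in>carrier (free_module R X). g \<oplus>\<^bsub>free_module R X\<^esub> f = \<zero>\<^bsub>free_module R X\<^esub>"
      by blast
  next
    fix r f assume rf: "r \<in> carrier R" "f \<in> carrier (free_module R X)"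
    have "{i. r \<otimes> f i \<noteq> \<zero>} \<subseteq> {i. f i \<noteq> \<zero>}" using rf by auto
    thus "r \<odot>\<^bsub>free_module R X\<^esub> f \<in> carrier (free_module R X)"
      using rf by (auto simp: F intro: finite_subset)
  qed (auto simp: F a_ac l_distr r_distr m_assoc)
qed

lemma basis_elt_closed:
  fixes R (structure)
  assumes "cring R" "i \<in> X"
  shows "basis_elt R i \<in> carrier (free_module R X)"
proof -
  interpret cring R by fact
  have "finite {j. basis_elt R i j \<noteq> \<zero>}"
    by (rule finite_subset[of _ "{i}"]) (auto simp: basis_elt_def)
  thus ?thesis using assms(2)
    by (auto simp: free_module_carrier[OF assms(1)] basis_elt_def)
qed

lemma spans_free_module:
  fixes R (structure)
  assumes "cring R"
  shows "spans R (free_module R X) (basis_elt R ` X)"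
proof -
  interpret cring R by fact
  interpret F: module R "free_module R X" by (rule module_free_module[OF assms])
  note [simp] = free_module_simps
  note F = free_module_carrier[OF assms, of _ X]
  show ?thesis
  proof (rule F.spansI)
    fix N assume N: "submodule N R (free_module R X)" "basis_elt R ` X \<subseteq> N"
    have "f \<in> N" if "finite S" "f \<in> carrier (free_module R X)" "{i. f i \<noteq> \<zero>} \<subseteq> S" for S f
      using that
    proof (induction S arbitrary: f rule: finite_induct)
      case empty
      hence "f = \<zero>\<^bsub>free_module R X\<^esub>" by auto
      thus ?case using F.submodule_zero_closed[OF N(1)] by simp
    next
      case (insert i S)
      \<comment> \<open>\<open>g\<close> is \<open>f\<close> with the coefficient at
        \<open>i\<close> erased. What was erased is a multiple of a basis element if
        \<open>i\<close> lies in \<open>X\<close>, and zero otherwise.\<close>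
      define g where "g = f(i := \<zero>)"
      have "{j. g j \<noteq> \<zero>} \<subseteq> {j. f j \<noteq> \<zero>}" by (auto simp: g_def)
      hence g: "g \<in> carrier (free_module R X)"
        using insert.prems(1) by (auto simp: F g_def intro: finite_subset)
      have gN: "g \<in> N" by (rule insert.IH[OF g]) (use insert.prems(2) in \<open>auto simp: g_def\<close>)
      show ?case
      proof (cases "i \<in> X")
        case True
        have "f = g \<oplus>\<^bsub>free_module R X\<^esub> (f i \<odot>\<^bsub>free_module R X\<^esub> basis_elt R i)"
          using insert.prems(1) by (auto simp: F g_def basis_elt_def)
        thus ?thesis using gN N True F.submoduleE(4,5)[OF N(1)] insert.prems(1)
          by (metis F image_subset_iff)
      next
        case False
        hence "f = g" using insert.prems(1) by (auto simp: F g_def)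
        thus ?thesis using gN by simp
      qed
    qed
    thus "carrier (free_module R X) \<subseteq> N" using F by blast
  qed (auto intro: basis_elt_closed[OF assms])
qed

text \<open>\<open>lin_ext\<close> sums over the support of its argument, which changes under
  addition and scaling; over a common finite superset the sums can be compared termwise.\<close>

lemma lin_ext_superset:
  assumes "module R M" "f \<in> carrier (free_module R X)" "finite S" "{i. f i \<noteq> \<zero>\<^bsub>R\<^esub>} \<subseteq> S"
    "\<And>i. i \<in> S \<Longrightarrow> \<phi> i \<in> carrier M"
  shows "lin_ext R M \<phi> f = finsum M (\<lambda>i. f i \<odot>\<^bsub>M\<^esub> \<phi> i) S"
proof -
  interpret module R M by fact
  note F = free_module_carrier[OF R.cring_axioms, of _ X]
  show ?thesis unfolding lin_ext_def
    by (rule M.add.finprod_mono_neutral_cong_left) (use assms F in auto)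
qed

lemma lin_ext_linear:
  fixes R (structure)
  assumes "module R M" "\<And>i. i \<in> X \<Longrightarrow> \<phi> i \<in> carrier M"
  shows "lin_ext R M \<phi> \<in> linear_maps R (free_module R X) M"
proof -
  interpret module R M by fact
  note [simp] = free_module_simps
  note F = free_module_carrier[OF R.cring_axioms, of _ X]
  interpret F: module R "free_module R X" by (rule module_free_module[OF R.cring_axioms])
  have sub: "{i. f i \<noteq> \<zero>} \<subseteq> X" if "f \<in> carrier (free_module R X)" for f
    using that by (auto simp: F)
  show ?thesis
  proof (rule linear_mapsI)
    fix f assume f: "f \<in> carrier (free_module R X)"
    show "lin_ext R M \<phi> f \<in> carrier M"
      unfolding lin_ext_def using sub[OF f] f assms(2)
      by (intro M.finsum_closed) (auto simp: F)
  next
    fix f g assume fg: "f \<in> carrier (free_module R X)" "g \<in> carrier (free_module R X)"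
    define S where "S = {i. f i \<noteq> \<zero>} \<union> {i. g i \<noteq> \<zero>}"
    have S: "finite S" "S \<subseteq> X" using fg sub by (auto simp: S_def F)
    have \<phi>S: "\<And>i. i \<in> S \<Longrightarrow> \<phi> i \<in> carrier M" using S assms(2) by auto
    have "lin_ext R M \<phi> (f \<oplus>\<^bsub>free_module R X\<^esub> g) =
        finsum M (\<lambda>i. (f \<oplus>\<^bsub>free_module R X\<^esub> g) i \<odot>\<^bsub>M\<^esub> \<phi> i) S"
      by (rule lin_ext_superset[OF assms(1) F.M.add.m_closed[OF fg] S(1) _ \<phi>S])
        (use fg in \<open>auto simp: S_def F\<close>)
    also have "\<dots> = finsum M (\<lambda>i. f i \<odot>\<^bsub>M\<^esub> \<phi> i \<oplus>\<^bsub>M\<^esub> g i \<odot>\<^bsub>M\<^esub> \<phi> i) S"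
      by (rule M.finsum_cong') (use fg \<phi>S in \<open>auto simp: F smult_l_distr\<close>)
    also have "\<dots> = finsum M (\<lambda>i. f i \<odot>\<^bsub>M\<^esub> \<phi> i) S \<oplus>\<^bsub>M\<^esub> finsum M (\<lambda>i. g i \<odot>\<^bsub>M\<^esub> \<phi> i) S"
      by (rule M.finsum_addf) (use fg \<phi>S in \<open>auto simp: F\<close>)
    also have "\<dots> = lin_ext R M \<phi> f \<oplus>\<^bsub>M\<^esub> lin_ext R M \<phi> g"
      using lin_ext_superset[OF assms(1) fg(1) S(1) _ \<phi>S] lin_ext_superset[OF assms(1) fg(2) S(1) _ \<phi>S]
      by (simp add: S_def)
    finally show "lin_ext R M \<phi> (f \<oplus>\<^bsub>free_module R X\<^esub> g) = lin_ext R M \<phi> f \<oplus>\<^bsub>M\<^esub> lin_ext R M \<phi> g" .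
  next
    fix r f assume rf: "r \<in> carrier R" "f \<in> carrier (free_module R X)"
    define S where "S = {i. f i \<noteq> \<zero>}"
    have S: "finite S" "S \<subseteq> X" using rf sub by (auto simp: S_def F)
    have \<phi>S: "\<And>i. i \<in> S \<Longrightarrow> \<phi> i \<in> carrier M" using S assms(2) by auto
    have "lin_ext R M \<phi> (r \<odot>\<^bsub>free_module R X\<^esub> f) =
        finsum M (\<lambda>i. (r \<odot>\<^bsub>free_module R X\<^esub> f) i \<odot>\<^bsub>M\<^esub> \<phi> i) S"
      by (rule lin_ext_superset[OF assms(1) F.smult_closed[OF rf] S(1) _ \<phi>S])
        (use rf in \<open>auto simp: S_def F\<close>)
    also have "\<dots> = finsum M (\<lambda>i. r \<odot>\<^bsub>M\<^esub> (f i \<odot>\<^bsub>M\<^esub> \<phi> i)) S"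
      by (rule M.finsum_cong') (use rf \<phi>S in \<open>auto simp: F smult_assoc1\<close>)
    also have "\<dots> = r \<odot>\<^bsub>M\<^esub> lin_ext R M \<phi> f"
      unfolding lin_ext_def S_def[symmetric]
      by (rule finsum_smult_ldistr[symmetric]) (use rf \<phi>S S in \<open>auto simp: F\<close>)
    finally show "lin_ext R M \<phi> (r \<odot>\<^bsub>free_module R X\<^esub> f) = r \<odot>\<^bsub>M\<^esub> lin_ext R M \<phi> f" .
  qed
qed

lemma lin_ext_basis:
  assumes "module R M" "\<phi> i \<in> carrier M"
  shows "lin_ext R M \<phi> (basis_elt R i) = \<phi> i"
proof -
  interpret module R M by fact
  \<comment> \<open>In the zero ring the support of a basis element is empty, so the sum is taken
    over the superset \<open>{i}\<close> instead.\<close>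
  have "lin_ext R M \<phi> (basis_elt R i) = finsum M (\<lambda>j. basis_elt R i j \<odot>\<^bsub>M\<^esub> \<phi> j) {i}"
    by (rule lin_ext_superset[OF assms(1) basis_elt_closed[OF R.cring_axioms, of i "{i}"]])
      (use assms(2) in \<open>auto simp: basis_elt_def\<close>)
  also have "\<dots> = basis_elt R i i \<odot>\<^bsub>M\<^esub> \<phi> i"
    using assms(2) by (subst M.finsum_insert) (auto simp: basis_elt_def)
  finally show ?thesis using assms(2) by (simp add: basis_elt_def)
qed

lemma free_linear_maps_eqI:
  assumes "module R M" "f \<in> linear_maps R (free_module R X) M" "g \<in> linear_maps R (free_module R X) M"
    "\<And>i. i \<in> X \<Longrightarrow> f (basis_elt R i) = g (basis_elt R i)" "x \<in> carrier (free_module R X)"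
  shows "f x = g x"
proof -
  interpret module R M by fact
  show ?thesis
    by (rule linear_maps_eqI[OF module_free_module[OF R.cring_axioms] assms(1)
          spans_free_module[OF R.cring_axioms] assms(2,3) _ assms(5)]) (use assms(4) in auto)
qed

text \<open>The definition is an extension in the first argument, so linearity in \<open>f\<close>
  is immediate. Linearity in the second argument is obtained by induction over \<open>f\<close>: on
  a basis element the map is a \<open>lin_ext\<close>, and linear maps are closed under linear
  combinations.\<close>

lemma bilin_ext_bilinear:
  assumes "module R M" "\<And>i j. \<lbrakk>i \<in> X; j \<in> Y\<rbrakk> \<Longrightarrow> \<phi> i j \<in> carrier M"
  shows "bilin_ext R M \<phi> \<in> bilinear_maps R (free_module R X) (free_module R Y) M"
proof -
  interpret module R M by fact
  let ?FX = "free_module R X" and ?FY = "free_module R Y"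
  interpret FX: module R "free_module R X" by (rule module_free_module[OF R.cring_axioms])
  interpret FY: module R "free_module R Y" by (rule module_free_module[OF R.cring_axioms])
  have lin: "lin_ext R M (\<phi> i) \<in> linear_maps R ?FY M" if "i \<in> X" for i
    using that by (intro lin_ext_linear assms)
  have lin': "(\<lambda>f. bilin_ext R M \<phi> f g) \<in> linear_maps R ?FX M" if "g \<in> carrier ?FY" for g
    unfolding bilin_ext_def by (rule lin_ext_linear[OF assms(1)]) (rule linear_mapsD(1)[OF lin that])
  show ?thesis
  proof (rule bilinear_mapsI[OF _ lin'])
    fix f assume "f \<in> carrier ?FX"
    with FX.module_axioms spans_free_module[OF R.cring_axioms, of X]
    show "bilin_ext R M \<phi> f \<in> linear_maps R ?FY M"
    proof (induction f rule: spans_induct)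
      case (base s)
      then obtain i where i: "i \<in> X" "s = basis_elt R i" by blast
      show ?case
      proof (rule linear_maps_cong[OF FY.module_axioms lin[OF i(1)]])
        fix y assume "y \<in> carrier ?FY"
        thus "bilin_ext R M \<phi> s y = lin_ext R M (\<phi> i) y"
          unfolding bilin_ext_def i(2)
          by (intro lin_ext_basis assms(1)) (rule linear_mapsD(1)[OF lin[OF i(1)]])
      qed
    next
      case (add f g)
      show ?case
        by (rule linear_maps_cong[OF FY.module_axioms linear_maps_add[OF assms(1) add(3,4)]])
          (rule linear_mapsD(2)[OF lin' add(1,2)])
    next
      case (smult r f)
      show ?case
        by (rule linear_maps_cong[OF FY.module_axioms linear_maps_smult[OF assms(1) smult(3,1)]])
          (rule linear_mapsD(3)[OF lin' smult(1,2)])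
    next
      case zero
      show ?case
        by (rule linear_maps_cong[OF FY.module_axioms linear_maps_zero_fun[OF assms(1)]])
          (rule linear_maps_zero[OF FX.module_axioms assms(1) lin'])
    qed
  qed
qed

section \<open>Quotient modules\<close>

lemma (in module) submodule_abelian_subgroup:
  assumes "submodule N R M"
  shows "abelian_subgroup N M"
  using assms by (intro abelian_subgroupI3[OF _ M.abelian_group_axioms] additive_subgroup.intro)
    (simp add: submodule_def)

lemma (in module) a_r_coset_rep:
  assumes "submodule N R M" "x \<in> carrier M" "y \<in> N +>\<^bsub>M\<^esub> x"
  shows "y \<in> carrier M" "y \<ominus>\<^bsub>M\<^esub> x \<in> N"
proof -
  note N = submoduleE[OF assms(1)]
  obtain h where h: "h \<in> N" "y = h \<oplus>\<^bsub>M\<^esub> x"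
    using assms(3) by (auto simp: a_r_coset_def r_coset_def)
  have hM: "h \<in> carrier M" using h(1) N(1) by blast
  show "y \<in> carrier M" using h(2) hM assms(2) by simp
  have "y \<ominus>\<^bsub>M\<^esub> x = h" using h(2) hM assms(2)
    by (simp add: M.minus_eq M.a_assoc M.r_neg)
  thus "y \<ominus>\<^bsub>M\<^esub> x \<in> N" using h(1) by simp
qed

lemma (in module) a_r_coset_self:
  assumes "submodule N R M" "x \<in> carrier M"
  shows "x \<in> N +>\<^bsub>M\<^esub> x"
  by (rule abelian_subgroup.a_rcos_self[OF submodule_abelian_subgroup[OF assms(1)] assms(2)])

lemma (in module) a_r_coset_eq_iff:
  assumes "submodule N R M" "x \<in> carrier M" "y \<in> carrier M"
  shows "N +>\<^bsub>M\<^esub> x = N +>\<^bsub>M\<^esub> y \<longleftrightarrow> x \<ominus>\<^bsub>M\<^esub> y \<in> N"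
proof
  assume "N +>\<^bsub>M\<^esub> x = N +>\<^bsub>M\<^esub> y"
  thus "x \<ominus>\<^bsub>M\<^esub> y \<in> N"
    using a_r_coset_rep(2)[OF assms(1,3)] a_r_coset_self[OF assms(1,2)] by simp
next
  assume *: "x \<ominus>\<^bsub>M\<^esub> y \<in> N"
  have "x = (x \<ominus>\<^bsub>M\<^esub> y) \<oplus>\<^bsub>M\<^esub> y" using assms(2,3) by (simp add: M.minus_eq M.a_assoc M.l_neg)
  hence "x \<in> N +>\<^bsub>M\<^esub> y" using * by (auto simp: a_r_coset_def r_coset_def)
  thus "N +>\<^bsub>M\<^esub> x = N +>\<^bsub>M\<^esub> y"
    using abelian_subgroup.a_repr_independence'[OF submodule_abelian_subgroup[OF assms(1)]] assms(3)
    by metis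
qed

lemma quot_module_simps:
  "carrier (quot_module M N) = (\<lambda>x. N +>\<^bsub>M\<^esub> x) ` carrier M"
  "\<zero>\<^bsub>quot_module M N\<^esub> = N"
  "\<one>\<^bsub>quot_module M N\<^esub> = N +>\<^bsub>M\<^esub> \<one>\<^bsub>M\<^esub>"
  by (auto simp: quot_module_def A_RCOSETS_def RCOSETS_def a_r_coset_def)

lemma (in module) quot_module_add:
  assumes "submodule N R M" "x \<in> carrier M" "y \<in> carrier M"
  shows "(N +>\<^bsub>M\<^esub> x) \<oplus>\<^bsub>quot_module M N\<^esub> (N +>\<^bsub>M\<^esub> y) = N +>\<^bsub>M\<^esub> (x \<oplus>\<^bsub>M\<^esub> y)"
  using abelian_subgroup.a_rcos_sum[OF submodule_abelian_subgroup[OF assms(1)] assms(2,3)]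
  by (simp add: quot_module_def)

text \<open>Scalar multiplication and product of a quotient are unions over representatives. Once
  all representatives give the same coset, the union collapses to it.\<close>

lemma UN_const_eq: "\<lbrakk>A \<noteq> {}; \<And>x. x \<in> A \<Longrightarrow> f x = c\<rbrakk> \<Longrightarrow> (\<Union>x\<in>A. f x) = c"
  by simp

lemma (in module) quot_module_smult:
  assumes "submodule N R M" "r \<in> carrier R" "x \<in> carrier M"
  shows "r \<odot>\<^bsub>quot_module M N\<^esub> (N +>\<^bsub>M\<^esub> x) = N +>\<^bsub>M\<^esub> (r \<odot>\<^bsub>M\<^esub> x)"
proof -
  have "N +>\<^bsub>M\<^esub> (r \<odot>\<^bsub>M\<^esub> y) = N +>\<^bsub>M\<^esub> (r \<odot>\<^bsub>M\<^esub> x)" if "y \<in> N +>\<^bsub>M\<^esub> x" for y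
  proof -
    note y = a_r_coset_rep[OF assms(1,3) that]
    have "r \<odot>\<^bsub>M\<^esub> y \<ominus>\<^bsub>M\<^esub> r \<odot>\<^bsub>M\<^esub> x = r \<odot>\<^bsub>M\<^esub> (y \<ominus>\<^bsub>M\<^esub> x)"
      using y(1) assms by (simp add: M.minus_eq smult_r_distr smult_r_minus)
    also have "\<dots> \<in> N" by (rule submoduleE(4)[OF assms(1,2) y(2)])
    finally show ?thesis
      by (simp only: a_r_coset_eq_iff[OF assms(1) smult_closed[OF assms(2) y(1)] smult_closed[OF assms(2,3)]])
  qed
  hence "(\<Union>y\<in>N +>\<^bsub>M\<^esub> x. N +>\<^bsub>M\<^esub> (r \<odot>\<^bsub>M\<^esub> y)) = N +>\<^bsub>M\<^esub> (r \<odot>\<^bsub>M\<^esub> x)"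
    using a_r_coset_self[OF assms(1,3)] by (intro UN_const_eq) blast+
  thus ?thesis by (simp add: quot_module_def)
qed

lemma module_quot_module:
  fixes R (structure) and M (structure)
  assumes "module R M" "submodule N R M"
  shows "module R (quot_module M N)"
proof -
  interpret module R M by fact
  note [simp] = quot_module_add[OF assms(2)] quot_module_smult[OF assms(2)] quot_module_simps
  \<comment> \<open>The zero of the quotient is \<open>N\<close> itself; it has to be recognized as
    the coset of zero before the coset formulas apply to it.\<close>
  have N0: "N = N +>\<^bsub>M\<^esub> \<zero>\<^bsub>M\<^esub>"
    using submoduleE(1)[OF assms(2)] by simp
  show ?thesis
  proof (intro moduleI R.cring_axioms abelian_groupI)
    fix x assume "x \<in> carrier (quot_module M N)"
    then obtain y where y: "y \<in> carrier M" "x = N +>\<^bsub>M\<^esub> y" by auto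
    show "\<zero>\<^bsub>quot_module M N\<^esub> \<oplus>\<^bsub>quot_module M N\<^esub> x = x"
      using y by (simp, subst N0) simp
    have "(N +>\<^bsub>M\<^esub> (\<ominus>\<^bsub>M\<^esub> y)) \<oplus>\<^bsub>quot_module M N\<^esub> x = \<zero>\<^bsub>quot_module M N\<^esub>"
      using y N0 by (simp add: M.l_neg)
    thus "\<exists>z\<in>carrier (quot_module M N). z \<oplus>\<^bsub>quot_module M N\<^esub> x = \<zero>\<^bsub>quot_module M N\<^esub>"
      using y by (auto intro!: bexI[of _ "N +>\<^bsub>M\<^esub> (\<ominus>\<^bsub>M\<^esub> y)"])
  next
    show "\<zero>\<^bsub>quot_module M N\<^esub> \<in> carrier (quot_module M N)"
      using N0 by auto
  qed (auto simp: M.a_ac smult_l_distr smult_r_distr smult_assoc1)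
qed

lemma quot_proj_linear:
  assumes "module R M" "submodule N R M"
  shows "(\<lambda>x. N +>\<^bsub>M\<^esub> x) \<in> linear_maps R M (quot_module M N)"
proof -
  interpret module R M by fact
  show ?thesis
    by (rule linear_mapsI)
      (simp_all add: quot_module_add[OF assms(2)] quot_module_smult[OF assms(2)] quot_module_simps(1))
qed

text \<open>The two representatives are exchanged one after the other. Each exchange alters the
  product by an element of \<open>N\<close> times a factor, which the ideal property
  absorbs.\<close>

lemma quot_module_mult:
  assumes "module R M" "submodule N R M" "mult M \<in> bilinear_maps R M M M"
    and ideal: "\<And>x y. \<lbrakk>x \<in> N; y \<in> carrier M\<rbrakk> \<Longrightarrow> x \<otimes>\<^bsub>M\<^esub> y \<in> N"
      "\<And>x y. \<lbrakk>x \<in> N; y \<in> carrier M\<rbrakk> \<Longrightarrow> y \<otimes>\<^bsub>M\<^esub> x \<in> N"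
    and xy: "x \<in> carrier M" "y \<in> carrier M"
  shows "(N +>\<^bsub>M\<^esub> x) \<otimes>\<^bsub>quot_module M N\<^esub> (N +>\<^bsub>M\<^esub> y) = N +>\<^bsub>M\<^esub> (x \<otimes>\<^bsub>M\<^esub> y)"
proof -
  interpret module R M by fact
  note closed = bilinear_maps_closed[OF assms(3)]
  have "N +>\<^bsub>M\<^esub> (x' \<otimes>\<^bsub>M\<^esub> y') = N +>\<^bsub>M\<^esub> (x \<otimes>\<^bsub>M\<^esub> y)"
    if x': "x' \<in> N +>\<^bsub>M\<^esub> x" and y': "y' \<in> N +>\<^bsub>M\<^esub> y" for x' y'
  proof -
    note xx = a_r_coset_rep[OF assms(2) xy(1) x']
    note yy = a_r_coset_rep[OF assms(2) xy(2) y']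
    have "N +>\<^bsub>M\<^esub> (x' \<otimes>\<^bsub>M\<^esub> y') = N +>\<^bsub>M\<^esub> (x \<otimes>\<^bsub>M\<^esub> y')"
      using ideal(1)[OF xx(2) yy(1)] linear_maps_minus[OF assms(1,1) bilinear_mapsD(2)[OF assms(3) yy(1)] xx(1) xy(1)]
      by (subst a_r_coset_eq_iff[OF assms(2)]) (simp_all add: closed xx yy xy)
    also have "\<dots> = N +>\<^bsub>M\<^esub> (x \<otimes>\<^bsub>M\<^esub> y)"
      using ideal(2)[OF yy(2) xy(1)] linear_maps_minus[OF assms(1,1) bilinear_mapsD(1)[OF assms(3) xy(1)] yy(1) xy(2)]
      by (subst a_r_coset_eq_iff[OF assms(2)]) (simp_all add: closed xx yy xy)
    finally show ?thesis .
  qed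
  hence "(\<Union>x'\<in>N +>\<^bsub>M\<^esub> x. \<Union>y'\<in>N +>\<^bsub>M\<^esub> y. N +>\<^bsub>M\<^esub> (x' \<otimes>\<^bsub>M\<^esub> y')) = N +>\<^bsub>M\<^esub> (x \<otimes>\<^bsub>M\<^esub> y)"
    using a_r_coset_self[OF assms(2)] xy by (intro UN_const_eq) blast+
  thus ?thesis by (simp add: quot_module_def rcoset_mult_def)
qed

lemma quot_module_mult_bilinear:
  assumes "module R M" "submodule N R M" "mult M \<in> bilinear_maps R M M M"
    and ideal: "\<And>x y. \<lbrakk>x \<in> N; y \<in> carrier M\<rbrakk> \<Longrightarrow> x \<otimes>\<^bsub>M\<^esub> y \<in> N"
      "\<And>x y. \<lbrakk>x \<in> N; y \<in> carrier M\<rbrakk> \<Longrightarrow> y \<otimes>\<^bsub>M\<^esub> x \<in> N"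
  shows "mult (quot_module M N) \<in> bilinear_maps R (quot_module M N) (quot_module M N) (quot_module M N)"
proof -
  interpret module R M by fact
  note closed = bilinear_maps_closed[OF assms(3)]
  note mult = quot_module_mult[OF assms]
  note lin1 = linear_mapsD[OF bilinear_mapsD(1)[OF assms(3)]]
  note lin2 = linear_mapsD[OF bilinear_mapsD(2)[OF assms(3)]]
  show ?thesis
  proof (intro bilinear_mapsI linear_mapsI)
  qed (auto simp: quot_module_simps(1) mult quot_module_add[OF assms(2)] quot_module_smult[OF assms(2)]
      closed lin1(2,3) lin2(2,3))
qed

section \<open>Modules given by generators and relations\<close>

text \<open>Both the tensor product and \<open>Sh(A)\<close> are of this shape.\<close>

definition fp_module where
  "fp_module R X S m u = quot_module (free_module R X\<lparr>mult := m, one := u\<rparr>)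
     (submodule_span R (free_module R X) S)"

definition fp_class where
  "fp_class R X S x = submodule_span R (free_module R X) S +>\<^bsub>free_module R X\<^esub> x"

text \<open>Multiplication and unit are written into a free module by record update. Cosets, linear
  maps and submodules depend only on addition and scalars, so this rule and the following ones strip
  the update off.\<close>

lemma a_r_coset_update [simp]: "N +>\<^bsub>M\<lparr>mult := m, one := u\<rparr>\<^esub> x = N +>\<^bsub>M\<^esub> x"
  by (simp add: a_r_coset_def r_coset_def)

lemma linear_maps_update [simp]:
  "linear_maps R (M\<lparr>mult := m, one := u\<rparr>) N = linear_maps R M N"
  "linear_maps R N (M\<lparr>mult := m, one := u\<rparr>) = linear_maps R N M"
  by (simp_all add: linear_maps_def)

lemma bilinear_maps_update [simp]:
  "bilinear_maps R (M\<lparr>mult := m, one := u\<rparr>) (M\<lparr>mult := m, one := u\<rparr>) (M\<lparr>mult := m, one := u\<rparr>) =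
    bilinear_maps R M M M"
  by (simp add: bilinear_maps_def)

lemma module_update: "module R M \<Longrightarrow> module R (M\<lparr>mult := m, one := u\<rparr>)"
  by (simp add: module_def module_axioms_def abelian_group_def abelian_monoid_def
      abelian_group_axioms_def)

lemma submodule_update [simp]:
  "submodule N R (M\<lparr>mult := m, one := u\<rparr>) = submodule N R M"
  by (simp add: submodule_def submodule_axioms_def)

context
  fixes R :: "('r, 'x) ring_scheme" and X :: "'i set" and S :: "('i \<Rightarrow> 'r) set"
  assumes R: "cring R" and S: "S \<subseteq> carrier (free_module R X)"
begin

private lemma F: "module R (free_module R X)"
  by (rule module_free_module[OF R])

private lemma F': "module R (free_module R X\<lparr>mult := m, one := u\<rparr>)"
  by (rule module_update[OF F])

private lemma K: "submodule (submodule_span R (free_module R X) S) R (free_module R X)"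
  by (rule module.submodule_span_submodule[OF F S])

private lemma K': "submodule (submodule_span R (free_module R X) S) R (free_module R X\<lparr>mult := m, one := u\<rparr>)"
  using K by simp

lemma module_fp_module: "module R (fp_module R X S m u)"
  unfolding fp_module_def by (rule module_quot_module[OF F' K'])

lemma fp_class_linear: "fp_class R X S \<in> linear_maps R (free_module R X) (fp_module R X S m u)"
  using quot_proj_linear[OF F' K', of u m] by (simp add: fp_module_def fp_class_def[abs_def])

lemma fp_module_carrier: "carrier (fp_module R X S m u) = fp_class R X S ` carrier (free_module R X)"
  by (simp add: fp_module_def fp_class_def[abs_def] quot_module_simps)

lemma fp_module_one: "\<one>\<^bsub>fp_module R X S m u\<^esub> = fp_class R X S u"
  by (simp add: fp_module_def fp_class_def[abs_def] quot_module_simps)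

lemma fp_spans: "spans R (fp_module R X S m u) ((\<lambda>i. fp_class R X S (basis_elt R i)) ` X)"
  using spans_image[OF F module_fp_module fp_class_linear fp_module_carrier[symmetric]
      spans_free_module[OF R], of m u] by (simp add: image_image)

lemma fp_class_eqI:
  assumes "x \<in> carrier (free_module R X)" "y \<in> carrier (free_module R X)"
    "x \<ominus>\<^bsub>free_module R X\<^esub> y \<in> submodule_span R (free_module R X) S"
  shows "fp_class R X S x = fp_class R X S y"
  unfolding fp_class_def using module.a_r_coset_eq_iff[OF F K assms(1,2)] assms(3) by blast

text \<open>\<open>quot_lift\<close> takes the unique element of an image. The elements killed by
  the extension of \<open>\<phi>\<close> form a submodule containing the relations, so the extension
  is constant on each coset and the image is a singleton.\<close>

lemma
  fixes L :: "('r, 'l, 'z) module_scheme"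
  assumes L: "module R L" and \<phi>: "\<And>i. i \<in> X \<Longrightarrow> \<phi> i \<in> carrier L"
    and rel: "\<And>s. s \<in> S \<Longrightarrow> lin_ext R L \<phi> s = \<zero>\<^bsub>L\<^esub>"
  shows fp_lift_basis: "i \<in> X \<Longrightarrow> quot_lift R L \<phi> (fp_class R X S (basis_elt R i)) = \<phi> i"
    and fp_lift_linear: "quot_lift R L \<phi> \<in> linear_maps R (fp_module R X S m u) L"
proof -
  note lin = lin_ext_linear[OF L \<phi>, of X]
  interpret F: module R "free_module R X" by (rule F)
  interpret L: module R L by (rule L)
  note K1 = F.submoduleE[OF K]
  have 0: "submodule_span R (free_module R X) S \<subseteq> {x \<in> carrier (free_module R X). lin_ext R L \<phi> x \<in> {\<zero>\<^bsub>L\<^esub>}}"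
    by (rule submodule_span_least[OF submodule_preimage[OF F L lin L.submodule_zero]])
      (use S rel in auto)
  have 1: "quot_lift R L \<phi> (fp_class R X S x) = lin_ext R L \<phi> x"
    if x: "x \<in> carrier (free_module R X)" for x
  proof -
    have "lin_ext R L \<phi> y = lin_ext R L \<phi> x" if y: "y \<in> fp_class R X S x" for y
    proof -
      note y' = F.a_r_coset_rep[OF K x y[unfolded fp_class_def]]
      have "lin_ext R L \<phi> y \<ominus>\<^bsub>L\<^esub> lin_ext R L \<phi> x = \<zero>\<^bsub>L\<^esub>"
        using 0 y'(2) linear_maps_minus[OF F L lin y'(1) x] by auto
      thus ?thesis using linear_mapsD(1)[OF lin] y'(1) x by (simp add: L.minus_zero_iff)
    qed
    moreover have "x \<in> fp_class R X S x"
      unfolding fp_class_def by (rule F.a_r_coset_self[OF K x])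
    ultimately have "lin_ext R L \<phi> ` fp_class R X S x = {lin_ext R L \<phi> x}" by blast
    thus ?thesis by (simp add: quot_lift_def)
  qed
  show "quot_lift R L \<phi> (fp_class R X S (basis_elt R i)) = \<phi> i" if "i \<in> X"
    using 1[OF basis_elt_closed[OF R that]] lin_ext_basis[of R L \<phi>, OF L \<phi>[OF that]] by simp
  note cls = linear_mapsD[OF fp_class_linear]
  show "quot_lift R L \<phi> \<in> linear_maps R (fp_module R X S m u) L"
  proof (rule linear_mapsI)
    fix x assume "x \<in> carrier (fp_module R X S m u)"
    thus "quot_lift R L \<phi> x \<in> carrier L"
      using 1 linear_mapsD(1)[OF lin] by (auto simp: fp_module_carrier)
  next
    fix x y assume "x \<in> carrier (fp_module R X S m u)" "y \<in> carrier (fp_module R X S m u)"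
    then obtain x' y' where xy: "x' \<in> carrier (free_module R X)" "y' \<in> carrier (free_module R X)"
      "x = fp_class R X S x'" "y = fp_class R X S y'" by (auto simp: fp_module_carrier)
    show "quot_lift R L \<phi> (x \<oplus>\<^bsub>fp_module R X S m u\<^esub> y) = quot_lift R L \<phi> x \<oplus>\<^bsub>L\<^esub> quot_lift R L \<phi> y"
      unfolding xy(3,4) cls(2)[OF xy(1,2), symmetric]
      by (simp only: 1 xy(1,2) F.M.add.m_closed linear_mapsD(2)[OF lin])
  next
    fix r x assume r: "r \<in> carrier R" and "x \<in> carrier (fp_module R X S m u)"
    then obtain x' where x: "x' \<in> carrier (free_module R X)" "x = fp_class R X S x'"
      by (auto simp: fp_module_carrier)
    show "quot_lift R L \<phi> (r \<odot>\<^bsub>fp_module R X S m u\<^esub> x) = r \<odot>\<^bsub>L\<^esub> quot_lift R L \<phi> x"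
      unfolding x(2) cls(3)[OF r x(1), symmetric]
      by (simp only: 1 x(1) r F.smult_closed linear_mapsD(3)[OF lin])
  qed
qed

text \<open>By bilinearity the span of \<open>S\<close> is a two-sided ideal as soon as it contains
  the products of relations with basis elements on either side; the product then descends to
  cosets.\<close>

lemma
  assumes \<phi>: "\<And>i j. \<lbrakk>i \<in> X; j \<in> X\<rbrakk> \<Longrightarrow> \<phi> i j \<in> carrier (free_module R X)"
    and m: "m = bilin_ext R (free_module R X) \<phi>"
    and ideal: "\<And>s i. \<lbrakk>s \<in> S; i \<in> X\<rbrakk> \<Longrightarrow> m s (basis_elt R i) \<in> submodule_span R (free_module R X) S"
      "\<And>s i. \<lbrakk>s \<in> S; i \<in> X\<rbrakk> \<Longrightarrow> m (basis_elt R i) s \<in> submodule_span R (free_module R X) S"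
  shows fp_mult_bilinear: "mult (fp_module R X S m u) \<in>
      bilinear_maps R (fp_module R X S m u) (fp_module R X S m u) (fp_module R X S m u)"
    and fp_mult_class: "\<lbrakk>x \<in> carrier (free_module R X); y \<in> carrier (free_module R X)\<rbrakk> \<Longrightarrow>
      fp_class R X S x \<otimes>\<^bsub>fp_module R X S m u\<^esub> fp_class R X S y = fp_class R X S (m x y)"
    and fp_mult_basis: "\<lbrakk>i \<in> X; j \<in> X\<rbrakk> \<Longrightarrow>
      fp_class R X S (basis_elt R i) \<otimes>\<^bsub>fp_module R X S m u\<^esub> fp_class R X S (basis_elt R j) =
      fp_class R X S (\<phi> i j)"
proof -
  let ?F = "free_module R X" and ?K = "submodule_span R (free_module R X) S"
  have bil: "m \<in> bilinear_maps R ?F ?F ?F"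
    unfolding m by (rule bilin_ext_bilinear[OF F \<phi>])
  have 1: "m x y \<in> ?K" if "x \<in> ?K" "y \<in> carrier ?F" for x y
    by (rule submodule_bilinear[OF F F F spans_free_module[OF R] bil K S _ that]) (use ideal in auto)
  have 2: "m y x \<in> ?K" if "x \<in> ?K" "y \<in> carrier ?F" for x y
    by (rule submodule_bilinear[OF F F F spans_free_module[OF R] bilinear_maps_flip[OF bil] K S _ that])
      (use ideal in auto)
  show "mult (fp_module R X S m u) \<in>
      bilinear_maps R (fp_module R X S m u) (fp_module R X S m u) (fp_module R X S m u)"
    unfolding fp_module_def
    by (rule quot_module_mult_bilinear[OF F' K']) (use 1 2 bil in simp_all)
  show *: "fp_class R X S x \<otimes>\<^bsub>fp_module R X S m u\<^esub> fp_class R X S y = fp_class R X S (m x y)"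
    if "x \<in> carrier ?F" "y \<in> carrier ?F" for x y
    using quot_module_mult[OF F' K', of u m x y] that 1 2 bil
    by (simp add: fp_module_def fp_class_def)
  have "m (basis_elt R i) (basis_elt R j) = \<phi> i j" if "i \<in> X" "j \<in> X"
    unfolding m bilin_ext_def
    by (simp add: lin_ext_basis[OF F] \<phi> that)
  thus "\<lbrakk>i \<in> X; j \<in> X\<rbrakk> \<Longrightarrow>
      fp_class R X S (basis_elt R i) \<otimes>\<^bsub>fp_module R X S m u\<^esub> fp_class R X S (basis_elt R j) =
      fp_class R X S (\<phi> i j)"
    using *[OF basis_elt_closed[OF R] basis_elt_closed[OF R]] by simp
qed

end

section \<open>Relations read as equations in the quotient\<close>

lemma (in abelian_group) minus_minus_zero:
  "\<lbrakk>x \<in> carrier G; y \<in> carrier G; z \<in> carrier G\<rbrakk> \<Longrightarrow> x \<ominus> y \<ominus> z = \<zero> \<longleftrightarrow> x = y \<oplus> z"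
  using minus_zero_iff[of x "y \<oplus> z"] by (simp add: minus_eq minus_add a_ac)

lemma fp_class_rel:
  assumes "cring R" "S \<subseteq> carrier (free_module R X)" "s \<in> S"
  shows "fp_class R X S s = \<zero>\<^bsub>fp_module R X S m u\<^esub>"
proof -
  interpret F: module R "free_module R X" by (rule module_free_module[OF assms(1)])
  have s: "s \<in> carrier (free_module R X)" using assms by blast
  have "fp_class R X S s = fp_class R X S \<zero>\<^bsub>free_module R X\<^esub>"
  proof (rule fp_class_eqI[OF assms(1,2) s F.M.zero_closed])
    have "s \<ominus>\<^bsub>free_module R X\<^esub> \<zero>\<^bsub>free_module R X\<^esub> = s"
      by (simp add: s F.M.minus_eq)
    thus "s \<ominus>\<^bsub>free_module R X\<^esub> \<zero>\<^bsub>free_module R X\<^esub> \<in> submodule_span R (free_module R X) S"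
      using assms(3) submodule_span_superset[of S R "free_module R X"] by auto
  qed
  also have "\<dots> = \<zero>\<^bsub>fp_module R X S m u\<^esub>"
    by (rule linear_maps_zero[OF F.module_axioms module_fp_module[OF assms(1,2)] fp_class_linear[OF assms(1,2)]])
  finally show ?thesis .
qed

text \<open>Relations become zero in the quotient. The two shapes treated here are those of
  \<open>tensor_rels\<close> and \<open>sh_rels\<close>, which thereby turn into additivity and
  homogeneity of the generators.\<close>

lemma
  assumes "cring R" "S \<subseteq> carrier (free_module R X)"
  shows fp_class_basis_add: "\<lbrakk>i \<in> X; j \<in> X; k \<in> X;
      basis_elt R i \<ominus>\<^bsub>free_module R X\<^esub> basis_elt R j \<ominus>\<^bsub>free_module R X\<^esub> basis_elt R k \<in> S\<rbrakk> \<Longrightarrow>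
      fp_class R X S (basis_elt R i) =
      fp_class R X S (basis_elt R j) \<oplus>\<^bsub>fp_module R X S m u\<^esub> fp_class R X S (basis_elt R k)"
    and fp_class_basis_smult: "\<lbrakk>i \<in> X; j \<in> X; r \<in> carrier R;
      basis_elt R i \<ominus>\<^bsub>free_module R X\<^esub> r \<odot>\<^bsub>free_module R X\<^esub> basis_elt R j \<in> S\<rbrakk> \<Longrightarrow>
      fp_class R X S (basis_elt R i) = r \<odot>\<^bsub>fp_module R X S m u\<^esub> fp_class R X S (basis_elt R j)"
proof -
  let ?F = "free_module R X" and ?e = "basis_elt R" and ?Q = "fp_module R X S m u"
    and ?c = "fp_class R X S"
  interpret F: module R ?F by (rule module_free_module[OF assms(1)])
  interpret Q: module R ?Q by (rule module_fp_module[OF assms])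
  note lin = fp_class_linear[OF assms, of m u]
  note e = basis_elt_closed[OF assms(1)]
  note c = linear_mapsD(1)[OF lin]
  note min = linear_maps_minus[OF F.module_axioms Q.module_axioms lin]
  { assume ijk: "i \<in> X" "j \<in> X" "k \<in> X" and s: "?e i \<ominus>\<^bsub>?F\<^esub> ?e j \<ominus>\<^bsub>?F\<^esub> ?e k \<in> S"
    note ei = e[OF ijk(1)] and ej = e[OF ijk(2)] and ek = e[OF ijk(3)]
    have "?c (?e i) \<ominus>\<^bsub>?Q\<^esub> ?c (?e j) \<ominus>\<^bsub>?Q\<^esub> ?c (?e k) = \<zero>\<^bsub>?Q\<^esub>"
      using fp_class_rel[OF assms s, of m u] min[OF F.M.minus_closed[OF ei ej] ek] min[OF ei ej]
      by simp
    thus "?c (?e i) = ?c (?e j) \<oplus>\<^bsub>?Q\<^esub> ?c (?e k)"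
      using Q.M.minus_minus_zero[OF c[OF ei] c[OF ej] c[OF ek]] by blast }
  { assume ij: "i \<in> X" "j \<in> X" "r \<in> carrier R" and s: "?e i \<ominus>\<^bsub>?F\<^esub> r \<odot>\<^bsub>?F\<^esub> ?e j \<in> S"
    note ei = e[OF ij(1)] and ej = e[OF ij(2)]
    have "?c (?e i) \<ominus>\<^bsub>?Q\<^esub> r \<odot>\<^bsub>?Q\<^esub> ?c (?e j) = \<zero>\<^bsub>?Q\<^esub>"
      using fp_class_rel[OF assms s, of m u] min[OF ei F.smult_closed[OF ij(3) ej]]
        linear_mapsD(3)[OF lin ij(3) ej]
      by (simp only:)
    thus "?c (?e i) = r \<odot>\<^bsub>?Q\<^esub> ?c (?e j)"
      using Q.M.minus_zero_iff[OF c[OF ei] Q.smult_closed[OF ij(3) c[OF ej]]] by blast }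
qed

text \<open>These values turn the condition of \<open>fp_lift_linear\<close>, that relations are
  killed, into additivity and homogeneity of \<open>\<phi>\<close>.\<close>

lemma lin_ext_basis_rel:
  assumes "module R L" "\<And>i. i \<in> X \<Longrightarrow> \<phi> i \<in> carrier L"
  shows "\<lbrakk>i \<in> X; j \<in> X; k \<in> X\<rbrakk> \<Longrightarrow>
      lin_ext R L \<phi> (basis_elt R i \<ominus>\<^bsub>free_module R X\<^esub> basis_elt R j \<ominus>\<^bsub>free_module R X\<^esub> basis_elt R k) =
      \<phi> i \<ominus>\<^bsub>L\<^esub> \<phi> j \<ominus>\<^bsub>L\<^esub> \<phi> k"
    and "\<lbrakk>i \<in> X; j \<in> X; r \<in> carrier R\<rbrakk> \<Longrightarrow>
      lin_ext R L \<phi> (basis_elt R i \<ominus>\<^bsub>free_module R X\<^esub> r \<odot>\<^bsub>free_module R X\<^esub> basis_elt R j) =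
      \<phi> i \<ominus>\<^bsub>L\<^esub> r \<odot>\<^bsub>L\<^esub> \<phi> j"
proof -
  interpret L: module R L by fact
  let ?F = "free_module R X"
  interpret F: module R ?F by (rule module_free_module[OF L.R.cring_axioms])
  note lin = lin_ext_linear[of R L X \<phi>, OF assms]
  note e = basis_elt_closed[OF L.R.cring_axioms]
  note min = linear_maps_minus[OF F.module_axioms L.module_axioms lin]
  have val: "lin_ext R L \<phi> (basis_elt R i) = \<phi> i" if "i \<in> X" for i
    by (rule lin_ext_basis[of R L \<phi>, OF assms(1) assms(2)[OF that]])
  { assume ijk: "i \<in> X" "j \<in> X" "k \<in> X"
    thus "lin_ext R L \<phi> (basis_elt R i \<ominus>\<^bsub>?F\<^esub> basis_elt R j \<ominus>\<^bsub>?F\<^esub> basis_elt R k) =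
      \<phi> i \<ominus>\<^bsub>L\<^esub> \<phi> j \<ominus>\<^bsub>L\<^esub> \<phi> k"
      by (simp only: min e F.M.minus_closed val) }
  { assume ij: "i \<in> X" "j \<in> X" "r \<in> carrier R"
    thus "lin_ext R L \<phi> (basis_elt R i \<ominus>\<^bsub>?F\<^esub> r \<odot>\<^bsub>?F\<^esub> basis_elt R j) = \<phi> i \<ominus>\<^bsub>L\<^esub> r \<odot>\<^bsub>L\<^esub> \<phi> j"
      by (simp only: min e F.smult_closed linear_mapsD(3)[OF lin] val) }
qed

section \<open>Tensor products\<close>

lemma tensor_eq_fp_module: "tensor R M N = fp_module R (carrier M \<times> carrier N) (tensor_rels R M N)
    (bilin_ext R (free_module R (carrier M \<times> carrier N))
            (\<lambda>(x, y) (x', y'). basis_elt R (x \<otimes>\<^bsub>M\<^esub> x', y \<otimes>\<^bsub>N\<^esub> y')))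
    (basis_elt R (\<one>\<^bsub>M\<^esub>, \<one>\<^bsub>N\<^esub>))"
  by (simp add: tensor_def fp_module_def tensor_kernel_def Let_def)

lemma pure_tensor_eq_fp_class: "pure_tensor R M N x y =
    fp_class R (carrier M \<times> carrier N) (tensor_rels R M N) (basis_elt R (x, y))"
  by (simp add: pure_tensor_def fp_class_def tensor_kernel_def)

lemma tensor_rels_cases [consumes 1, case_names add_left add_right smult_left smult_right]:
  assumes "s \<in> tensor_rels R M N"
  obtains
    x x' y where "x \<in> carrier M" "x' \<in> carrier M" "y \<in> carrier N"
      "s = basis_elt R (x \<oplus>\<^bsub>M\<^esub> x', y) \<ominus>\<^bsub>free_module R (carrier M \<times> carrier N)\<^esub> basis_elt R (x, y)
        \<ominus>\<^bsub>free_module R (carrier M \<times> carrier N)\<^esub> basis_elt R (x', y)"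
  | x y y' where "x \<in> carrier M" "y \<in> carrier N" "y' \<in> carrier N"
      "s = basis_elt R (x, y \<oplus>\<^bsub>N\<^esub> y') \<ominus>\<^bsub>free_module R (carrier M \<times> carrier N)\<^esub> basis_elt R (x, y)
        \<ominus>\<^bsub>free_module R (carrier M \<times> carrier N)\<^esub> basis_elt R (x, y')"
  | r x y where "r \<in> carrier R" "x \<in> carrier M" "y \<in> carrier N"
      "s = basis_elt R (r \<odot>\<^bsub>M\<^esub> x, y) \<ominus>\<^bsub>free_module R (carrier M \<times> carrier N)\<^esub>
        r \<odot>\<^bsub>free_module R (carrier M \<times> carrier N)\<^esub> basis_elt R (x, y)"
  | r x y where "r \<in> carrier R" "x \<in> carrier M" "y \<in> carrier N"
      "s = basis_elt R (x, r \<odot>\<^bsub>N\<^esub> y) \<ominus>\<^bsub>free_module R (carrier M \<times> carrier N)\<^esub>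
        r \<odot>\<^bsub>free_module R (carrier M \<times> carrier N)\<^esub> basis_elt R (x, y)"
  using assms unfolding tensor_rels_def Let_def by blast

lemma tensor_relsI:
  "\<lbrakk>x \<in> carrier M; x' \<in> carrier M; y \<in> carrier N\<rbrakk> \<Longrightarrow>
    basis_elt R (x \<oplus>\<^bsub>M\<^esub> x', y) \<ominus>\<^bsub>free_module R (carrier M \<times> carrier N)\<^esub> basis_elt R (x, y)
        \<ominus>\<^bsub>free_module R (carrier M \<times> carrier N)\<^esub> basis_elt R (x', y) \<in> tensor_rels R M N"
  "\<lbrakk>x \<in> carrier M; y \<in> carrier N; y' \<in> carrier N\<rbrakk> \<Longrightarrow>
    basis_elt R (x, y \<oplus>\<^bsub>N\<^esub> y') \<ominus>\<^bsub>free_module R (carrier M \<times> carrier N)\<^esub> basis_elt R (x, y)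
        \<ominus>\<^bsub>free_module R (carrier M \<times> carrier N)\<^esub> basis_elt R (x, y') \<in> tensor_rels R M N"
  "\<lbrakk>r \<in> carrier R; x \<in> carrier M; y \<in> carrier N\<rbrakk> \<Longrightarrow>
    basis_elt R (r \<odot>\<^bsub>M\<^esub> x, y) \<ominus>\<^bsub>free_module R (carrier M \<times> carrier N)\<^esub>
        r \<odot>\<^bsub>free_module R (carrier M \<times> carrier N)\<^esub> basis_elt R (x, y) \<in> tensor_rels R M N"
  "\<lbrakk>r \<in> carrier R; x \<in> carrier M; y \<in> carrier N\<rbrakk> \<Longrightarrow>
    basis_elt R (x, r \<odot>\<^bsub>N\<^esub> y) \<ominus>\<^bsub>free_module R (carrier M \<times> carrier N)\<^esub>
        r \<odot>\<^bsub>free_module R (carrier M \<times> carrier N)\<^esub> basis_elt R (x, y) \<in> tensor_rels R M N"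
  unfolding tensor_rels_def Let_def by blast+

context
  fixes R :: "('r, 'x) ring_scheme" and M :: "('r, 'm, 'y) module_scheme"
    and N :: "('r, 'n, 'z) module_scheme"
  assumes M: "module R M" and N: "module R N"
begin

interpretation M: module R M by (rule M)
interpretation N: module R N by (rule N)

private abbreviation (input) "FT \<equiv> free_module R (carrier M \<times> carrier N)"

interpretation F: module R FT by (rule module_free_module[OF M.R.cring_axioms])

private lemma e: "\<lbrakk>x \<in> carrier M; y \<in> carrier N\<rbrakk> \<Longrightarrow> basis_elt R (x, y) \<in> carrier FT"
  by (rule basis_elt_closed[OF M.R.cring_axioms]) simp

lemma tensor_rels_closed: "tensor_rels R M N \<subseteq> carrier FT"
proof
  fix s assume "s \<in> tensor_rels R M N"
  thus "s \<in> carrier FT"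
    by (cases rule: tensor_rels_cases)
      (simp_all only: e F.M.minus_closed F.smult_closed M.M.add.m_closed N.M.add.m_closed
        M.smult_closed N.smult_closed)
qed

lemma module_tensor: "module R (tensor R M N)"
  unfolding tensor_eq_fp_module by (rule module_fp_module[OF M.R.cring_axioms tensor_rels_closed])

lemma pure_tensor_bilinear: "pure_tensor R M N \<in> bilinear_maps R M N (tensor R M N)"
proof -
  note lin = fp_class_linear[OF M.R.cring_axioms tensor_rels_closed]
  note add = fp_class_basis_add[OF M.R.cring_axioms tensor_rels_closed]
  note smult = fp_class_basis_smult[OF M.R.cring_axioms tensor_rels_closed]
  show ?thesis
    unfolding tensor_eq_fp_module pure_tensor_eq_fp_class[abs_def]
    \<comment> \<open>Six goals arise: closure, additivity and homogeneity, for the second argument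
      and then for the first.\<close>
    apply (intro bilinear_mapsI linear_mapsI)
         apply (rule linear_mapsD(1)[OF lin e]; assumption)
        apply (rule add; simp add: tensor_relsI)
       apply (rule smult; simp add: tensor_relsI)
      apply (rule linear_mapsD(1)[OF lin e]; assumption)
     apply (rule add; simp add: tensor_relsI)
    apply (rule smult; simp add: tensor_relsI)
    done
qed

lemma pure_tensor_closed: "\<lbrakk>x \<in> carrier M; y \<in> carrier N\<rbrakk> \<Longrightarrow> pure_tensor R M N x y \<in> carrier (tensor R M N)"
  by (rule bilinear_maps_closed[OF pure_tensor_bilinear])

lemma spans_tensor:
  "spans R (tensor R M N) {pure_tensor R M N x y | x y. x \<in> carrier M \<and> y \<in> carrier N}"
proof -
  have "{pure_tensor R M N x y | x y. x \<in> carrier M \<and> y \<in> carrier N} =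
      (\<lambda>i. fp_class R (carrier M \<times> carrier N) (tensor_rels R M N) (basis_elt R i)) ` (carrier M \<times> carrier N)"
    by (auto simp: pure_tensor_eq_fp_class)
  thus ?thesis using fp_spans[OF M.R.cring_axioms tensor_rels_closed]
    by (simp add: tensor_eq_fp_module)
qed

lemma tensor_linear_eqI:
  assumes "module R L" "f \<in> linear_maps R (tensor R M N) L" "g \<in> linear_maps R (tensor R M N) L"
    "\<And>x y. \<lbrakk>x \<in> carrier M; y \<in> carrier N\<rbrakk> \<Longrightarrow> f (pure_tensor R M N x y) = g (pure_tensor R M N x y)"
    "t \<in> carrier (tensor R M N)"
  shows "f t = g t"
  by (rule linear_maps_eqI[OF module_tensor assms(1) spans_tensor assms(2,3) _ assms(5)])
    (use assms(4) in blast)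

text \<open>The universal property: the four kinds of relations are exactly additivity and
  homogeneity of \<open>b\<close> in each of its two arguments.\<close>

lemma
  assumes L: "module R L" and b: "b \<in> bilinear_maps R M N L"
  shows tensor_lift_linear: "quot_lift R L (\<lambda>(x, y). b x y) \<in> linear_maps R (tensor R M N) L"
    and tensor_lift_pure: "\<lbrakk>x \<in> carrier M; y \<in> carrier N\<rbrakk> \<Longrightarrow>
      quot_lift R L (\<lambda>(x, y). b x y) (pure_tensor R M N x y) = b x y"
proof -
  interpret L: module R L by (rule L)
  let ?\<phi> = "\<lambda>(x, y). b x y"
  have \<phi>: "?\<phi> i \<in> carrier L" if "i \<in> carrier M \<times> carrier N" for i
    using that bilinear_maps_closed[OF b] by auto
  note val = lin_ext_basis_rel[of R L "carrier M \<times> carrier N" ?\<phi>, OF L \<phi>]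
  note b1 = linear_mapsD[OF bilinear_mapsD(1)[OF b]]
  note b2 = linear_mapsD[OF bilinear_mapsD(2)[OF b]]
  have rel: "lin_ext R L ?\<phi> s = \<zero>\<^bsub>L\<^esub>" if "s \<in> tensor_rels R M N" for s
    using that
  proof (cases rule: tensor_rels_cases)
    case (add_left x x' y)
    show ?thesis unfolding add_left(4)
      by (subst val(1)) (simp_all add: add_left(1-3) b2(1,2) L.M.minus_minus_zero)
  next
    case (add_right x y y')
    show ?thesis unfolding add_right(4)
      by (subst val(1)) (simp_all add: add_right(1-3) b1(1,2) L.M.minus_minus_zero)
  next
    case (smult_left r x y)
    show ?thesis unfolding smult_left(4)
      by (subst val(2)) (simp_all add: smult_left(1-3) b2(1,3) L.M.minus_zero_iff)
  next
    case (smult_right r x y)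
    show ?thesis unfolding smult_right(4)
      by (subst val(2)) (simp_all add: smult_right(1-3) b1(1,3) L.M.minus_zero_iff)
  qed
  show "quot_lift R L ?\<phi> \<in> linear_maps R (tensor R M N) L"
    unfolding tensor_eq_fp_module
    by (rule fp_lift_linear[OF M.R.cring_axioms tensor_rels_closed L \<phi> rel])
  show "quot_lift R L ?\<phi> (pure_tensor R M N x y) = b x y" if "x \<in> carrier M" "y \<in> carrier N"
    using fp_lift_basis[OF M.R.cring_axioms tensor_rels_closed L \<phi> rel, of "(x, y)"] that
    by (simp add: pure_tensor_eq_fp_class)
qed

end

section \<open>Functoriality and associativity of the tensor product\<close>

lemma
  assumes M': "module R M'" and N': "module R N'" and M: "module R M" and N: "module R N"
    and f: "f \<in> linear_maps R M' M" and g: "g \<in> linear_maps R N' N"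
  shows tensor_map_linear: "tensor_map R M N f g \<in> linear_maps R (tensor R M' N') (tensor R M N)"
    and tensor_map_pure: "\<lbrakk>x \<in> carrier M'; y \<in> carrier N'\<rbrakk> \<Longrightarrow>
      tensor_map R M N f g (pure_tensor R M' N' x y) = pure_tensor R M N (f x) (g y)"
proof -
  note b = bilinear_maps_comp[OF pure_tensor_bilinear[OF M N] f g linear_maps_id]
  note lift = tensor_lift_linear[OF M' N' module_tensor[OF M N] b]
    tensor_lift_pure[OF M' N' module_tensor[OF M N] b]
  show "tensor_map R M N f g \<in> linear_maps R (tensor R M' N') (tensor R M N)"
    unfolding tensor_map_def by (rule lift(1))
  show "\<lbrakk>x \<in> carrier M'; y \<in> carrier N'\<rbrakk> \<Longrightarrow>
      tensor_map R M N f g (pure_tensor R M' N' x y) = pure_tensor R M N (f x) (g y)"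
    unfolding tensor_map_def by (rule lift(2))
qed

text \<open>The associator is a lift inside a lift. For fixed \<open>z\<close> the inner lift is
  linear in \<open>t\<close> by the universal property. Linearity in \<open>z\<close> is not visible
  from the definition; it is an equation between maps linear in \<open>t\<close>, hence can be
  compared on pure tensors.\<close>

lemma
  assumes L: "module R L" and M: "module R M" and N: "module R N"
  shows tensor_assoc_linear: "tensor_assoc R L M N \<in>
      linear_maps R (tensor R (tensor R L M) N) (tensor R L (tensor R M N))"
    and tensor_assoc_pure: "\<lbrakk>x \<in> carrier L; y \<in> carrier M; z \<in> carrier N\<rbrakk> \<Longrightarrow>
      tensor_assoc R L M N (pure_tensor R (tensor R L M) N (pure_tensor R L M x y) z) =
      pure_tensor R L (tensor R M N) x (pure_tensor R M N y z)"
proof -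
  note LM = module_tensor[OF L M] and MN = module_tensor[OF M N]
  note T = module_tensor[OF L MN]
  let ?T = "tensor R L (tensor R M N)"
  define c where "c z = (\<lambda>(x, y). pure_tensor R L (tensor R M N) x (pure_tensor R M N y z))" for z
  have c: "quot_lift R ?T (c z) \<in> linear_maps R (tensor R L M) ?T"
    "\<lbrakk>x \<in> carrier L; y \<in> carrier M\<rbrakk> \<Longrightarrow> quot_lift R ?T (c z) (pure_tensor R L M x y) =
      pure_tensor R L (tensor R M N) x (pure_tensor R M N y z)" if z: "z \<in> carrier N" for z x y
  proof -
    note b = bilinear_maps_comp[OF pure_tensor_bilinear[OF L MN] linear_maps_id
        bilinear_mapsD(2)[OF pure_tensor_bilinear[OF M N] z] linear_maps_id]
    show "quot_lift R ?T (c z) \<in> linear_maps R (tensor R L M) ?T"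
      unfolding c_def by (rule tensor_lift_linear[OF L M T b])
    show "\<lbrakk>x \<in> carrier L; y \<in> carrier M\<rbrakk> \<Longrightarrow> quot_lift R ?T (c z) (pure_tensor R L M x y) =
      pure_tensor R L (tensor R M N) x (pure_tensor R M N y z)"
      unfolding c_def by (rule tensor_lift_pure[OF L M T b])
  qed
  interpret T: module R ?T by (rule T)
  interpret N: module R N by (rule N)
  note pt1 = bilinear_mapsD(1)[OF pure_tensor_bilinear[OF L MN]]
  note pt2 = bilinear_mapsD(1)[OF pure_tensor_bilinear[OF M N]]
  note pc = pure_tensor_closed[OF M N]
  have b: "(\<lambda>t z. quot_lift R ?T (c z) t) \<in> bilinear_maps R (tensor R L M) N ?T"
  proof (rule bilinear_mapsI[OF _ c(1)])
    fix t assume t: "t \<in> carrier (tensor R L M)"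
    show "(\<lambda>z. quot_lift R ?T (c z) t) \<in> linear_maps R N ?T"
    proof (rule linear_mapsI)
      fix z assume "z \<in> carrier N"
      thus "quot_lift R ?T (c z) t \<in> carrier ?T" by (rule linear_mapsD(1)[OF c(1) t])
    next
      fix z z' assume z: "z \<in> carrier N" "z' \<in> carrier N"
      show "quot_lift R ?T (c (z \<oplus>\<^bsub>N\<^esub> z')) t = quot_lift R ?T (c z) t \<oplus>\<^bsub>?T\<^esub> quot_lift R ?T (c z') t"
        by (rule tensor_linear_eqI[OF L M T c(1) linear_maps_add[OF T c(1) c(1)] _ t])
          (simp_all add: z c(2) linear_mapsD(2)[OF pt1] linear_mapsD(2)[OF pt2] pc)
    next
      fix r z assume z: "r \<in> carrier R" "z \<in> carrier N"
      show "quot_lift R ?T (c (r \<odot>\<^bsub>N\<^esub> z)) t = r \<odot>\<^bsub>?T\<^esub> quot_lift R ?T (c z) t"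
        by (rule tensor_linear_eqI[OF L M T c(1) linear_maps_smult[OF T c(1)] _ t])
          (simp_all add: z c(2) linear_mapsD(3)[OF pt1] linear_mapsD(3)[OF pt2] pc)
    qed
  qed
  have eq: "tensor_assoc R L M N = quot_lift R ?T (\<lambda>(t, z). quot_lift R ?T (c z) t)"
    unfolding tensor_assoc_def Let_def c_def ..
  show "tensor_assoc R L M N \<in>
      linear_maps R (tensor R (tensor R L M) N) (tensor R L (tensor R M N))"
    unfolding eq by (rule tensor_lift_linear[OF LM N T b])
  show "\<lbrakk>x \<in> carrier L; y \<in> carrier M; z \<in> carrier N\<rbrakk> \<Longrightarrow>
      tensor_assoc R L M N (pure_tensor R (tensor R L M) N (pure_tensor R L M x y) z) =
      pure_tensor R L (tensor R M N) x (pure_tensor R M N y z)"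
    unfolding eq using tensor_lift_pure[OF LM N T b pure_tensor_closed[OF L M]] c(2) by simp
qed

section \<open>Tensor products of algebras\<close>

lemma
  assumes M: "algebra R M" and N: "algebra R N"
  shows algebra_tensor: "algebra R (tensor R M N)"
    and tensor_mult_pure: "\<lbrakk>x \<in> carrier M; y \<in> carrier N; x' \<in> carrier M; y' \<in> carrier N\<rbrakk> \<Longrightarrow>
      pure_tensor R M N x y \<otimes>\<^bsub>tensor R M N\<^esub> pure_tensor R M N x' y' =
      pure_tensor R M N (x \<otimes>\<^bsub>M\<^esub> x') (y \<otimes>\<^bsub>N\<^esub> y')"
    and tensor_one: "\<one>\<^bsub>tensor R M N\<^esub> = pure_tensor R M N \<one>\<^bsub>M\<^esub> \<one>\<^bsub>N\<^esub>"
proof -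
  interpret M: algebra R M by fact
  interpret N: algebra R N by fact
  let ?X = "carrier M \<times> carrier N"
  let ?F = "free_module R ?X"
  interpret F: module R ?F by (rule module_free_module[OF M.R.cring_axioms])
  let ?\<phi> = "\<lambda>(x, y) (x', y'). basis_elt R (x \<otimes>\<^bsub>M\<^esub> x', y \<otimes>\<^bsub>N\<^esub> y')"
  define m where "m = bilin_ext R ?F ?\<phi>"
  let ?S = "tensor_rels R M N"
  note S = tensor_rels_closed[OF M.module N.module]
  have \<phi>: "?\<phi> i j \<in> carrier ?F" if "i \<in> ?X" "j \<in> ?X" for i j
    using that by (auto intro!: basis_elt_closed[OF M.R.cring_axioms])
  have bil: "m \<in> bilinear_maps R ?F ?F ?F"
    unfolding m_def by (rule bilin_ext_bilinear[OF F.module_axioms \<phi>])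
  have val: "m (basis_elt R i) (basis_elt R j) = ?\<phi> i j" if "i \<in> ?X" "j \<in> ?X" for i j
    unfolding m_def bilin_ext_def
    by (simp only: lin_ext_basis[OF F.module_axioms] \<phi>[OF that])
  have comm: "m x y = m y x" if "x \<in> carrier ?F" "y \<in> carrier ?F" for x y
    by (rule bilinear_maps_eqI[OF F.module_axioms F.module_axioms F.module_axioms
          spans_free_module[OF M.R.cring_axioms] spans_free_module[OF M.R.cring_axioms]
          bil bilinear_maps_flip[OF bil] _ that])
      (auto simp: val M.m_comm N.m_comm)
  note e = basis_elt_closed[OF M.R.cring_axioms, of _ ?X]
  \<comment> \<open>A relation times a basis element is again a relation of the same kind, not
    merely an element of the span. Multiplication from the other side is covered by commutativity of
    \<open>m\<close>.\<close>
  have ideal: "m s (basis_elt R i) \<in> ?S" if s: "s \<in> ?S" and i: "i \<in> ?X" for s i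
  proof -
    obtain a b where ab: "a \<in> carrier M" "b \<in> carrier N" "i = (a, b)" using i by auto
    have lin: "(\<lambda>x. m x (basis_elt R (a, b))) \<in> linear_maps R ?F ?F"
      by (rule bilinear_mapsD(2)[OF bil e[OF i[unfolded ab(3)]]])
    note lin' = linear_maps_minus[OF F.module_axioms F.module_axioms lin] linear_mapsD(3)[OF lin]
    note * = e
    from s show ?thesis
    proof (cases rule: tensor_rels_cases)
      case (add_left x x' y)
      have "m s (basis_elt R i) = basis_elt R (x \<otimes>\<^bsub>M\<^esub> a \<oplus>\<^bsub>M\<^esub> x' \<otimes>\<^bsub>M\<^esub> a, y \<otimes>\<^bsub>N\<^esub> b) \<ominus>\<^bsub>?F\<^esub>
          basis_elt R (x \<otimes>\<^bsub>M\<^esub> a, y \<otimes>\<^bsub>N\<^esub> b) \<ominus>\<^bsub>?F\<^esub> basis_elt R (x' \<otimes>\<^bsub>M\<^esub> a, y \<otimes>\<^bsub>N\<^esub> b)"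
        unfolding add_left(4) using add_left(1-3) ab
        by (simp add: lin' * val M.l_distr)
      thus ?thesis using add_left(1-3) ab by (simp add: tensor_relsI(1))
    next
      case (add_right x y y')
      have "m s (basis_elt R i) = basis_elt R (x \<otimes>\<^bsub>M\<^esub> a, y \<otimes>\<^bsub>N\<^esub> b \<oplus>\<^bsub>N\<^esub> y' \<otimes>\<^bsub>N\<^esub> b) \<ominus>\<^bsub>?F\<^esub>
          basis_elt R (x \<otimes>\<^bsub>M\<^esub> a, y \<otimes>\<^bsub>N\<^esub> b) \<ominus>\<^bsub>?F\<^esub> basis_elt R (x \<otimes>\<^bsub>M\<^esub> a, y' \<otimes>\<^bsub>N\<^esub> b)"
        unfolding add_right(4) using add_right(1-3) ab
        by (simp add: lin' * val N.l_distr)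
      thus ?thesis using add_right(1-3) ab by (simp add: tensor_relsI(2))
    next
      case (smult_left r x y)
      have "m s (basis_elt R i) = basis_elt R (r \<odot>\<^bsub>M\<^esub> (x \<otimes>\<^bsub>M\<^esub> a), y \<otimes>\<^bsub>N\<^esub> b) \<ominus>\<^bsub>?F\<^esub>
          r \<odot>\<^bsub>?F\<^esub> basis_elt R (x \<otimes>\<^bsub>M\<^esub> a, y \<otimes>\<^bsub>N\<^esub> b)"
        unfolding smult_left(4) using smult_left(1-3) ab
        by (simp add: lin' * val M.smult_assoc2)
      thus ?thesis using smult_left(1-3) ab by (simp add: tensor_relsI(3))
    next
      case (smult_right r x y)
      have "m s (basis_elt R i) = basis_elt R (x \<otimes>\<^bsub>M\<^esub> a, r \<odot>\<^bsub>N\<^esub> (y \<otimes>\<^bsub>N\<^esub> b)) \<ominus>\<^bsub>?F\<^esub>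
          r \<odot>\<^bsub>?F\<^esub> basis_elt R (x \<otimes>\<^bsub>M\<^esub> a, y \<otimes>\<^bsub>N\<^esub> b)"
        unfolding smult_right(4) using smult_right(1-3) ab
        by (simp add: lin' * val N.smult_assoc2)
      thus ?thesis using smult_right(1-3) ab by (simp add: tensor_relsI(4))
    qed
  qed
  have ideal1: "m s (basis_elt R i) \<in> submodule_span R ?F ?S" if "s \<in> ?S" "i \<in> ?X" for s i
    using ideal[OF that] submodule_span_superset[of ?S R ?F] by blast
  have ideal2: "m (basis_elt R i) s \<in> submodule_span R ?F ?S" if "s \<in> ?S" "i \<in> ?X" for s i
    using ideal1[OF that] comm[OF e[OF that(2)], of s] that(1) S by auto
  note mult = fp_mult_bilinear[OF M.R.cring_axioms S \<phi> m_def ideal1 ideal2]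
    fp_mult_basis[OF M.R.cring_axioms S \<phi> m_def ideal1 ideal2]
  have eq: "tensor R M N = fp_module R ?X ?S m (basis_elt R (\<one>\<^bsub>M\<^esub>, \<one>\<^bsub>N\<^esub>))"
    by (simp add: tensor_eq_fp_module m_def)
  show pure: "pure_tensor R M N x y \<otimes>\<^bsub>tensor R M N\<^esub> pure_tensor R M N x' y' =
      pure_tensor R M N (x \<otimes>\<^bsub>M\<^esub> x') (y \<otimes>\<^bsub>N\<^esub> y')"
    if "x \<in> carrier M" "y \<in> carrier N" "x' \<in> carrier M" "y' \<in> carrier N" for x y x' y'
    unfolding eq pure_tensor_eq_fp_class by (subst mult(2)) (use that in auto)
  show one: "\<one>\<^bsub>tensor R M N\<^esub> = pure_tensor R M N \<one>\<^bsub>M\<^esub> \<one>\<^bsub>N\<^esub>"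
    unfolding eq pure_tensor_eq_fp_class
    by (rule fp_module_one[OF M.R.cring_axioms S])
  have bilT: "mult (tensor R M N) \<in> bilinear_maps R (tensor R M N) (tensor R M N) (tensor R M N)"
    unfolding eq by (rule mult(1))
  show "algebra R (tensor R M N)"
  proof (rule algebraI_spans[OF module_tensor[OF M.module N.module] bilT spans_tensor[OF M.module N.module]])
    show "\<one>\<^bsub>tensor R M N\<^esub> \<in> carrier (tensor R M N)"
      unfolding one by (rule pure_tensor_closed[OF M.module N.module]) auto
  qed (auto simp: pure one M.m_assoc N.m_assoc M.m_comm N.m_comm M.m_lcomm N.m_lcomm)
qed

lemma tensor_map_algebra_hom:
  assumes M': "algebra R M'" and N': "algebra R N'" and M: "algebra R M" and N: "algebra R N"
    and f: "f \<in> algebra_homs R M' M" and g: "g \<in> algebra_homs R N' N"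
  shows "tensor_map R M N f g \<in> algebra_homs R (tensor R M' N') (tensor R M N)"
proof -
  interpret M': algebra R M' by fact
  interpret N': algebra R N' by fact
  interpret M: algebra R M by fact
  interpret N: algebra R N by fact
  note f' = algebra_homsD[OF f] and g' = algebra_homsD[OF g]
  note fc = linear_mapsD(1)[OF f'(1)] and gc = linear_mapsD(1)[OF g'(1)]
  note val = tensor_map_pure[OF M'.module N'.module M.module N.module f'(1) g'(1)]
  show ?thesis
  proof (rule algebra_homs_spansI[OF algebra_tensor[OF M' N'] algebra_tensor[OF M N]
        tensor_map_linear[OF M'.module N'.module M.module N.module f'(1) g'(1)]
        spans_tensor[OF M'.module N'.module]])
    show "tensor_map R M N f g \<one>\<^bsub>tensor R M' N'\<^esub> = \<one>\<^bsub>tensor R M N\<^esub>"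
      by (simp add: tensor_one[OF M' N'] tensor_one[OF M N] val f' g')
  qed (auto simp: tensor_mult_pure[OF M' N'] tensor_mult_pure[OF M N] val f' g' fc gc)
qed

lemma tensor_linear_eqI3:
  assumes L: "module R L" and M: "module R M" and N: "module R N" and K: "module R K"
    and f: "f \<in> linear_maps R (tensor R (tensor R L M) N) K"
    and g: "g \<in> linear_maps R (tensor R (tensor R L M) N) K"
    and eq: "\<And>x y z. \<lbrakk>x \<in> carrier L; y \<in> carrier M; z \<in> carrier N\<rbrakk> \<Longrightarrow>
      f (pure_tensor R (tensor R L M) N (pure_tensor R L M x y) z) =
      g (pure_tensor R (tensor R L M) N (pure_tensor R L M x y) z)"
    and t: "t \<in> carrier (tensor R (tensor R L M) N)"
  shows "f t = g t"
proof (rule tensor_linear_eqI[OF module_tensor[OF L M] N K f g _ t])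
  fix s z assume s: "s \<in> carrier (tensor R L M)" and z: "z \<in> carrier N"
  note p = bilinear_mapsD(2)[OF pure_tensor_bilinear[OF module_tensor[OF L M] N] z]
  show "f (pure_tensor R (tensor R L M) N s z) = g (pure_tensor R (tensor R L M) N s z)"
    by (rule tensor_linear_eqI[OF L M K linear_maps_comp[OF p f] linear_maps_comp[OF p g] _ s])
      (rule eq[OF _ _ z])
qed

lemma tensor_assoc_algebra_hom:
  assumes L: "algebra R L" and M: "algebra R M" and N: "algebra R N"
  shows "tensor_assoc R L M N \<in>
      algebra_homs R (tensor R (tensor R L M) N) (tensor R L (tensor R M N))"
proof -
  interpret L: algebra R L by fact
  interpret M: algebra R M by fact
  interpret N: algebra R N by fact
  note LM = algebra_tensor[OF L M] and MN = algebra_tensor[OF M N]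
  let ?T' = "tensor R (tensor R L M) N" and ?T = "tensor R L (tensor R M N)"
  interpret T: algebra R ?T by (rule algebra_tensor[OF L MN])
  interpret T': algebra R ?T' by (rule algebra_tensor[OF LM N])
  interpret LM: algebra R "tensor R L M" by (rule LM)
  note lin = tensor_assoc_linear[OF L.module M.module N.module]
  note val = tensor_assoc_pure[OF L.module M.module N.module]
  note pc = pure_tensor_closed[OF L.module M.module] pure_tensor_closed[OF M.module N.module]
  note ms = tensor_mult_pure[OF LM N] tensor_mult_pure[OF L MN] tensor_mult_pure[OF L M]
    tensor_mult_pure[OF M N]
  let ?\<alpha> = "tensor_assoc R L M N"
  \<comment> \<open>Both sides are linear in \<open>s\<close> and in \<open>t\<close>, so it is
    enough to let first \<open>s\<close> and then \<open>t\<close> be a threefold pure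
    tensor.\<close>
  have *: "?\<alpha> (s \<otimes>\<^bsub>?T'\<^esub> t) = ?\<alpha> s \<otimes>\<^bsub>?T\<^esub> ?\<alpha> t" if s: "s \<in> carrier ?T'" and t: "t \<in> carrier ?T'" for s t
  proof (rule tensor_linear_eqI3[OF L.module M.module N.module T.module
        linear_maps_comp[OF bilinear_mapsD(2)[OF T'.mult_bilinear t] lin]
        linear_maps_comp[OF lin bilinear_mapsD(2)[OF T.mult_bilinear linear_mapsD(1)[OF lin t]]] _ s])
    fix x y z assume xyz: "x \<in> carrier L" "y \<in> carrier M" "z \<in> carrier N"
    let ?p = "pure_tensor R (tensor R L M) N (pure_tensor R L M x y) z"
    have p: "?p \<in> carrier ?T'"
      by (rule pure_tensor_closed[OF LM.module N.module pc(1)[OF xyz(1,2)] xyz(3)])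
    show "?\<alpha> (?p \<otimes>\<^bsub>?T'\<^esub> t) = ?\<alpha> ?p \<otimes>\<^bsub>?T\<^esub> ?\<alpha> t"
      by (rule tensor_linear_eqI3[OF L.module M.module N.module T.module
        linear_maps_comp[OF bilinear_mapsD(1)[OF T'.mult_bilinear p] lin]
        linear_maps_comp[OF lin bilinear_mapsD(1)[OF T.mult_bilinear linear_mapsD(1)[OF lin p]]] _ t])
        (simp add: val ms pc xyz)
  qed
  have "?\<alpha> \<one>\<^bsub>?T'\<^esub> = \<one>\<^bsub>?T\<^esub>"
    by (simp add: tensor_one[OF LM N] tensor_one[OF L M] tensor_one[OF L MN] tensor_one[OF M N] val)
  thus ?thesis using lin *
    by (auto simp: algebra_homs_def intro!: ring_hom_memI linear_mapsD(1,2)[OF lin])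
qed

section \<open>The shuffle product on words\<close>

text \<open>These are the shapes of cancellation met below, mostly between summands of the product
  recursion.\<close>

lemma (in abelian_group) add_minus_cancel:
  assumes "x \<in> carrier G" "y \<in> carrier G" "z \<in> carrier G"
  shows "x \<oplus> y \<oplus> z \<ominus> x = y \<oplus> z" "y \<oplus> x \<ominus> x = y" "y \<oplus> x \<oplus> z \<ominus> (x \<oplus> z) = y"
    "y \<oplus> x \<oplus> z \<ominus> x = y \<oplus> z" "y \<oplus> x \<ominus> (x \<ominus> z) = y \<oplus> z" "x \<ominus> (y \<oplus> x) = \<ominus> y"
proof -
  have 1: "y \<oplus> x \<ominus> x = y" if "x \<in> carrier G" "y \<in> carrier G" for x y
    using that by (simp add: minus_eq a_assoc r_neg)
  show "y \<oplus> x \<ominus> x = y" using 1 assms by simp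
  have "x \<oplus> y \<oplus> z = y \<oplus> z \<oplus> x" using assms by (simp add: a_ac)
  thus "x \<oplus> y \<oplus> z \<ominus> x = y \<oplus> z" using 1 assms by simp
  have "y \<oplus> x \<oplus> z = y \<oplus> z \<oplus> x" using assms by (simp add: a_ac)
  thus "y \<oplus> x \<oplus> z \<ominus> x = y \<oplus> z" using 1 assms by simp
  have "y \<oplus> x \<oplus> z = y \<oplus> (x \<oplus> z)" using assms by (simp add: a_ac)
  thus "y \<oplus> x \<oplus> z \<ominus> (x \<oplus> z) = y" using 1 assms by simp
  have "y \<oplus> x = (y \<oplus> z) \<oplus> (x \<ominus> z)"
    using assms by (simp add: minus_eq a_assoc a_lcomm[of x] a_lcomm[of z] r_neg a_comm)
  thus "y \<oplus> x \<ominus> (x \<ominus> z) = y \<oplus> z" using 1[of "x \<ominus> z" "y \<oplus> z"] assms by simp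
  have "x \<ominus> (y \<oplus> x) = \<ominus> y \<oplus> x \<ominus> x" using assms by (simp add: minus_eq minus_add a_ac)
  thus "x \<ominus> (y \<oplus> x) = \<ominus> y" using 1[of x "\<ominus> y"] assms by simp
qed

text \<open>Everything up to the TD identity for \<open>P\<close> concerns only the algebra
  \<open>A\<close> and the scalar; the coalgebra structure enters with
  \<open>td_bialgebra\<close>.\<close>

locale td_words =
  fixes R :: "('r, 'x) ring_scheme" and A :: "('r, 'a, 'y) module_scheme" and l :: 'r
  assumes algebra_A: "algebra R A" and l_closed: "l \<in> carrier R"
begin

sublocale A: algebra R A by (rule algebra_A)

abbreviation "L \<equiv> lists (carrier A)"
abbreviation "W \<equiv> word_module R A"
abbreviation "ee \<equiv> basis_elt R"
abbreviation "pre \<equiv> prefix_letter R A"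
abbreviation "td \<equiv> td_shuffle R A l"
abbreviation "rm v \<equiv> lin_ext R W (\<lambda>w. td w v)"

sublocale W: module R W
  unfolding word_module_def by (rule module_free_module[OF A.R.cring_axioms])

lemmas W_eqI = free_linear_maps_eqI[where R = R and X = L, folded word_module_def[of R A]]
lemmas W_lin = lin_ext_linear[where R = R and X = L, folded word_module_def[of R A]]

lemma ee_closed [simp]: "w \<in> L \<Longrightarrow> ee w \<in> carrier W"
  unfolding word_module_def by (rule basis_elt_closed[OF A.R.cring_axioms])

lemma pre_linear: "a \<in> carrier A \<Longrightarrow> pre a \<in> linear_maps R W W"
  unfolding prefix_letter_def by (rule W_lin[OF W.module_axioms]) simp

lemma pre_basis: "\<lbrakk>a \<in> carrier A; w \<in> L\<rbrakk> \<Longrightarrow> pre a (ee w) = ee (a # w)"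
  unfolding prefix_letter_def by (rule lin_ext_basis[OF W.module_axioms]) simp

lemma pre_closed [simp]: "\<lbrakk>a \<in> carrier A; x \<in> carrier W\<rbrakk> \<Longrightarrow> pre a x \<in> carrier W"
  by (rule linear_mapsD(1)[OF pre_linear])

lemmas pre_add = linear_mapsD(2)[OF pre_linear]
lemmas pre_smult = linear_mapsD(3)[OF pre_linear]
lemmas pre_minus = linear_maps_minus[OF W.module_axioms W.module_axioms pre_linear]

lemma td_Nil [simp]: "td u [] = ee u"
  by (cases u) auto

lemma lin_ext_basis_id: "x \<in> carrier W \<Longrightarrow> lin_ext R W ee x = x"
  by (rule W_eqI[OF W.module_axioms W_lin[OF W.module_axioms] linear_maps_id])
    (simp_all add: lin_ext_basis[OF W.module_axioms])

lemma td_one: "\<lbrakk>u \<in> L; u \<noteq> []\<rbrakk> \<Longrightarrow> td u [\<one>\<^bsub>A\<^esub>] = ee (\<one>\<^bsub>A\<^esub> # u) \<oplus>\<^bsub>W\<^esub> l \<odot>\<^bsub>W\<^esub> ee u"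
proof (induction u)
  case (Cons a u)
  hence au: "a \<in> carrier A" "u \<in> L" by auto
  have cl: "td u [\<one>\<^bsub>A\<^esub>] \<in> carrier W"
    using Cons.IH au by (cases "u = []") (auto simp: l_closed)
  have "td (a # u) [\<one>\<^bsub>A\<^esub>] = pre a (td u [\<one>\<^bsub>A\<^esub>]) \<oplus>\<^bsub>W\<^esub> ee (\<one>\<^bsub>A\<^esub> # a # u) \<oplus>\<^bsub>W\<^esub> l \<odot>\<^bsub>W\<^esub> ee (a # u)
      \<ominus>\<^bsub>W\<^esub> pre a (td u [\<one>\<^bsub>A\<^esub>])"
    using au cl by (simp add: lin_ext_basis_id pre_basis)
  also have "\<dots> = ee (\<one>\<^bsub>A\<^esub> # a # u) \<oplus>\<^bsub>W\<^esub> l \<odot>\<^bsub>W\<^esub> ee (a # u)"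
    using au cl by (intro W.M.add_minus_cancel) (auto simp: l_closed)
  finally show ?case .
qed simp

lemma td_one_closed: "u \<in> L \<Longrightarrow> td u [\<one>\<^bsub>A\<^esub>] \<in> carrier W"
  by (cases "u = []") (auto simp: td_one l_closed)

text \<open>The nested product multiplies \<open>v\<close> from the left by whatever words occur in
  \<open>td u [\<one>]\<close>. Hence the outer induction is on \<open>v\<close>, with the first
  word arbitrary, while \<open>td u [\<one>]\<close> is known from the explicit formula.\<close>

lemma td_closed: "\<lbrakk>u \<in> L; v \<in> L\<rbrakk> \<Longrightarrow> td u v \<in> carrier W"
proof (induction v arbitrary: u)
  case (Cons b v)
  note IHv = Cons.IH
  have bv: "b \<in> carrier A" "v \<in> L" using Cons.prems by auto
  from Cons.prems(1) show ?case
  proof (induction u)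
    case (Cons a u)
    have "rm v (td u [\<one>\<^bsub>A\<^esub>]) \<in> carrier W"
      by (rule linear_mapsD(1)[OF W_lin[OF W.module_axioms] td_one_closed])
        (use IHv Cons bv in auto)
    thus ?case using Cons IHv bv l_closed by simp
  qed (use Cons.prems in simp)
qed simp

section \<open>Right multiplication by a word, and the operator \<open>E\<close>\<close>

lemma rm_linear: "v \<in> L \<Longrightarrow> rm v \<in> linear_maps R W W"
  by (rule W_lin[OF W.module_axioms]) (rule td_closed)

lemma rm_basis: "\<lbrakk>u \<in> L; v \<in> L\<rbrakk> \<Longrightarrow> rm v (ee u) = td u v"
  using lin_ext_basis[of R W "\<lambda>w. td w v", OF W.module_axioms] td_closed by simp

text \<open>Multiplication by \<open>l - [\<one>]\<close>; it turns the last two terms of the defining recursion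
  into one, so that the nested product disappears.\<close>

definition E where
  "E = lin_ext R W (\<lambda>w. if w = [] then l \<odot>\<^bsub>W\<^esub> ee [] \<ominus>\<^bsub>W\<^esub> ee [\<one>\<^bsub>A\<^esub>] else \<ominus>\<^bsub>W\<^esub> ee (\<one>\<^bsub>A\<^esub> # w))"

lemma E_linear: "E \<in> linear_maps R W W"
  unfolding E_def by (rule W_lin[OF W.module_axioms]) (simp add: l_closed)

lemma E_closed [simp]: "x \<in> carrier W \<Longrightarrow> E x \<in> carrier W"
  by (rule linear_mapsD(1)[OF E_linear])

lemma E_basis:
  "E (ee []) = l \<odot>\<^bsub>W\<^esub> ee [] \<ominus>\<^bsub>W\<^esub> ee [\<one>\<^bsub>A\<^esub>]"
  "\<lbrakk>w \<in> L; w \<noteq> []\<rbrakk> \<Longrightarrow> E (ee w) = \<ominus>\<^bsub>W\<^esub> ee (\<one>\<^bsub>A\<^esub> # w)"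
  unfolding E_def by (subst lin_ext_basis[OF W.module_axioms]; simp add: l_closed)+

text \<open>A prefixed combination does not involve the empty word, so only the second clause of
  \<open>E\<close> is met.\<close>

lemma E_pre:
  assumes "a \<in> carrier A" "x \<in> carrier W"
  shows "E (pre a x) = \<ominus>\<^bsub>W\<^esub> pre \<one>\<^bsub>A\<^esub> (pre a x)"
  by (rule W_eqI[OF W.module_axioms linear_maps_comp[OF pre_linear[OF assms(1)] E_linear]
      linear_maps_a_inv_fun[OF W.module_axioms linear_maps_comp[OF pre_linear[OF assms(1)]
        pre_linear[OF A.one_closed]]] _ assms(2)])
    (simp add: pre_basis assms E_basis)

lemma td_one_E: "u \<in> L \<Longrightarrow> td u [\<one>\<^bsub>A\<^esub>] = l \<odot>\<^bsub>W\<^esub> ee u \<ominus>\<^bsub>W\<^esub> E (ee u)"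
proof (cases "u = []")
  case True
  have "l \<odot>\<^bsub>W\<^esub> ee [] \<ominus>\<^bsub>W\<^esub> (l \<odot>\<^bsub>W\<^esub> ee [] \<ominus>\<^bsub>W\<^esub> ee [\<one>\<^bsub>A\<^esub>]) = ee [\<one>\<^bsub>A\<^esub>]"
    using W.M.add_minus_cancel(5)[of "l \<odot>\<^bsub>W\<^esub> ee []" "\<zero>\<^bsub>W\<^esub>" "ee [\<one>\<^bsub>A\<^esub>]"] by (simp add: l_closed)
  thus ?thesis using True by (simp add: E_basis)
next
  case False
  assume "u \<in> L"
  thus ?thesis using False by (simp add: td_one E_basis W.M.minus_eq l_closed W.M.a_comm)
qed

text \<open>A direct computation without induction. For nonempty words it comes down to the fact
  that a leading unit letter can be pulled out of a product; for an empty left word it is the mirror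
  image of \<open>td_one\<close>.\<close>

lemma E_td:
  assumes u: "u \<in> L" and v: "v \<in> L"
  shows "rm v (E (ee u)) = E (td u v)"
proof (cases v)
  case Nil
  thus ?thesis using u by (simp add: lin_ext_basis_id)
next
  case (Cons b v')
  have bv: "b \<in> carrier A" "v' \<in> L" using v Cons by auto
  note lin = linear_mapsD[OF rm_linear] linear_maps_minus[OF W.module_axioms W.module_axioms rm_linear]
    linear_maps_a_inv[OF W.module_axioms W.module_axioms rm_linear]
  show ?thesis
  proof (cases u)
    case Nil
    \<comment> \<open>The nested factor is the product of \<open>[]\<close> with
      \<open>[\<one>]\<close>, that is \<open>[\<one>]\<close>, so the fourth summand of the
      recursion cancels the second.\<close>
    have "td [\<one>\<^bsub>A\<^esub>] v = ee (\<one>\<^bsub>A\<^esub> # v) \<oplus>\<^bsub>W\<^esub> pre b (td [\<one>\<^bsub>A\<^esub>] v') \<oplus>\<^bsub>W\<^esub> l \<odot>\<^bsub>W\<^esub> ee v \<ominus>\<^bsub>W\<^esub> pre b (td [\<one>\<^bsub>A\<^esub>] v')"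
      using bv Cons by (simp add: pre_basis rm_basis)
    also have "\<dots> = ee (\<one>\<^bsub>A\<^esub> # v) \<oplus>\<^bsub>W\<^esub> l \<odot>\<^bsub>W\<^esub> ee v"
      using bv v by (intro W.M.add_minus_cancel) (auto simp: l_closed td_closed)
    finally have *: "td [\<one>\<^bsub>A\<^esub>] v = ee (\<one>\<^bsub>A\<^esub> # v) \<oplus>\<^bsub>W\<^esub> l \<odot>\<^bsub>W\<^esub> ee v" .
    have "rm v (E (ee [])) = l \<odot>\<^bsub>W\<^esub> ee v \<ominus>\<^bsub>W\<^esub> td [\<one>\<^bsub>A\<^esub>] v"
      using v by (simp add: E_basis lin rm_basis l_closed)
    also have "\<dots> = \<ominus>\<^bsub>W\<^esub> ee (\<one>\<^bsub>A\<^esub> # v)"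
      unfolding * using v by (intro W.M.add_minus_cancel(6)) (auto simp: l_closed)
    also have "\<dots> = E (ee v)" using v Cons by (simp add: E_basis)
    finally show ?thesis using Nil by simp
  next
    case (Cons a u')
    have au: "a \<in> carrier A" "u' \<in> L" using u Cons by auto
    let ?X = "pre b (td (\<one>\<^bsub>A\<^esub> # u) v')" and ?Y = "l \<odot>\<^bsub>W\<^esub> pre b (td u v')"
    have cl: "td (\<one>\<^bsub>A\<^esub> # u) v' \<in> carrier W" "td u v' \<in> carrier W" "td u v \<in> carrier W"
      using u bv v by (auto simp: td_closed)
    \<comment> \<open>By \<open>td_one\<close>, the nested product reproduces the second and third
      summands of the recursion for \<open>\<one> # u\<close>, so that only the first
      survives.\<close>
    have rm1: "rm v' (td u [\<one>\<^bsub>A\<^esub>]) = td (\<one>\<^bsub>A\<^esub> # u) v' \<oplus>\<^bsub>W\<^esub> l \<odot>\<^bsub>W\<^esub> td u v'"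
      using u bv Cons by (subst td_one) (simp_all add: lin rm_basis l_closed del: td_shuffle.simps)
    have "td (\<one>\<^bsub>A\<^esub> # u) v = pre \<one>\<^bsub>A\<^esub> (td u v) \<oplus>\<^bsub>W\<^esub> ?X \<oplus>\<^bsub>W\<^esub> ?Y \<ominus>\<^bsub>W\<^esub> pre b (rm v' (td u [\<one>\<^bsub>A\<^esub>]))"
      unfolding \<open>v = b # v'\<close> by (subst td_shuffle.simps) (simp add: bv)
    also have "pre b (rm v' (td u [\<one>\<^bsub>A\<^esub>])) = ?X \<oplus>\<^bsub>W\<^esub> ?Y"
      unfolding rm1 using cl bv by (simp add: pre_add pre_smult l_closed)
    also have "pre \<one>\<^bsub>A\<^esub> (td u v) \<oplus>\<^bsub>W\<^esub> ?X \<oplus>\<^bsub>W\<^esub> ?Y \<ominus>\<^bsub>W\<^esub> (?X \<oplus>\<^bsub>W\<^esub> ?Y) = pre \<one>\<^bsub>A\<^esub> (td u v)"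
      using cl bv by (intro W.M.add_minus_cancel) (auto simp: l_closed)
    finally have *: "td (\<one>\<^bsub>A\<^esub> # u) v = pre \<one>\<^bsub>A\<^esub> (td u v)" .
    \<comment> \<open>Both words are nonempty, so every summand of the recursion is a prefixed
      combination; the elements on which \<open>E\<close> is minus prefixing \<open>\<one>\<close>
      form a submodule containing all of these.\<close>
    have sub: "submodule {x \<in> carrier W. E x = \<ominus>\<^bsub>W\<^esub> pre \<one>\<^bsub>A\<^esub> x} R W" (is "submodule ?K R W")
      by (rule submodule_equalizer[OF W.module_axioms W.module_axioms E_linear
          linear_maps_a_inv_fun[OF W.module_axioms pre_linear[OF A.one_closed]]])
    have preK: "pre c x \<in> ?K" if "c \<in> carrier A" "x \<in> carrier W" for c x
      using that by (simp add: E_pre)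
    have "td u v \<in> ?K"
      unfolding \<open>v = b # v'\<close> Cons
      by (subst td_shuffle.simps)
        (intro W.submodule_minus_closed[OF sub] W.submoduleE(4,5)[OF sub] preK linear_mapsD(1)[OF rm_linear];
          use au bv l_closed v \<open>v = b # v'\<close> u Cons in \<open>simp add: td_closed td_one_closed del: td_shuffle.simps\<close>)
    hence "E (td u v) = \<ominus>\<^bsub>W\<^esub> pre \<one>\<^bsub>A\<^esub> (td u v)" by simp
    thus ?thesis using u v Cons * by (simp add: E_basis lin rm_basis del: td_shuffle.simps)
  qed
qed

text \<open>By \<open>td_one_E\<close> and \<open>E_td\<close> the nested product is
  \<open>l\<close> times \<open>td u v\<close> minus \<open>E (td u v)\<close>, and its first part
  cancels the summand with \<open>l\<close>. In this form the recursion treats its two factors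
  alike.\<close>

lemma td_Cons:
  assumes "a \<in> carrier A" "b \<in> carrier A" "u \<in> L" "v \<in> L"
  shows "td (a # u) (b # v) = pre a (td u (b # v)) \<oplus>\<^bsub>W\<^esub> pre b (td (a # u) v) \<oplus>\<^bsub>W\<^esub> pre (a \<otimes>\<^bsub>A\<^esub> b) (E (td u v))"
proof -
  let ?p = "pre (a \<otimes>\<^bsub>A\<^esub> b)"
  have cl: "td u (b # v) \<in> carrier W" "td (a # u) v \<in> carrier W" "td u v \<in> carrier W"
    using assms by (simp_all add: td_closed del: td_shuffle.simps)
  note lin = linear_mapsD[OF rm_linear] linear_maps_minus[OF W.module_axioms W.module_axioms rm_linear]
  have "rm v (td u [\<one>\<^bsub>A\<^esub>]) = l \<odot>\<^bsub>W\<^esub> td u v \<ominus>\<^bsub>W\<^esub> E (td u v)"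
    using assms by (subst td_one_E) (simp_all add: lin l_closed rm_basis E_td)
  hence "?p (rm v (td u [\<one>\<^bsub>A\<^esub>])) = l \<odot>\<^bsub>W\<^esub> ?p (td u v) \<ominus>\<^bsub>W\<^esub> ?p (E (td u v))"
    using cl assms by (simp add: pre_minus pre_smult l_closed)
  moreover have "pre a (td u (b # v)) \<oplus>\<^bsub>W\<^esub> pre b (td (a # u) v) \<oplus>\<^bsub>W\<^esub> l \<odot>\<^bsub>W\<^esub> ?p (td u v) \<ominus>\<^bsub>W\<^esub>
      (l \<odot>\<^bsub>W\<^esub> ?p (td u v) \<ominus>\<^bsub>W\<^esub> ?p (E (td u v))) =
      pre a (td u (b # v)) \<oplus>\<^bsub>W\<^esub> pre b (td (a # u) v) \<oplus>\<^bsub>W\<^esub> ?p (E (td u v))"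
    using cl assms by (intro W.M.add_minus_cancel(5)) (auto simp: l_closed)
  ultimately show ?thesis by (subst td_shuffle.simps) (simp only:)
qed

text \<open>The outer induction on \<open>v\<close> settles the products with the shorter right
  word, for every left word; the inner induction on \<open>u\<close> settles the remaining one,
  \<open>td u (b # v)\<close>.\<close>

lemma td_comm: "\<lbrakk>u \<in> L; v \<in> L\<rbrakk> \<Longrightarrow> td u v = td v u"
proof (induction v arbitrary: u)
  case (Cons b v)
  note IHv = Cons.IH
  have bv: "b \<in> carrier A" "v \<in> L" using Cons.prems by auto
  from Cons.prems(1) show ?case
  proof (induction u)
    case (Cons a u)
    have au: "a \<in> carrier A" "u \<in> L" using Cons by auto
    have IHu: "td u (b # v) = td (b # v) u" using Cons.IH by simp
    have "td v (a # u) \<in> carrier W" "td (b # v) u \<in> carrier W" "td v u \<in> carrier W"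
      using au bv by (simp_all add: td_closed del: td_shuffle.simps)
    thus ?case using au bv IHv[of "a # u"] IHv[of u] IHu
      by (simp add: td_Cons A.m_comm W.M.a_ac del: td_shuffle.simps)
  qed simp
qed simp

section \<open>Bilinear extension of the product, and associativity\<close>

definition mul where "mul = bilin_ext R W td"

lemma mul_bilinear: "mul \<in> bilinear_maps R W W W"
  unfolding mul_def using bilin_ext_bilinear[OF W.module_axioms, of L L td] td_closed
  by (simp add: word_module_def)

lemma mul_basis: "\<lbrakk>u \<in> L; v \<in> L\<rbrakk> \<Longrightarrow> mul (ee u) (ee v) = td u v"
  unfolding mul_def bilin_ext_def
  using lin_ext_basis[of R W "td u", OF W.module_axioms]
    lin_ext_basis[of R W "\<lambda>u. lin_ext R W (td u) (ee v)", OF W.module_axioms] td_closed by simp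

lemma mul_closed [simp]: "\<lbrakk>x \<in> carrier W; y \<in> carrier W\<rbrakk> \<Longrightarrow> mul x y \<in> carrier W"
  by (rule bilinear_maps_closed[OF mul_bilinear])

lemmas mul_lin2 = linear_mapsD(2,3)[OF bilinear_mapsD(2)[OF mul_bilinear]]

lemma spans_W: "spans R W (ee ` L)"
  unfolding word_module_def by (rule spans_free_module[OF A.R.cring_axioms])

lemma W_bilin_eqI:
  assumes "b \<in> bilinear_maps R W W W" "c \<in> bilinear_maps R W W W"
    "\<And>u v. \<lbrakk>u \<in> L; v \<in> L\<rbrakk> \<Longrightarrow> b (ee u) (ee v) = c (ee u) (ee v)" "x \<in> carrier W" "y \<in> carrier W"
  shows "b x y = c x y"
  by (rule bilinear_maps_eqI[OF W.module_axioms W.module_axioms W.module_axioms spans_W spans_W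
        assms(1,2) _ assms(4,5)]) (elim imageE, simp only: assms(3))

lemma mul_comm: "\<lbrakk>x \<in> carrier W; y \<in> carrier W\<rbrakk> \<Longrightarrow> mul x y = mul y x"
  by (rule W_bilin_eqI[OF mul_bilinear bilinear_maps_flip[OF mul_bilinear]])
    (simp add: mul_basis td_comm)

lemma mul_one: "x \<in> carrier W \<Longrightarrow> mul (ee []) x = x"
  by (rule W_eqI[OF W.module_axioms bilinear_mapsD(1)[OF mul_bilinear] linear_maps_id])
    (simp_all add: mul_basis)

lemma E_mul: "\<lbrakk>x \<in> carrier W; y \<in> carrier W\<rbrakk> \<Longrightarrow> mul (E x) y = E (mul x y)"
proof (rule W_bilin_eqI[OF bilinear_maps_comp[OF mul_bilinear E_linear linear_maps_id linear_maps_id]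
      bilinear_maps_comp[OF mul_bilinear linear_maps_id linear_maps_id E_linear]])
  fix u v assume uv: "u \<in> L" "v \<in> L"
  have "mul x (ee v) = rm v x" if "x \<in> carrier W" for x
    by (rule W_eqI[OF W.module_axioms bilinear_mapsD(2)[OF mul_bilinear] rm_linear _ that])
      (use uv in \<open>simp_all add: mul_basis rm_basis\<close>)
  thus "mul (E (ee u)) (ee v) = E (mul (ee u) (ee v))" using uv by (simp add: E_td rm_basis)
qed

text \<open>The recursion for arbitrary combinations instead of words; only in this form can it be
  applied again to its own summands.\<close>

lemma mul_pre:
  assumes a: "a \<in> carrier A" and b: "b \<in> carrier A" and "x \<in> carrier W" "y \<in> carrier W"
  shows "mul (pre a x) (pre b y) =
    pre a (mul x (pre b y)) \<oplus>\<^bsub>W\<^esub> pre b (mul (pre a x) y) \<oplus>\<^bsub>W\<^esub> pre (a \<otimes>\<^bsub>A\<^esub> b) (E (mul x y))"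
proof (rule W_bilin_eqI[OF _ _ _ assms(3,4)])
  note id = linear_maps_id and pa = pre_linear[OF a] and pb = pre_linear[OF b]
  show "(\<lambda>x y. mul (pre a x) (pre b y)) \<in> bilinear_maps R W W W"
    by (rule bilinear_maps_comp[OF mul_bilinear pa pb id])
  show "(\<lambda>x y. pre a (mul x (pre b y)) \<oplus>\<^bsub>W\<^esub> pre b (mul (pre a x) y) \<oplus>\<^bsub>W\<^esub>
      pre (a \<otimes>\<^bsub>A\<^esub> b) (E (mul x y))) \<in> bilinear_maps R W W W"
    using a b
    by (intro bilinear_maps_add W.module_axioms bilinear_maps_comp[OF mul_bilinear id pb pa]
        bilinear_maps_comp[OF mul_bilinear pa id pb]
        bilinear_maps_comp[OF mul_bilinear id id linear_maps_comp[OF E_linear pre_linear]]) simp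
  fix u v assume "u \<in> L" "v \<in> L"
  thus "mul (pre a (ee u)) (pre b (ee v)) = pre a (mul (ee u) (pre b (ee v))) \<oplus>\<^bsub>W\<^esub>
      pre b (mul (pre a (ee u)) (ee v)) \<oplus>\<^bsub>W\<^esub> pre (a \<otimes>\<^bsub>A\<^esub> b) (E (mul (ee u) (ee v)))"
    using a b by (simp add: pre_basis mul_basis td_Cons del: td_shuffle.simps)
qed

text \<open>\<open>mul_pre\<close> is applied to each of the three summands of the inner product.
  \<open>E_mul\<close> pulls \<open>E\<close> out of products, and the three terms with leading
  letter \<open>c\<close> recombine to the inner product times \<open>z\<close>. What results is
  unchanged when \<open>a\<close>, \<open>x\<close> are exchanged with \<open>c\<close>,
  \<open>z\<close>, provided the smaller triple products can be reversed.\<close>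

lemma mul_pre3:
  assumes abc: "a \<in> carrier A" "b \<in> carrier A" "c \<in> carrier A"
    and xyz: "x \<in> carrier W" "y \<in> carrier W" "z \<in> carrier W"
  shows "mul (mul (pre a x) (pre b y)) (pre c z) =
    pre a (mul (mul x (pre b y)) (pre c z)) \<oplus>\<^bsub>W\<^esub> pre b (mul (mul (pre a x) y) (pre c z)) \<oplus>\<^bsub>W\<^esub>
    pre c (mul (mul (pre a x) (pre b y)) z) \<oplus>\<^bsub>W\<^esub>
    pre (a \<otimes>\<^bsub>A\<^esub> c) (E (mul (mul x (pre b y)) z)) \<oplus>\<^bsub>W\<^esub> pre (b \<otimes>\<^bsub>A\<^esub> c) (E (mul (mul (pre a x) y) z)) \<oplus>\<^bsub>W\<^esub>
    pre (a \<otimes>\<^bsub>A\<^esub> b) (E (mul (mul x y) (pre c z))) \<oplus>\<^bsub>W\<^esub>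
    pre (a \<otimes>\<^bsub>A\<^esub> b \<otimes>\<^bsub>A\<^esub> c) (E (E (mul (mul x y) z)))"
  (is "_ = ?rhs")
proof -
  define X where "X = mul x (pre b y)"
  define Y where "Y = mul (pre a x) y"
  define Z where "Z = mul x y"
  have cl: "X \<in> carrier W" "Y \<in> carrier W" "Z \<in> carrier W"
    using assms by (auto simp: X_def Y_def Z_def)
  have *: "mul (pre a x) (pre b y) = pre a X \<oplus>\<^bsub>W\<^esub> pre b Y \<oplus>\<^bsub>W\<^esub> pre (a \<otimes>\<^bsub>A\<^esub> b) (E Z)"
    using mul_pre[OF abc(1,2) xyz(1,2)] by (simp add: X_def Y_def Z_def)
  have "mul (pre a X \<oplus>\<^bsub>W\<^esub> pre b Y \<oplus>\<^bsub>W\<^esub> pre (a \<otimes>\<^bsub>A\<^esub> b) (E Z)) (pre c z) =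
    pre a (mul X (pre c z)) \<oplus>\<^bsub>W\<^esub> pre b (mul Y (pre c z)) \<oplus>\<^bsub>W\<^esub>
    pre c (mul (pre a X \<oplus>\<^bsub>W\<^esub> pre b Y \<oplus>\<^bsub>W\<^esub> pre (a \<otimes>\<^bsub>A\<^esub> b) (E Z)) z) \<oplus>\<^bsub>W\<^esub>
    pre (a \<otimes>\<^bsub>A\<^esub> c) (E (mul X z)) \<oplus>\<^bsub>W\<^esub> pre (b \<otimes>\<^bsub>A\<^esub> c) (E (mul Y z)) \<oplus>\<^bsub>W\<^esub>
    pre (a \<otimes>\<^bsub>A\<^esub> b) (E (mul Z (pre c z))) \<oplus>\<^bsub>W\<^esub> pre (a \<otimes>\<^bsub>A\<^esub> b \<otimes>\<^bsub>A\<^esub> c) (E (E (mul Z z)))"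
    using abc cl xyz(3) by (simp add: mul_lin2 mul_pre E_mul pre_add W.M.a_ac)
  thus ?thesis unfolding * X_def[symmetric] Y_def[symmetric] Z_def[symmetric] .
qed

lemma mul_assoc_basis:
  "\<lbrakk>u \<in> L; v \<in> L; w \<in> L\<rbrakk> \<Longrightarrow> mul (mul (ee u) (ee v)) (ee w) = mul (ee u) (mul (ee v) (ee w))"
proof (induction "length u + length v + length w" arbitrary: u v w rule: less_induct)
  case less
  note uvw = less.prems
  show ?case
  proof (cases "u = [] \<or> v = [] \<or> w = []")
    case True
    have "mul x (ee []) = x" if "x \<in> carrier W" for x
      using mul_comm[OF that, of "ee []"] mul_one[OF that] by simp
    moreover note uvw[THEN ee_closed]
    ultimately show ?thesis using True by (elim disjE) (simp_all only: mul_one mul_closed)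
  next
    case False
    then obtain a u' b v' c w' where eqs: "u = a # u'" "v = b # v'" "w = c # w'"
      by (meson neq_Nil_conv)
    have abc: "a \<in> carrier A" "b \<in> carrier A" "c \<in> carrier A" and L: "u' \<in> L" "v' \<in> L" "w' \<in> L"
      using uvw eqs by auto
    have pre: "ee u = pre a (ee u')" "ee v = pre b (ee v')" "ee w = pre c (ee w')"
      using eqs abc L by (simp_all add: pre_basis)
    have cl: "ee u \<in> carrier W" "ee v \<in> carrier W" "ee w \<in> carrier W"
      "ee u' \<in> carrier W" "ee v' \<in> carrier W" "ee w' \<in> carrier W" using uvw L by auto
    \<comment> \<open>Given commutativity, associativity amounts to reversing a triple product,
      which is the symmetry displayed by \<open>mul_pre3\<close>. Each of its seven terms contains a
      triple of smaller total length.\<close>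
    have IH: "mul (mul (ee x) (ee y)) (ee z) = mul (mul (ee z) (ee y)) (ee x)"
      if "x \<in> L" "y \<in> L" "z \<in> L" "length x + length y + length z < length u + length v + length w"
      for x y z
      using less.hyps[OF that(4,1-3)] that mul_comm[of "ee x"] mul_comm[of "ee y" "ee z"] by simp
    have "mul (mul (ee u) (ee v)) (ee w) =
      pre a (mul (mul (ee u') (ee v)) (ee w)) \<oplus>\<^bsub>W\<^esub> pre b (mul (mul (ee u) (ee v')) (ee w)) \<oplus>\<^bsub>W\<^esub>
      pre c (mul (mul (ee u) (ee v)) (ee w')) \<oplus>\<^bsub>W\<^esub>
      pre (a \<otimes>\<^bsub>A\<^esub> c) (E (mul (mul (ee u') (ee v)) (ee w'))) \<oplus>\<^bsub>W\<^esub>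
      pre (b \<otimes>\<^bsub>A\<^esub> c) (E (mul (mul (ee u) (ee v')) (ee w'))) \<oplus>\<^bsub>W\<^esub>
      pre (a \<otimes>\<^bsub>A\<^esub> b) (E (mul (mul (ee u') (ee v')) (ee w))) \<oplus>\<^bsub>W\<^esub>
      pre (a \<otimes>\<^bsub>A\<^esub> b \<otimes>\<^bsub>A\<^esub> c) (E (E (mul (mul (ee u') (ee v')) (ee w'))))"
      unfolding pre by (rule mul_pre3[OF abc cl(4-6)])
    also have "\<dots> =
      pre c (mul (mul (ee w') (ee v)) (ee u)) \<oplus>\<^bsub>W\<^esub> pre b (mul (mul (ee w) (ee v')) (ee u)) \<oplus>\<^bsub>W\<^esub>
      pre a (mul (mul (ee w) (ee v)) (ee u')) \<oplus>\<^bsub>W\<^esub>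
      pre (c \<otimes>\<^bsub>A\<^esub> a) (E (mul (mul (ee w') (ee v)) (ee u'))) \<oplus>\<^bsub>W\<^esub>
      pre (b \<otimes>\<^bsub>A\<^esub> a) (E (mul (mul (ee w) (ee v')) (ee u'))) \<oplus>\<^bsub>W\<^esub>
      pre (c \<otimes>\<^bsub>A\<^esub> b) (E (mul (mul (ee w') (ee v')) (ee u))) \<oplus>\<^bsub>W\<^esub>
      pre (c \<otimes>\<^bsub>A\<^esub> b \<otimes>\<^bsub>A\<^esub> a) (E (E (mul (mul (ee w') (ee v')) (ee u'))))"
      using IH[of u' v w] IH[of u v' w] IH[of u v w'] IH[of u' v w'] IH[of u v' w'] IH[of u' v' w]
        IH[of u' v' w'] uvw L abc cl eqs
      by (simp add: W.M.a_ac A.m_ac del: td_shuffle.simps)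
    also have "\<dots> = mul (mul (ee w) (ee v)) (ee u)"
      unfolding pre by (rule mul_pre3[OF abc(3,2,1) cl(6,5,4), symmetric])
    also have "\<dots> = mul (ee u) (mul (ee v) (ee w))"
      using cl mul_comm by simp
    finally show ?thesis .
  qed
qed

text \<open>The product is recorded as an algebra on \<open>W\<close> so that
  \<open>algebraI_spans\<close> extends associativity from words to combinations.\<close>

lemma mul_algebra: "algebra R (W\<lparr>mult := mul, one := ee []\<rparr>)"
proof (rule algebraI_spans[OF module_update[OF W.module_axioms], where S = "ee ` L"])
  show "spans R (W\<lparr>mult := mul, one := ee []\<rparr>) (ee ` L)"
    using spans_W by (simp add: spans_def submodule_span_def)
  show "mult (W\<lparr>mult := mul, one := ee []\<rparr>) \<in> bilinear_maps R (W\<lparr>mult := mul, one := ee []\<rparr>)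
      (W\<lparr>mult := mul, one := ee []\<rparr>) (W\<lparr>mult := mul, one := ee []\<rparr>)"
    using mul_bilinear by simp
next
  fix x y z assume "x \<in> ee ` L" "y \<in> ee ` L" "z \<in> ee ` L"
  thus "x \<otimes>\<^bsub>W\<lparr>mult := mul, one := ee []\<rparr>\<^esub> y \<otimes>\<^bsub>W\<lparr>mult := mul, one := ee []\<rparr>\<^esub> z =
      x \<otimes>\<^bsub>W\<lparr>mult := mul, one := ee []\<rparr>\<^esub> (y \<otimes>\<^bsub>W\<lparr>mult := mul, one := ee []\<rparr>\<^esub> z)"
    by (elim imageE) (simp add: mul_assoc_basis)
qed (auto intro: mul_comm mul_one ee_closed)

lemma mul_assoc:
  assumes "x \<in> carrier W" "y \<in> carrier W" "z \<in> carrier W"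
  shows "mul (mul x y) z = mul x (mul y z)"
proof -
  interpret algebra R "W\<lparr>mult := mul, one := ee []\<rparr>" by (rule mul_algebra)
  show ?thesis using m_assoc assms by simp
qed

end

section \<open>The algebra \<open>Sh(A)\<close>\<close>

context td_words
begin

section \<open>Formal words of positive length and the multilinearity relations\<close>

abbreviation "SW \<equiv> sh_words A"
abbreviation "F \<equiv> free_module R SW"
abbreviation "K \<equiv> sh_kernel R A"
abbreviation "S \<equiv> Sh R A l"

definition "shmul = bilin_ext R F (\<lambda>u v. pre (hd u \<otimes>\<^bsub>A\<^esub> hd v) (td (tl u) (tl v)))"
definition "cl = fp_class R SW (sh_rels R A)"

lemma Sh_eq_fp_module: "S = fp_module R SW (sh_rels R A) shmul (ee [\<one>\<^bsub>A\<^esub>])"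
  by (simp add: Sh_def fp_module_def sh_kernel_def Let_def shmul_def)

lemma sh_pure_eq_cl: "sh_pure R A w = cl (ee w)"
  by (simp add: sh_pure_def cl_def fp_class_def sh_kernel_def)

lemma sh_words_iff: "w \<in> SW \<longleftrightarrow> w \<in> L \<and> w \<noteq> []"
  by (simp add: sh_words_def)

lemma sh_words_cases:
  assumes "w \<in> SW"
  obtains a u where "a \<in> carrier A" "u \<in> L" "w = a # u"
  using assms by (cases w) (auto simp: sh_words_iff)

sublocale F: module R F
  by (rule module_free_module[OF A.R.cring_axioms])

lemma eeF_closed: "w \<in> SW \<Longrightarrow> ee w \<in> carrier F"
  by (rule basis_elt_closed[OF A.R.cring_axioms])

lemma ee_Cons_closed: "\<lbrakk>a \<in> carrier A; u \<in> L\<rbrakk> \<Longrightarrow> ee (a # u) \<in> carrier F"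
  by (rule eeF_closed) (simp add: sh_words_iff)

text \<open>Elements of both modules are functions on all words, so the inclusion is the identity
  function, and sums and multiples are the same functions. Negation is defined through the carrier,
  however, so differences have to be transferred by linearity.\<close>

lemma F_to_W_linear: "(\<lambda>x. x) \<in> linear_maps R F W"
  unfolding word_module_def
  by (rule linear_mapsI)
    (simp_all add: free_module_carrier[OF A.R.cring_axioms] free_module_simps sh_words_iff)

lemmas F_closed_W = linear_mapsD(1)[OF F_to_W_linear]
lemmas F_add_W = linear_mapsD(2)[OF F_to_W_linear]
lemmas F_smult_W = linear_mapsD(3)[OF F_to_W_linear]
lemmas F_minus_W = linear_maps_minus[OF F.module_axioms W.module_axioms F_to_W_linear]

text \<open>\<open>finsum\<close> depends on the module in which it is taken. The extension formed
  in \<open>W\<close> is therefore compared on basis words with the one formed in \<open>F\<close>,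
  where a prefixed combination belongs.\<close>

lemma pre_linear_F:
  assumes a: "a \<in> carrier A"
  shows "pre a \<in> linear_maps R W F"
proof (rule linear_maps_cong[OF W.module_axioms])
  show lin: "lin_ext R F (\<lambda>w. ee (a # w)) \<in> linear_maps R W F"
    by (rule W_lin[OF F.module_axioms ee_Cons_closed[OF a]])
  fix x assume x: "x \<in> carrier W"
  show "pre a x = lin_ext R F (\<lambda>w. ee (a # w)) x"
    by (rule W_eqI[OF W.module_axioms pre_linear[OF a] linear_maps_comp[OF lin F_to_W_linear] _ x])
      (simp add: pre_basis a lin_ext_basis[OF F.module_axioms] ee_Cons_closed)
qed

lemmas preF_closed = linear_mapsD(1)[OF pre_linear_F]

text \<open>The relations are indexed by the words before and after the altered letter, so that
  prefixing a letter merely lengthens the first index.\<close>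

definition rel_add where
  "rel_add u a b v = ee (u @ (a \<oplus>\<^bsub>A\<^esub> b) # v) \<ominus>\<^bsub>F\<^esub> ee (u @ a # v) \<ominus>\<^bsub>F\<^esub> ee (u @ b # v)"
definition rel_smult where
  "rel_smult u r a v = ee (u @ (r \<odot>\<^bsub>A\<^esub> a) # v) \<ominus>\<^bsub>F\<^esub> r \<odot>\<^bsub>F\<^esub> ee (u @ a # v)"

lemma sh_rels_eq: "sh_rels R A =
    {rel_add u a b v | u a b v. u \<in> L \<and> v \<in> L \<and> a \<in> carrier A \<and> b \<in> carrier A} \<union>
    {rel_smult u r a v | r u a v. r \<in> carrier R \<and> u \<in> L \<and> v \<in> L \<and> a \<in> carrier A}"
  by (simp add: sh_rels_def Let_def rel_add_def rel_smult_def)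

lemma sh_rels_cases [consumes 1, case_names add smult]:
  assumes "s \<in> sh_rels R A"
  obtains u a b v where "u \<in> L" "v \<in> L" "a \<in> carrier A" "b \<in> carrier A" "s = rel_add u a b v"
  | u r a v where "u \<in> L" "v \<in> L" "r \<in> carrier R" "a \<in> carrier A" "s = rel_smult u r a v"
proof -
  show thesis
    using assms unfolding sh_rels_eq
  proof (elim UnE CollectE exE conjE)
    fix u a b v assume "s = rel_add u a b v" "u \<in> L" "v \<in> L" "a \<in> carrier A" "b \<in> carrier A"
    thus thesis using that(1) by simp
  next
    fix u r a v assume "s = rel_smult u r a v" "u \<in> L" "v \<in> L" "r \<in> carrier R" "a \<in> carrier A"
    thus thesis using that(2) by simp
  qed
qed

lemma rel_add_in_sh_rels:
  "\<lbrakk>u \<in> L; v \<in> L; a \<in> carrier A; b \<in> carrier A\<rbrakk> \<Longrightarrow> rel_add u a b v \<in> sh_rels R A"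
  unfolding sh_rels_eq by (rule UnI1, intro CollectI exI conjI, rule refl)

lemma rel_smult_in_sh_rels:
  "\<lbrakk>u \<in> L; v \<in> L; r \<in> carrier R; a \<in> carrier A\<rbrakk> \<Longrightarrow> rel_smult u r a v \<in> sh_rels R A"
  unfolding sh_rels_eq by (rule UnI2, intro CollectI exI conjI, rule refl)

lemmas sh_relsI = rel_add_in_sh_rels rel_smult_in_sh_rels

lemma insert_letter_word: "\<lbrakk>u \<in> L; v \<in> L; a \<in> carrier A\<rbrakk> \<Longrightarrow> u @ a # v \<in> SW"
  by (simp add: sh_words_iff)

lemma sh_rels_closed: "sh_rels R A \<subseteq> carrier F"
proof
  fix s assume "s \<in> sh_rels R A"
  thus "s \<in> carrier F"
    by (cases rule: sh_rels_cases)
      (simp_all add: rel_add_def rel_smult_def eeF_closed insert_letter_word)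
qed

lemmas S_module = module_fp_module[OF A.R.cring_axioms sh_rels_closed, of shmul "ee [\<one>\<^bsub>A\<^esub>]",
    folded Sh_eq_fp_module]

sublocale S: module R S by (rule S_module)

lemma cl_linear: "cl \<in> linear_maps R F S"
  unfolding cl_def Sh_eq_fp_module by (rule fp_class_linear[OF A.R.cring_axioms sh_rels_closed])

lemma spans_S: "spans R S (sh_pure R A ` SW)"
  using fp_spans[OF A.R.cring_axioms sh_rels_closed]
  by (simp add: Sh_eq_fp_module sh_pure_eq_cl[abs_def] cl_def)

section \<open>The kernel inside all combinations of words\<close>

lemma K_submodule: "submodule K R F"
  unfolding sh_kernel_def by (rule F.submodule_span_submodule[OF sh_rels_closed])

lemma rels_in_K: "sh_rels R A \<subseteq> K"
  unfolding sh_kernel_def by (rule submodule_span_superset)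

lemma K_subset_F: "x \<in> K \<Longrightarrow> x \<in> carrier F"
  using F.submoduleE(1)[OF K_submodule] by blast

lemma K_subset_W: "x \<in> K \<Longrightarrow> x \<in> carrier W"
  by (rule F_closed_W[OF K_subset_F])

text \<open>Tails of words may be empty, so prefixing and the product \<open>mul\<close> are
  computed in \<open>W\<close>; closure arguments for them need the kernel as a submodule
  there.\<close>

lemma K_submodule_W: "submodule K R W"
proof (rule W.submoduleI)
  show "K \<subseteq> carrier W" using K_subset_W by blast
  show "\<zero>\<^bsub>W\<^esub> \<in> K" using F.submodule_zero_closed[OF K_submodule] by (simp add: word_module_def free_module_simps)
  show "\<ominus>\<^bsub>W\<^esub> x \<in> K" if "x \<in> K" for x
    using linear_maps_a_inv[OF F.module_axioms W.module_axioms F_to_W_linear K_subset_F[OF that]]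
      F.submoduleE(3)[OF K_submodule that] by simp
  show "x \<oplus>\<^bsub>W\<^esub> y \<in> K" if "x \<in> K" "y \<in> K" for x y
    using F_add_W[OF K_subset_F[OF that(1)] K_subset_F[OF that(2)]]
      F.submoduleE(5)[OF K_submodule that] by simp
  show "r \<odot>\<^bsub>W\<^esub> x \<in> K" if "r \<in> carrier R" "x \<in> K" for r x
    using F_smult_W[OF that(1) K_subset_F[OF that(2)]] F.submoduleE(4)[OF K_submodule that] by simp
qed

lemmas K_add = W.submoduleE(5)[OF K_submodule_W]
lemmas K_a_inv = W.submoduleE(3)[OF K_submodule_W]

lemma rel_add_W:
  assumes "u \<in> L" "a \<in> carrier A" "b \<in> carrier A" "v \<in> L"
  shows "rel_add u a b v = ee (u @ (a \<oplus>\<^bsub>A\<^esub> b) # v) \<ominus>\<^bsub>W\<^esub> ee (u @ a # v) \<ominus>\<^bsub>W\<^esub> ee (u @ b # v)"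
  unfolding rel_add_def using assms
  by (subst F_minus_W[OF F.M.minus_closed[OF eeF_closed eeF_closed] eeF_closed],
      (simp_all add: insert_letter_word)[3], subst F_minus_W[OF eeF_closed eeF_closed])
    (simp_all add: insert_letter_word)

lemma rel_smult_W:
  assumes "u \<in> L" "r \<in> carrier R" "a \<in> carrier A" "v \<in> L"
  shows "rel_smult u r a v = ee (u @ (r \<odot>\<^bsub>A\<^esub> a) # v) \<ominus>\<^bsub>W\<^esub> r \<odot>\<^bsub>W\<^esub> ee (u @ a # v)"
  unfolding rel_smult_def using assms
  by (subst F_minus_W[OF eeF_closed F.smult_closed[OF assms(2) eeF_closed]])
    (simp_all add: F_smult_W eeF_closed insert_letter_word)

lemma rel_add_Cons:
  assumes "d \<in> carrier A" "u \<in> L" "a \<in> carrier A" "b \<in> carrier A" "v \<in> L"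
  shows "rel_add (d # u) a b v = pre d (rel_add u a b v)"
  using assms by (simp add: rel_add_W pre_minus pre_basis)

lemma rel_smult_Cons:
  assumes "d \<in> carrier A" "u \<in> L" "r \<in> carrier R" "a \<in> carrier A" "v \<in> L"
  shows "rel_smult (d # u) r a v = pre d (rel_smult u r a v)"
  using assms by (simp add: rel_smult_W pre_minus pre_smult pre_basis)

text \<open>A relation prefixed by a letter is a relation with the altered letter one place further
  on, so generators of \<open>K\<close> go to generators.\<close>

lemma pre_K: "\<lbrakk>d \<in> carrier A; x \<in> K\<rbrakk> \<Longrightarrow> pre d x \<in> K"
proof -
  assume d: "d \<in> carrier A" and x: "x \<in> K"
  have "K \<subseteq> {x \<in> carrier F. pre d x \<in> K}"
    unfolding sh_kernel_def[of R A]
  proof (rule submodule_span_least)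
    show "submodule {x \<in> carrier F. pre d x \<in> submodule_span R F (sh_rels R A)} R F"
      using submodule_preimage[OF F.module_axioms W.module_axioms
          linear_maps_comp[OF F_to_W_linear pre_linear[OF d]] K_submodule_W]
      by (simp add: sh_kernel_def)
    show "sh_rels R A \<subseteq> {x \<in> carrier F. pre d x \<in> submodule_span R F (sh_rels R A)}"
    proof
      fix s assume s: "s \<in> sh_rels R A"
      hence "pre d s \<in> sh_rels R A"
      proof (cases rule: sh_rels_cases)
        case (add u a b v)
        thus ?thesis using d sh_relsI(1)[of "d # u" v a b] by (simp add: rel_add_Cons)
      next
        case (smult u r a v)
        thus ?thesis using d sh_relsI(2)[of "d # u" v r a] by (simp add: rel_smult_Cons)
      qed
      thus "s \<in> {x \<in> carrier F. pre d x \<in> submodule_span R F (sh_rels R A)}"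
        using s rels_in_K sh_rels_closed by (auto simp: sh_kernel_def)
    qed
  qed
  thus ?thesis using x by blast
qed

lemma E_F: "x \<in> carrier F \<Longrightarrow> E x = \<ominus>\<^bsub>W\<^esub> pre \<one>\<^bsub>A\<^esub> x"
  by (rule free_linear_maps_eqI[OF W.module_axioms linear_maps_comp[OF F_to_W_linear E_linear]
        linear_maps_comp[OF F_to_W_linear linear_maps_a_inv_fun[OF W.module_axioms
          pre_linear[OF A.one_closed]]]])
    (simp_all add: E_basis pre_basis sh_words_iff)

lemma E_K: "x \<in> K \<Longrightarrow> E x \<in> K"
  by (simp add: E_F K_subset_F K_a_inv pre_K)

text \<open>For a single word as tail this is a relation in the first letter. The expression is
  linear in the tail, and the product recursion produces it with tails that are
  combinations.\<close>

lemma rel_add_Nil: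
  assumes "a \<in> carrier A" "b \<in> carrier A" "x \<in> carrier W"
  shows "pre (a \<oplus>\<^bsub>A\<^esub> b) x \<ominus>\<^bsub>W\<^esub> pre a x \<ominus>\<^bsub>W\<^esub> pre b x \<in> K"
proof -
  have "carrier W \<subseteq> {x \<in> carrier W. pre (a \<oplus>\<^bsub>A\<^esub> b) x \<ominus>\<^bsub>W\<^esub> pre a x \<ominus>\<^bsub>W\<^esub> pre b x \<in> K}"
  proof (rule spansD[OF spans_W submodule_preimage[OF W.module_axioms W.module_axioms _ K_submodule_W]])
    show "(\<lambda>x. pre (a \<oplus>\<^bsub>A\<^esub> b) x \<ominus>\<^bsub>W\<^esub> pre a x \<ominus>\<^bsub>W\<^esub> pre b x) \<in> linear_maps R W W"
      using assms by (intro linear_maps_minus_fun W.module_axioms pre_linear) simp_all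
    show "ee ` L \<subseteq> {x \<in> carrier W. pre (a \<oplus>\<^bsub>A\<^esub> b) x \<ominus>\<^bsub>W\<^esub> pre a x \<ominus>\<^bsub>W\<^esub> pre b x \<in> K}"
    proof
      fix x assume "x \<in> ee ` L"
      then obtain v where v: "v \<in> L" "x = ee v" by (rule imageE)
      have "rel_add [] a b v \<in> K"
        using assms v(1) by (intro subsetD[OF rels_in_K] sh_relsI) simp_all
      thus "x \<in> {x \<in> carrier W. pre (a \<oplus>\<^bsub>A\<^esub> b) x \<ominus>\<^bsub>W\<^esub> pre a x \<ominus>\<^bsub>W\<^esub> pre b x \<in> K}"
        using v assms by (simp add: rel_add_W pre_basis)
    qed
  qed
  thus ?thesis using assms(3) by blast
qed

lemma rel_smult_Nil:
  assumes "r \<in> carrier R" "a \<in> carrier A" "x \<in> carrier W"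
  shows "pre (r \<odot>\<^bsub>A\<^esub> a) x \<ominus>\<^bsub>W\<^esub> r \<odot>\<^bsub>W\<^esub> pre a x \<in> K"
proof -
  have "carrier W \<subseteq> {x \<in> carrier W. pre (r \<odot>\<^bsub>A\<^esub> a) x \<ominus>\<^bsub>W\<^esub> r \<odot>\<^bsub>W\<^esub> pre a x \<in> K}"
  proof (rule spansD[OF spans_W submodule_preimage[OF W.module_axioms W.module_axioms _ K_submodule_W]])
    show "(\<lambda>x. pre (r \<odot>\<^bsub>A\<^esub> a) x \<ominus>\<^bsub>W\<^esub> r \<odot>\<^bsub>W\<^esub> pre a x) \<in> linear_maps R W W"
      using assms by (intro linear_maps_minus_fun linear_maps_smult W.module_axioms pre_linear) simp_all
    show "ee ` L \<subseteq> {x \<in> carrier W. pre (r \<odot>\<^bsub>A\<^esub> a) x \<ominus>\<^bsub>W\<^esub> r \<odot>\<^bsub>W\<^esub> pre a x \<in> K}"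
    proof
      fix x assume "x \<in> ee ` L"
      then obtain v where v: "v \<in> L" "x = ee v" by (rule imageE)
      have "rel_smult [] r a v \<in> K"
        using assms v(1) by (intro subsetD[OF rels_in_K] sh_relsI) simp_all
      thus "x \<in> {x \<in> carrier W. pre (r \<odot>\<^bsub>A\<^esub> a) x \<ominus>\<^bsub>W\<^esub> r \<odot>\<^bsub>W\<^esub> pre a x \<in> K}"
        using v assms by (simp add: rel_smult_W pre_basis)
    qed
  qed
  thus ?thesis using assms(3) by blast
qed

section \<open>Products of relations with words stay in the kernel\<close>

lemmas mul_minus2 = linear_maps_minus[OF W.module_axioms W.module_axioms bilinear_mapsD(2)[OF mul_bilinear]]

lemma mul_ee_Nil: "x \<in> carrier W \<Longrightarrow> mul x (ee []) = x"
  using mul_comm[of x "ee []"] mul_one[of x] by simp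

text \<open>The three terms of \<open>mul_pre\<close> are covered in turn by the hypothesis at
  \<open>c # v\<close>, the induction hypothesis and the hypothesis at \<open>v\<close>, since
  prefixing and \<open>E\<close> preserve \<open>K\<close>. This carries the ideal property past the
  letters in front of the altered one.\<close>

lemma mul_pre_K:
  assumes d: "d \<in> carrier A" and x: "x \<in> carrier W" and K: "\<And>v. v \<in> L \<Longrightarrow> mul x (ee v) \<in> K"
  shows "v \<in> L \<Longrightarrow> mul (pre d x) (ee v) \<in> K"
proof (induction v)
  case Nil
  show ?case using K[of "[]"] x d by (simp add: mul_ee_Nil pre_K)
next
  case (Cons c v)
  hence c: "c \<in> carrier A" "v \<in> L" by auto
  have "mul (pre d x) (ee (c # v)) = pre d (mul x (ee (c # v))) \<oplus>\<^bsub>W\<^esub> pre c (mul (pre d x) (ee v)) \<oplus>\<^bsub>W\<^esub>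
      pre (d \<otimes>\<^bsub>A\<^esub> c) (E (mul x (ee v)))"
    using mul_pre[OF d c(1) x ee_closed[OF c(2)]] by (simp add: pre_basis c)
  also have "\<dots> \<in> K"
    using Cons.IH[OF c(2)] K[OF c(2)] K[of "c # v"] c d by (intro K_add pre_K E_K) simp_all
  finally show ?case .
qed

text \<open>Multiplied by \<open>c # v\<close>, a first-letter relation splits into the same
  relation with a new tail, the letter \<open>c\<close> in front of its product with
  \<open>v\<close>, and a first-letter relation for the products of \<open>a\<close> and
  \<open>b\<close> with \<open>c\<close>. The last one rests on distributivity in
  \<open>A\<close>.\<close>

lemma mul_rel_add_Nil_K:
  assumes ab: "a \<in> carrier A" "b \<in> carrier A" and x: "x \<in> carrier W"
  shows "v \<in> L \<Longrightarrow> mul (pre (a \<oplus>\<^bsub>A\<^esub> b) x \<ominus>\<^bsub>W\<^esub> pre a x \<ominus>\<^bsub>W\<^esub> pre b x) (ee v) \<in> K"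
proof (induction v)
  case Nil
  show ?case using rel_add_Nil[OF ab x] ab x by (simp add: mul_ee_Nil)
next
  case (Cons c v)
  hence c: "c \<in> carrier A" "v \<in> L" by auto
  let ?y = "ee v"
  define X where "X = mul x (pre c ?y)"
  define Y where "Y = E (mul x ?y)"
  have XY: "X \<in> carrier W" "Y \<in> carrier W" using x c by (auto simp: X_def Y_def)
  let ?s = "pre (a \<oplus>\<^bsub>A\<^esub> b) x \<ominus>\<^bsub>W\<^esub> pre a x \<ominus>\<^bsub>W\<^esub> pre b x"
  have m: "mul ?s z = mul (pre (a \<oplus>\<^bsub>A\<^esub> b) x) z \<ominus>\<^bsub>W\<^esub> mul (pre a x) z \<ominus>\<^bsub>W\<^esub> mul (pre b x) z"
    if "z \<in> carrier W" for z using that ab x by (simp add: mul_minus2)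
  have "mul ?s (ee (c # v)) = (pre (a \<oplus>\<^bsub>A\<^esub> b) X \<ominus>\<^bsub>W\<^esub> pre a X \<ominus>\<^bsub>W\<^esub> pre b X) \<oplus>\<^bsub>W\<^esub> pre c (mul ?s ?y) \<oplus>\<^bsub>W\<^esub>
      (pre (a \<otimes>\<^bsub>A\<^esub> c \<oplus>\<^bsub>A\<^esub> b \<otimes>\<^bsub>A\<^esub> c) Y \<ominus>\<^bsub>W\<^esub> pre (a \<otimes>\<^bsub>A\<^esub> c) Y \<ominus>\<^bsub>W\<^esub> pre (b \<otimes>\<^bsub>A\<^esub> c) Y)"
  proof -
    have "mul ?s (ee (c # v)) = mul ?s (pre c ?y)" using c by (simp add: pre_basis)
    also have "\<dots> = mul (pre (a \<oplus>\<^bsub>A\<^esub> b) x) (pre c ?y) \<ominus>\<^bsub>W\<^esub> mul (pre a x) (pre c ?y) \<ominus>\<^bsub>W\<^esub> mul (pre b x) (pre c ?y)"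
      using c by (intro m) simp
    also have "\<dots> = (pre (a \<oplus>\<^bsub>A\<^esub> b) X \<ominus>\<^bsub>W\<^esub> pre a X \<ominus>\<^bsub>W\<^esub> pre b X) \<oplus>\<^bsub>W\<^esub> pre c (mul ?s ?y) \<oplus>\<^bsub>W\<^esub>
      (pre (a \<otimes>\<^bsub>A\<^esub> c \<oplus>\<^bsub>A\<^esub> b \<otimes>\<^bsub>A\<^esub> c) Y \<ominus>\<^bsub>W\<^esub> pre (a \<otimes>\<^bsub>A\<^esub> c) Y \<ominus>\<^bsub>W\<^esub> pre (b \<otimes>\<^bsub>A\<^esub> c) Y)"
      using XY ab c x m[OF ee_closed[OF c(2)]]
      by (simp add: mul_pre X_def[symmetric] Y_def[symmetric] A.l_distr W.M.minus_eq W.M.minus_add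
          pre_add W.M.a_ac linear_maps_a_inv[OF W.module_axioms W.module_axioms pre_linear])
    finally show ?thesis .
  qed
  also have "\<dots> \<in> K"
    using Cons.IH[OF c(2)] XY ab c by (intro K_add rel_add_Nil pre_K) simp_all
  finally show ?case .
qed

lemma mul_rel_smult_Nil_K:
  assumes ra: "r \<in> carrier R" "a \<in> carrier A" and x: "x \<in> carrier W"
  shows "v \<in> L \<Longrightarrow> mul (pre (r \<odot>\<^bsub>A\<^esub> a) x \<ominus>\<^bsub>W\<^esub> r \<odot>\<^bsub>W\<^esub> pre a x) (ee v) \<in> K"
proof (induction v)
  case Nil
  show ?case using rel_smult_Nil[OF ra x] ra x by (simp add: mul_ee_Nil)
next
  case (Cons c v)
  hence c: "c \<in> carrier A" "v \<in> L" by auto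
  let ?y = "ee v"
  define X where "X = mul x (pre c ?y)"
  define Y where "Y = E (mul x ?y)"
  have XY: "X \<in> carrier W" "Y \<in> carrier W" using x c by (auto simp: X_def Y_def)
  let ?s = "pre (r \<odot>\<^bsub>A\<^esub> a) x \<ominus>\<^bsub>W\<^esub> r \<odot>\<^bsub>W\<^esub> pre a x"
  have m: "mul ?s z = mul (pre (r \<odot>\<^bsub>A\<^esub> a) x) z \<ominus>\<^bsub>W\<^esub> r \<odot>\<^bsub>W\<^esub> mul (pre a x) z"
    if "z \<in> carrier W" for z using that ra x by (simp add: mul_minus2 mul_lin2)
  have "mul ?s (ee (c # v)) = (pre (r \<odot>\<^bsub>A\<^esub> a) X \<ominus>\<^bsub>W\<^esub> r \<odot>\<^bsub>W\<^esub> pre a X) \<oplus>\<^bsub>W\<^esub> pre c (mul ?s ?y) \<oplus>\<^bsub>W\<^esub>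
      (pre (r \<odot>\<^bsub>A\<^esub> (a \<otimes>\<^bsub>A\<^esub> c)) Y \<ominus>\<^bsub>W\<^esub> r \<odot>\<^bsub>W\<^esub> pre (a \<otimes>\<^bsub>A\<^esub> c) Y)"
  proof -
    have "mul ?s (ee (c # v)) = mul ?s (pre c ?y)" using c by (simp add: pre_basis)
    also have "\<dots> = mul (pre (r \<odot>\<^bsub>A\<^esub> a) x) (pre c ?y) \<ominus>\<^bsub>W\<^esub> r \<odot>\<^bsub>W\<^esub> mul (pre a x) (pre c ?y)"
      using c by (intro m) simp
    also have "\<dots> = (pre (r \<odot>\<^bsub>A\<^esub> a) X \<ominus>\<^bsub>W\<^esub> r \<odot>\<^bsub>W\<^esub> pre a X) \<oplus>\<^bsub>W\<^esub> pre c (mul ?s ?y) \<oplus>\<^bsub>W\<^esub>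
      (pre (r \<odot>\<^bsub>A\<^esub> (a \<otimes>\<^bsub>A\<^esub> c)) Y \<ominus>\<^bsub>W\<^esub> r \<odot>\<^bsub>W\<^esub> pre (a \<otimes>\<^bsub>A\<^esub> c) Y)"
      using XY ra c x m[OF ee_closed[OF c(2)]]
      by (simp add: mul_pre X_def[symmetric] Y_def[symmetric] A.smult_assoc2 W.M.minus_eq W.M.minus_add
          pre_add pre_smult W.smult_r_distr W.M.a_ac
          linear_maps_a_inv[OF W.module_axioms W.module_axioms pre_linear])
    finally show ?thesis .
  qed
  also have "\<dots> \<in> K"
    using Cons.IH[OF c(2)] XY ra c by (intro K_add rel_smult_Nil pre_K) simp_all
  finally show ?case .
qed

lemma rel_add_Nil_eq:
  "\<lbrakk>a \<in> carrier A; b \<in> carrier A; v \<in> L\<rbrakk> \<Longrightarrow>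
    rel_add [] a b v = pre (a \<oplus>\<^bsub>A\<^esub> b) (ee v) \<ominus>\<^bsub>W\<^esub> pre a (ee v) \<ominus>\<^bsub>W\<^esub> pre b (ee v)"
  by (simp add: rel_add_W pre_basis)

lemma rel_smult_Nil_eq:
  "\<lbrakk>r \<in> carrier R; a \<in> carrier A; v \<in> L\<rbrakk> \<Longrightarrow>
    rel_smult [] r a v = pre (r \<odot>\<^bsub>A\<^esub> a) (ee v) \<ominus>\<^bsub>W\<^esub> r \<odot>\<^bsub>W\<^esub> pre a (ee v)"
  by (simp add: rel_smult_W pre_basis)

lemma rel_closed_W:
  "\<lbrakk>u \<in> L; a \<in> carrier A; b \<in> carrier A; v \<in> L\<rbrakk> \<Longrightarrow> rel_add u a b v \<in> carrier W"
  "\<lbrakk>u \<in> L; r \<in> carrier R; a \<in> carrier A; v \<in> L\<rbrakk> \<Longrightarrow> rel_smult u r a v \<in> carrier W"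
  by (intro F_closed_W subsetD[OF sh_rels_closed] sh_relsI; assumption)+

lemma mul_rel_K:
  "\<lbrakk>u \<in> L; a \<in> carrier A; b \<in> carrier A; v \<in> L; w \<in> L\<rbrakk> \<Longrightarrow> mul (rel_add u a b v) (ee w) \<in> K"
  "\<lbrakk>u \<in> L; r \<in> carrier R; a \<in> carrier A; v \<in> L; w \<in> L\<rbrakk> \<Longrightarrow> mul (rel_smult u r a v) (ee w) \<in> K"
proof (induction u arbitrary: w)
  case Nil
  { case 1 thus ?case by (simp add: rel_add_Nil_eq mul_rel_add_Nil_K) }
  { case 2 thus ?case by (simp add: rel_smult_Nil_eq mul_rel_smult_Nil_K) }
next
  case (Cons d u)
  { case 1
    thus ?case using Cons.IH(1) by (simp add: rel_add_Cons mul_pre_K rel_closed_W) }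
  { case 2
    thus ?case using Cons.IH(2) by (simp add: rel_smult_Cons mul_pre_K rel_closed_W) }
qed

end

context td_words
begin

section \<open>The multiplication of \<open>Sh(A)\<close> on formal words\<close>

lemma shmul_closed: "\<lbrakk>u \<in> SW; v \<in> SW\<rbrakk> \<Longrightarrow> pre (hd u \<otimes>\<^bsub>A\<^esub> hd v) (td (tl u) (tl v)) \<in> carrier F"
  by (elim sh_words_cases) (simp add: preF_closed td_closed)

lemma shmul_bilinear: "shmul \<in> bilinear_maps R F F F"
  unfolding shmul_def by (rule bilin_ext_bilinear[OF F.module_axioms shmul_closed])

lemma shmul_basis: "\<lbrakk>a \<in> carrier A; b \<in> carrier A; u \<in> L; v \<in> L\<rbrakk> \<Longrightarrow>
    shmul (ee (a # u)) (ee (b # v)) = pre (a \<otimes>\<^bsub>A\<^esub> b) (td u v)"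
proof -
  assume *: "a \<in> carrier A" "b \<in> carrier A" "u \<in> L" "v \<in> L"
  let ?\<phi> = "\<lambda>u v. pre (hd u \<otimes>\<^bsub>A\<^esub> hd v) (td (tl u) (tl v))"
  have 1: "?\<phi> (a # u) (b # v) \<in> carrier F" using * by (intro shmul_closed) (simp_all add: sh_words_iff)
  hence 2: "lin_ext R F (?\<phi> (a # u)) (ee (b # v)) = ?\<phi> (a # u) (b # v)"
    by (rule lin_ext_basis[OF F.module_axioms])
  have "shmul (ee (a # u)) (ee (b # v)) = lin_ext R F (?\<phi> (a # u)) (ee (b # v))"
    unfolding shmul_def bilin_ext_def
    by (rule lin_ext_basis[OF F.module_axioms]) (use 1 2 in simp)
  thus ?thesis using 2 by simp
qed

lemma shmul_pre:
  assumes "a \<in> carrier A" "b \<in> carrier A" "x \<in> carrier W" "y \<in> carrier W"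
  shows "shmul (pre a x) (pre b y) = pre (a \<otimes>\<^bsub>A\<^esub> b) (mul x y)"
  by (rule bilinear_maps_eqI[OF W.module_axioms W.module_axioms F.module_axioms spans_W spans_W
      bilinear_maps_comp[OF shmul_bilinear pre_linear_F[OF assms(1)] pre_linear_F[OF assms(2)] linear_maps_id]
      bilinear_maps_comp[OF mul_bilinear linear_maps_id linear_maps_id
        pre_linear_F[OF A.m_closed[OF assms(1,2)]]] _ assms(3,4)])
    (elim imageE; simp add: assms pre_basis shmul_basis mul_basis)

text \<open>If the altered letter is the first one, linearity of the product of \<open>A\<close>
  gives a first-letter relation again. If it comes later, the relation sits in the tail, where
  \<open>mul_rel_K\<close> applies, behind a common first letter.\<close>

lemma shmul_ideal:
  assumes s: "s \<in> sh_rels R A" and w: "w \<in> SW"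
  shows "shmul s (ee w) \<in> K"
proof -
  obtain c y where c: "c \<in> carrier A" "y \<in> L" "w = c # y" using w by (rule sh_words_cases)
  have ew: "ee (c # y) = pre c (ee y)" using c by (simp add: pre_basis)
  have cons: "shmul (pre d t) (ee (c # y)) \<in> K"
    if "d \<in> carrier A" "t \<in> carrier W" "mul t (ee y) \<in> K" for d t
    unfolding ew using that c by (simp add: shmul_pre pre_K)
  note lin = bilinear_mapsD(2)[OF shmul_bilinear eeF_closed[OF w[unfolded c(3)]]]
  note mins = linear_maps_minus[OF F.module_axioms F.module_axioms lin]
  from s show ?thesis
  proof (cases rule: sh_rels_cases)
    case (add u a b v)
    show ?thesis
    proof (cases u)
      case Nil
      have "shmul s (ee w) = pre ((a \<oplus>\<^bsub>A\<^esub> b) \<otimes>\<^bsub>A\<^esub> c) (mul (ee v) (ee y)) \<ominus>\<^bsub>W\<^esub>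
          pre (a \<otimes>\<^bsub>A\<^esub> c) (mul (ee v) (ee y)) \<ominus>\<^bsub>W\<^esub> pre (b \<otimes>\<^bsub>A\<^esub> c) (mul (ee v) (ee y))"
        using add Nil c
        by (simp add: rel_add_def mins eeF_closed sh_words_iff F_minus_W[symmetric]
            preF_closed shmul_basis mul_basis td_closed)
      thus ?thesis using add c by (simp add: A.l_distr rel_add_Nil)
    next
      case (Cons d u')
      thus ?thesis using add c by (simp add: rel_add_Cons cons rel_closed_W mul_rel_K)
    qed
  next
    case (smult u r a v)
    show ?thesis
    proof (cases u)
      case Nil
      have "shmul s (ee w) = pre ((r \<odot>\<^bsub>A\<^esub> a) \<otimes>\<^bsub>A\<^esub> c) (mul (ee v) (ee y)) \<ominus>\<^bsub>W\<^esub>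
          r \<odot>\<^bsub>W\<^esub> pre (a \<otimes>\<^bsub>A\<^esub> c) (mul (ee v) (ee y))"
        using smult Nil c
        by (simp add: rel_smult_def mins linear_mapsD(3)[OF lin] eeF_closed sh_words_iff
            F_minus_W[symmetric] F_smult_W[symmetric] preF_closed shmul_basis mul_basis td_closed)
      thus ?thesis using smult c by (simp add: A.smult_assoc2 rel_smult_Nil)
    next
      case (Cons d u')
      thus ?thesis using smult c by (simp add: rel_smult_Cons cons rel_closed_W mul_rel_K)
    qed
  qed
qed

lemma shmul_comm: "\<lbrakk>x \<in> carrier F; y \<in> carrier F\<rbrakk> \<Longrightarrow> shmul x y = shmul y x"
proof (rule bilinear_maps_eqI[OF F.module_axioms F.module_axioms F.module_axioms
      spans_free_module[OF A.R.cring_axioms] spans_free_module[OF A.R.cring_axioms]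
      shmul_bilinear bilinear_maps_flip[OF shmul_bilinear]])
  fix s t assume "s \<in> ee ` SW" "t \<in> ee ` SW"
  thus "shmul s t = shmul t s"
    by (elim imageE sh_words_cases) (simp add: shmul_basis td_comm A.m_comm)
qed

lemma shmul_ideal2:
  assumes "s \<in> sh_rels R A" "w \<in> SW"
  shows "shmul (ee w) s \<in> K"
  using shmul_ideal[OF assms] shmul_comm[of s "ee w"] assms sh_rels_closed eeF_closed by auto

section \<open>The quotient algebra\<close>

lemma S_mult_bilinear: "mult S \<in> bilinear_maps R S S S"
  unfolding Sh_eq_fp_module
  by (rule fp_mult_bilinear[OF A.R.cring_axioms sh_rels_closed shmul_closed shmul_def
      shmul_ideal[unfolded sh_kernel_def] shmul_ideal2[unfolded sh_kernel_def]])

lemma S_mult_cl: "\<lbrakk>x \<in> carrier F; y \<in> carrier F\<rbrakk> \<Longrightarrow> cl x \<otimes>\<^bsub>S\<^esub> cl y = cl (shmul x y)"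
  unfolding Sh_eq_fp_module cl_def
  by (rule fp_mult_class[OF A.R.cring_axioms sh_rels_closed shmul_closed shmul_def
      shmul_ideal[unfolded sh_kernel_def] shmul_ideal2[unfolded sh_kernel_def]])

text \<open>The image of \<open>a \<otimes> x\<close> under the identification of
  \<open>Sh(A)\<close> with \<open>A \<otimes> Sh^+(A)\<close>, with \<open>x\<close> still a formal
  combination. Laws for \<open>Sh(A)\<close> thus become laws of \<open>A\<close> in the first
  letter and of \<open>mul\<close> in the tail.\<close>

definition q where "q a x = cl (pre a x)"

lemma q_linear: "a \<in> carrier A \<Longrightarrow> q a \<in> linear_maps R W S"
  unfolding q_def[abs_def] by (rule linear_maps_comp[OF pre_linear_F cl_linear])

lemma q_closed [simp]: "\<lbrakk>a \<in> carrier A; x \<in> carrier W\<rbrakk> \<Longrightarrow> q a x \<in> carrier S"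
  by (rule linear_mapsD(1)[OF q_linear])

lemma q_basis: "\<lbrakk>a \<in> carrier A; u \<in> L\<rbrakk> \<Longrightarrow> q a (ee u) = sh_pure R A (a # u)"
  by (simp add: q_def pre_basis sh_pure_eq_cl)

lemma cl_K_eqI:
  assumes "x \<in> carrier F" "y \<in> carrier F" "x \<ominus>\<^bsub>W\<^esub> y \<in> K"
  shows "cl x = cl y"
  unfolding cl_def
  by (rule fp_class_eqI[OF A.R.cring_axioms sh_rels_closed assms(1,2)])
    (use assms in \<open>simp add: F_minus_W sh_kernel_def\<close>)

text \<open>This is where the first-letter relations with arbitrary tails,
  \<open>rel_add_Nil\<close> and \<open>rel_smult_Nil\<close>, are used in the quotient.\<close>

lemma q_linear2:
  assumes x: "x \<in> carrier W"
  shows "(\<lambda>a. q a x) \<in> linear_maps R A S"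
proof (rule linear_mapsI)
  fix a b assume ab: "a \<in> carrier A" "b \<in> carrier A"
  have "pre (a \<oplus>\<^bsub>A\<^esub> b) x \<ominus>\<^bsub>W\<^esub> (pre a x \<oplus>\<^bsub>W\<^esub> pre b x) \<in> K"
    using rel_add_Nil[OF ab x] ab x by (simp add: W.M.minus_eq W.M.minus_add W.M.a_assoc)
  moreover have "pre a x \<oplus>\<^bsub>F\<^esub> pre b x \<in> carrier F" using ab x by (simp add: preF_closed)
  ultimately have "cl (pre (a \<oplus>\<^bsub>A\<^esub> b) x) = cl (pre a x \<oplus>\<^bsub>F\<^esub> pre b x)"
    using ab x F_add_W[OF preF_closed[OF ab(1) x] preF_closed[OF ab(2) x]]
    by (intro cl_K_eqI) (simp_all add: preF_closed)
  also have "\<dots> = cl (pre a x) \<oplus>\<^bsub>S\<^esub> cl (pre b x)"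
    using ab x by (intro linear_mapsD(2)[OF cl_linear]) (simp_all add: preF_closed)
  finally show "q (a \<oplus>\<^bsub>A\<^esub> b) x = q a x \<oplus>\<^bsub>S\<^esub> q b x" by (simp add: q_def)
next
  fix r a assume ra: "r \<in> carrier R" "a \<in> carrier A"
  have "r \<odot>\<^bsub>F\<^esub> pre a x \<in> carrier F" using ra x by (simp add: preF_closed)
  hence "cl (pre (r \<odot>\<^bsub>A\<^esub> a) x) = cl (r \<odot>\<^bsub>F\<^esub> pre a x)"
    using ra x rel_smult_Nil[OF ra x] F_smult_W[OF ra(1) preF_closed[OF ra(2) x]]
    by (intro cl_K_eqI) (simp_all add: preF_closed)
  also have "\<dots> = r \<odot>\<^bsub>S\<^esub> cl (pre a x)"
    using ra x by (intro linear_mapsD(3)[OF cl_linear]) (simp_all add: preF_closed)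
  finally show "q (r \<odot>\<^bsub>A\<^esub> a) x = r \<odot>\<^bsub>S\<^esub> q a x" by (simp add: q_def)
qed (simp add: x)

lemma q_mult:
  "\<lbrakk>a \<in> carrier A; b \<in> carrier A; x \<in> carrier W; y \<in> carrier W\<rbrakk> \<Longrightarrow>
    q a x \<otimes>\<^bsub>S\<^esub> q b y = q (a \<otimes>\<^bsub>A\<^esub> b) (mul x y)"
  by (simp add: q_def S_mult_cl preF_closed shmul_pre)

lemma sh_pure_image_cases:
  assumes "x \<in> sh_pure R A ` SW"
  obtains a u where "a \<in> carrier A" "u \<in> L" "x = q a (ee u)"
  using assms by (elim imageE sh_words_cases) (simp add: q_basis)

lemma S_one: "\<one>\<^bsub>S\<^esub> = q \<one>\<^bsub>A\<^esub> (ee [])"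
  by (simp add: Sh_eq_fp_module fp_module_one[OF A.R.cring_axioms sh_rels_closed] q_def pre_basis cl_def)

lemma S_algebra: "algebra R S"
proof (rule algebraI_spans[OF S_module S_mult_bilinear spans_S])
  show "\<one>\<^bsub>S\<^esub> \<in> carrier S" by (simp add: S_one)
next
  fix x y z assume "x \<in> sh_pure R A ` SW" "y \<in> sh_pure R A ` SW" "z \<in> sh_pure R A ` SW"
  thus "x \<otimes>\<^bsub>S\<^esub> y \<otimes>\<^bsub>S\<^esub> z = x \<otimes>\<^bsub>S\<^esub> (y \<otimes>\<^bsub>S\<^esub> z)"
    by (elim sh_pure_image_cases) (simp add: q_mult mul_assoc A.m_assoc)
next
  fix x y assume "x \<in> sh_pure R A ` SW" "y \<in> sh_pure R A ` SW"
  thus "x \<otimes>\<^bsub>S\<^esub> y = y \<otimes>\<^bsub>S\<^esub> x"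
    by (elim sh_pure_image_cases) (simp add: q_mult mul_comm A.m_comm)
next
  fix x assume "x \<in> sh_pure R A ` SW"
  thus "\<one>\<^bsub>S\<^esub> \<otimes>\<^bsub>S\<^esub> x = x"
    by (elim sh_pure_image_cases) (simp add: q_mult S_one mul_one)
qed

sublocale S: algebra R S by (rule S_algebra)

section \<open>Maps out of \<open>Sh(A)\<close>, and the operator \<open>P\<close>\<close>

lemma
  assumes N: "module R N" and \<phi>: "\<And>w. w \<in> SW \<Longrightarrow> \<phi> w \<in> carrier N"
    and add: "\<And>u a b v. \<lbrakk>u \<in> L; a \<in> carrier A; b \<in> carrier A; v \<in> L\<rbrakk> \<Longrightarrow>
      \<phi> (u @ (a \<oplus>\<^bsub>A\<^esub> b) # v) = \<phi> (u @ a # v) \<oplus>\<^bsub>N\<^esub> \<phi> (u @ b # v)"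
    and smult: "\<And>u r a v. \<lbrakk>u \<in> L; r \<in> carrier R; a \<in> carrier A; v \<in> L\<rbrakk> \<Longrightarrow>
      \<phi> (u @ (r \<odot>\<^bsub>A\<^esub> a) # v) = r \<odot>\<^bsub>N\<^esub> \<phi> (u @ a # v)"
  shows sh_lift_linear: "quot_lift R N \<phi> \<in> linear_maps R S N"
    and sh_lift_pure: "w \<in> SW \<Longrightarrow> quot_lift R N \<phi> (sh_pure R A w) = \<phi> w"
proof -
  interpret N: module R N by (rule N)
  \<comment> \<open>Linearity of \<open>\<phi>\<close> in each letter of a word is precisely the
    vanishing of its extension on the two kinds of relations.\<close>
  have rel: "lin_ext R N \<phi> s = \<zero>\<^bsub>N\<^esub>" if "s \<in> sh_rels R A" for s
    using that
  proof (cases rule: sh_rels_cases)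
    case (add u a b v)
    show ?thesis unfolding add(5) rel_add_def
      by (subst lin_ext_basis_rel(1)[OF N \<phi>])
        (simp_all add: add(1-4) insert_letter_word assms(3) \<phi> N.M.minus_minus_zero)
  next
    case (smult u r a v)
    show ?thesis unfolding smult(5) rel_smult_def
      by (subst lin_ext_basis_rel(2)[OF N \<phi>])
        (simp_all add: smult(1-4) insert_letter_word assms(4) \<phi> N.M.minus_zero_iff)
  qed
  show "quot_lift R N \<phi> \<in> linear_maps R S N"
    unfolding Sh_eq_fp_module
    by (rule fp_lift_linear[OF A.R.cring_axioms sh_rels_closed N \<phi> rel])
  show "w \<in> SW \<Longrightarrow> quot_lift R N \<phi> (sh_pure R A w) = \<phi> w"
    unfolding sh_pure_eq_cl cl_def
    by (rule fp_lift_basis[OF A.R.cring_axioms sh_rels_closed N \<phi> rel])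
qed

lemma sh_pure_closed: "w \<in> SW \<Longrightarrow> sh_pure R A w \<in> carrier S"
  using spans_closed[OF spans_S] by blast

lemma sh_pure_multilinear:
  assumes "u \<in> L" "v \<in> L" "a \<in> carrier A"
  shows "b \<in> carrier A \<Longrightarrow> sh_pure R A (u @ (a \<oplus>\<^bsub>A\<^esub> b) # v) =
      sh_pure R A (u @ a # v) \<oplus>\<^bsub>S\<^esub> sh_pure R A (u @ b # v)"
    and "r \<in> carrier R \<Longrightarrow> sh_pure R A (u @ (r \<odot>\<^bsub>A\<^esub> a) # v) = r \<odot>\<^bsub>S\<^esub> sh_pure R A (u @ a # v)"
proof -
  assume "b \<in> carrier A"
  thus "sh_pure R A (u @ (a \<oplus>\<^bsub>A\<^esub> b) # v) = sh_pure R A (u @ a # v) \<oplus>\<^bsub>S\<^esub> sh_pure R A (u @ b # v)"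
    unfolding sh_pure_eq_cl Sh_eq_fp_module cl_def
    using assms
    by (intro fp_class_basis_add[OF A.R.cring_axioms sh_rels_closed] insert_letter_word
        rel_add_in_sh_rels[unfolded rel_add_def]) simp_all
next
  assume "r \<in> carrier R"
  thus "sh_pure R A (u @ (r \<odot>\<^bsub>A\<^esub> a) # v) = r \<odot>\<^bsub>S\<^esub> sh_pure R A (u @ a # v)"
    unfolding sh_pure_eq_cl Sh_eq_fp_module cl_def
    using assms
    by (intro fp_class_basis_smult[OF A.R.cring_axioms sh_rels_closed] insert_letter_word
        rel_smult_in_sh_rels[unfolded rel_smult_def]) simp_all
qed

abbreviation "P \<equiv> sh_operator R A l"

lemma P_linear: "P \<in> linear_maps R S S"
  and P_pure: "w \<in> SW \<Longrightarrow> P (sh_pure R A w) = sh_pure R A (\<one>\<^bsub>A\<^esub> # w)"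
proof -
  let ?\<phi> = "\<lambda>w. sh_pure R A (\<one>\<^bsub>A\<^esub> # w)"
  have 1: "?\<phi> w \<in> carrier S" if "w \<in> SW" for w
    by (rule sh_pure_closed) (use that in \<open>simp add: sh_words_iff\<close>)
  have 2: "?\<phi> (u @ (a \<oplus>\<^bsub>A\<^esub> b) # v) = ?\<phi> (u @ a # v) \<oplus>\<^bsub>S\<^esub> ?\<phi> (u @ b # v)"
    if "u \<in> L" "a \<in> carrier A" "b \<in> carrier A" "v \<in> L" for u a b v
    using sh_pure_multilinear(1)[of "\<one>\<^bsub>A\<^esub> # u" v a b] that by simp
  have 3: "?\<phi> (u @ (r \<odot>\<^bsub>A\<^esub> a) # v) = r \<odot>\<^bsub>S\<^esub> ?\<phi> (u @ a # v)"
    if "u \<in> L" "r \<in> carrier R" "a \<in> carrier A" "v \<in> L" for u r a v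
    using sh_pure_multilinear(2)[of "\<one>\<^bsub>A\<^esub> # u" v a r] that by simp
  show "P \<in> linear_maps R S S"
    unfolding sh_operator_def by (rule sh_lift_linear[where \<phi> = ?\<phi>, OF S_module 1 2 3])
  show "P (sh_pure R A w) = ?\<phi> w" if "w \<in> SW"
    unfolding sh_operator_def by (rule sh_lift_pure[where \<phi> = ?\<phi>, OF S_module 1 2 3 that])
qed

lemma P_closed [simp]: "x \<in> carrier S \<Longrightarrow> P x \<in> carrier S"
  by (rule linear_mapsD(1)[OF P_linear])

lemma P_q:
  assumes "a \<in> carrier A" "x \<in> carrier W"
  shows "P (q a x) = q \<one>\<^bsub>A\<^esub> (pre a x)"
  by (rule W_eqI[OF S_module linear_maps_comp[OF q_linear P_linear]
        linear_maps_comp[OF pre_linear q_linear] _ assms(2)])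
    (use assms in \<open>simp_all add: q_basis P_pure sh_words_iff pre_basis\<close>)

section \<open>Letters, and generation of \<open>Sh(A)\<close> by letters and
  \<open>P\<close>\<close>

abbreviation "\<iota> a \<equiv> sh_pure R A [a]"

lemma \<iota>_eq_q: "a \<in> carrier A \<Longrightarrow> \<iota> a = q a (ee [])"
  by (simp add: q_basis)

text \<open>A letter has the empty word as its tail, and the empty word is the unit of
  \<open>mul\<close>.\<close>

lemma \<iota>_hom: "(\<lambda>a. \<iota> a) \<in> algebra_homs R A S"
proof -
  have lin: "(\<lambda>a. \<iota> a) \<in> linear_maps R A S"
    by (rule linear_maps_cong[OF A.module q_linear2[OF ee_closed]]) (simp_all add: \<iota>_eq_q)
  thus ?thesis
    by (auto simp: algebra_homs_def \<iota>_eq_q S_one q_mult mul_one intro!: ring_hom_memI linear_mapsD(2)[OF lin])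
qed

lemma \<iota>_closed [simp]: "a \<in> carrier A \<Longrightarrow> \<iota> a \<in> carrier S"
  by (simp add: \<iota>_eq_q)

text \<open>The first factor has an empty tail and the second has first letter
  \<open>\<one>\<close>, so each contributes only one of the two components of the product.\<close>

lemma sh_pure_Cons: "\<lbrakk>a \<in> carrier A; w \<in> SW\<rbrakk> \<Longrightarrow> sh_pure R A (a # w) = \<iota> a \<otimes>\<^bsub>S\<^esub> P (sh_pure R A w)"
  by (elim sh_words_cases)
    (simp add: q_basis[symmetric] \<iota>_eq_q P_q q_mult mul_one pre_basis)

lemma S_induct [consumes 1, case_names letter Cons add smult zero]:
  assumes "x \<in> carrier S"
    and "\<And>a. a \<in> carrier A \<Longrightarrow> Q (\<iota> a)"
    and "\<And>a w. \<lbrakk>a \<in> carrier A; w \<in> SW; Q (sh_pure R A w)\<rbrakk> \<Longrightarrow> Q (\<iota> a \<otimes>\<^bsub>S\<^esub> P (sh_pure R A w))"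
    and "\<And>x y. \<lbrakk>x \<in> carrier S; y \<in> carrier S; Q x; Q y\<rbrakk> \<Longrightarrow> Q (x \<oplus>\<^bsub>S\<^esub> y)"
    and "\<And>r x. \<lbrakk>r \<in> carrier R; x \<in> carrier S; Q x\<rbrakk> \<Longrightarrow> Q (r \<odot>\<^bsub>S\<^esub> x)"
    and "Q \<zero>\<^bsub>S\<^esub>"
  shows "Q x"
  using S_module spans_S assms(1)
proof (induction x rule: spans_induct)
  case (base s)
  then obtain w where w: "w \<in> SW" "s = sh_pure R A w" by blast
  have "w \<in> SW \<Longrightarrow> Q (sh_pure R A w)" for w
  proof (induction w)
    case (Cons a w)
    show ?case
    proof (cases "w = []")
      case True
      thus ?thesis using Cons.prems assms(2) by (simp add: sh_words_iff)
    next
      case False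
      hence "a \<in> carrier A" "w \<in> SW" using Cons.prems by (auto simp: sh_words_iff)
      thus ?thesis using Cons.IH assms(3) by (simp add: sh_pure_Cons)
    qed
  qed (simp add: sh_words_iff)
  thus ?case using w by simp
qed (use assms(4-6) in auto)

section \<open>The element \<open>\<kappa>\<close> and the TD identity\<close>

definition \<kappa> where "\<kappa> = P \<one>\<^bsub>S\<^esub> \<ominus>\<^bsub>S\<^esub> l \<odot>\<^bsub>S\<^esub> \<one>\<^bsub>S\<^esub>"

lemma \<kappa>_closed [simp]: "\<kappa> \<in> carrier S"
  by (simp add: \<kappa>_def l_closed)

text \<open>\<open>\<kappa>\<close> is \<open>- q \<one> (E (ee []))\<close>. Multiplying by it
  therefore leaves the first letter alone and applies \<open>- E\<close> to the tail; in this way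
  \<open>E\<close> survives in the quotient.\<close>

lemma \<kappa>_mult_q:
  assumes "a \<in> carrier A" "x \<in> carrier W"
  shows "\<kappa> \<otimes>\<^bsub>S\<^esub> q a x = \<ominus>\<^bsub>S\<^esub> q a (E x)"
proof -
  note ql = linear_maps_a_inv[OF W.module_axioms S_module q_linear]
    linear_maps_minus[OF W.module_axioms S_module q_linear] linear_mapsD(3)[OF q_linear]
  have "\<kappa> = q \<one>\<^bsub>A\<^esub> (ee [\<one>\<^bsub>A\<^esub>] \<ominus>\<^bsub>W\<^esub> l \<odot>\<^bsub>W\<^esub> ee [])"
    by (simp add: \<kappa>_def S_one P_q pre_basis ql l_closed)
  also have "ee [\<one>\<^bsub>A\<^esub>] \<ominus>\<^bsub>W\<^esub> l \<odot>\<^bsub>W\<^esub> ee [] = \<ominus>\<^bsub>W\<^esub> E (ee [])"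
    by (simp add: E_basis W.M.minus_eq W.M.minus_add W.M.a_comm l_closed)
  finally have "\<kappa> = \<ominus>\<^bsub>S\<^esub> q \<one>\<^bsub>A\<^esub> (E (ee []))" by (simp add: ql)
  thus ?thesis using assms by (simp add: S.l_minus q_mult E_mul mul_one)
qed

text \<open>The tail of \<open>P x\<close> involves nonempty words only. There \<open>- E\<close>
  inserts a unit letter behind the leading unit letter, which has the same effect as a second
  application of \<open>P\<close>.\<close>

lemma P_mult_\<kappa>: "x \<in> carrier S \<Longrightarrow> \<kappa> \<otimes>\<^bsub>S\<^esub> P x = P (P x)"
proof (rule linear_maps_eqI[OF S_module S_module spans_S
      linear_maps_comp[OF P_linear bilinear_mapsD(1)[OF S_mult_bilinear \<kappa>_closed]]
      linear_maps_comp[OF P_linear P_linear]])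
  fix s assume "s \<in> sh_pure R A ` SW"
  thus "\<kappa> \<otimes>\<^bsub>S\<^esub> P s = P (P s)"
    by (elim sh_pure_image_cases)
      (simp add: P_q \<kappa>_mult_q E_pre linear_maps_a_inv[OF W.module_axioms S_module q_linear])
qed

text \<open>The \<open>l\<close>-TD identity \<open>P(x)P(y) = P(xP(y) + P(x)y + l xy - xP(1)y)\<close>; its last two terms are
  \<open>- \<kappa>xy\<close>.\<close>

lemma P_mult_P:
  assumes "x \<in> carrier S" "y \<in> carrier S"
  shows "P x \<otimes>\<^bsub>S\<^esub> P y = P (x \<otimes>\<^bsub>S\<^esub> P y \<oplus>\<^bsub>S\<^esub> P x \<otimes>\<^bsub>S\<^esub> y \<ominus>\<^bsub>S\<^esub> \<kappa> \<otimes>\<^bsub>S\<^esub> (x \<otimes>\<^bsub>S\<^esub> y))"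
proof (rule bilinear_maps_eqI[OF S_module S_module S_module spans_S spans_S _ _ _ assms])
  note id = linear_maps_id and b = S_mult_bilinear
  show "(\<lambda>x y. P x \<otimes>\<^bsub>S\<^esub> P y) \<in> bilinear_maps R S S S"
    by (rule bilinear_maps_comp[OF b P_linear P_linear id])
  have "(\<lambda>x y. x \<otimes>\<^bsub>S\<^esub> P y \<oplus>\<^bsub>S\<^esub> P x \<otimes>\<^bsub>S\<^esub> y \<oplus>\<^bsub>S\<^esub> (\<ominus>\<^bsub>S\<^esub> (\<kappa> \<otimes>\<^bsub>S\<^esub> (x \<otimes>\<^bsub>S\<^esub> y)))) \<in> bilinear_maps R S S S"
    by (intro bilinear_maps_add S_module bilinear_maps_comp[OF b id P_linear id]
        bilinear_maps_comp[OF b P_linear id id] bilinear_maps_comp[OF b id id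
          linear_maps_a_inv_fun[OF S_module bilinear_mapsD(1)[OF b \<kappa>_closed]]])
  from bilinear_maps_comp[OF this id id P_linear]
  show "(\<lambda>x y. P (x \<otimes>\<^bsub>S\<^esub> P y \<oplus>\<^bsub>S\<^esub> P x \<otimes>\<^bsub>S\<^esub> y \<ominus>\<^bsub>S\<^esub> \<kappa> \<otimes>\<^bsub>S\<^esub> (x \<otimes>\<^bsub>S\<^esub> y))) \<in> bilinear_maps R S S S"
    by (simp add: a_minus_def)
  fix s t assume "s \<in> sh_pure R A ` SW" "t \<in> sh_pure R A ` SW"
  then obtain a u b v where *: "a \<in> carrier A" "u \<in> L" "s = q a (ee u)" "b \<in> carrier A" "v \<in> L" "t = q b (ee v)"
    by (elim sh_pure_image_cases)
  thus "P s \<otimes>\<^bsub>S\<^esub> P t = P (s \<otimes>\<^bsub>S\<^esub> P t \<oplus>\<^bsub>S\<^esub> P s \<otimes>\<^bsub>S\<^esub> t \<ominus>\<^bsub>S\<^esub> \<kappa> \<otimes>\<^bsub>S\<^esub> (s \<otimes>\<^bsub>S\<^esub> t))"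
    by (simp add: P_q q_mult \<kappa>_mult_q S.M.minus_eq linear_mapsD(2)[OF P_linear] mul_pre
        linear_mapsD(2)[OF q_linear])
qed

end

section \<open>The bialgebra structure\<close>

lemma algebra_self_module:
  fixes R (structure)
  assumes "cring R"
  shows "algebra R (self_module R)"
proof -
  interpret cring R by fact
  show ?thesis
    by (rule algebraI[OF assms], unfold_locales)
      (auto simp: self_module_def a_ac m_ac l_distr r_distr Units_def
        intro: exI[of _ "\<ominus> x" for x])
qed

lemma algebra_homs_id: "(\<lambda>x. x) \<in> algebra_homs R M M"
  by (auto simp: algebra_homs_def linear_maps_id ring_hom_def)

lemma algebra_homs_comp:
  "\<lbrakk>f \<in> algebra_homs R M N; g \<in> algebra_homs R N L\<rbrakk> \<Longrightarrow> (\<lambda>x. g (f x)) \<in> algebra_homs R M L"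
  by (auto simp: algebra_homs_def ring_hom_def Pi_iff intro: linear_maps_comp)

text \<open>The \<open>Cons\<close> premise is offered for arbitrary \<open>w\<close> in the carrier
  rather than for classes of words, so that it can be met with the recursion formulas for general
  elements.\<close>

lemma (in td_words) S_linear_eqI:
  assumes N: "module R N" and f: "f \<in> linear_maps R S N" and g: "g \<in> linear_maps R S N"
    and letter: "\<And>a. a \<in> carrier A \<Longrightarrow> f (\<iota> a) = g (\<iota> a)"
    and Cons: "\<And>a w. \<lbrakk>a \<in> carrier A; w \<in> carrier S; f w = g w\<rbrakk> \<Longrightarrow> f (\<iota> a \<otimes>\<^bsub>S\<^esub> P w) = g (\<iota> a \<otimes>\<^bsub>S\<^esub> P w)"
    and x: "x \<in> carrier S"
  shows "f x = g x"
  using x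
proof (induction x rule: S_induct)
  case (letter a)
  thus ?case by (rule assms(4))
next
  case (Cons a w)
  thus ?case by (intro assms(5)) (simp_all add: sh_pure_closed)
qed (simp_all add: linear_mapsD[OF f] linear_mapsD[OF g]
    linear_maps_zero[OF S_module N f] linear_maps_zero[OF S_module N g])

locale td_bialgebra = td_words R A l
  for R :: "('r, 'x) ring_scheme" and A :: "('r, 'a, 'y) module_scheme" and l :: 'r +
  fixes \<Delta>A :: "'a \<Rightarrow> ('a \<times> 'a \<Rightarrow> 'r) set" and \<epsilon>A :: "'a \<Rightarrow> 'r"
  assumes bialgebra_A: "bialgebra R A \<Delta>A \<epsilon>A"
begin

abbreviation "T \<equiv> tensor R S S"
abbreviation "TA \<equiv> tensor R A A"
abbreviation "\<iota>\<iota> \<equiv> tensor_map R S S (\<lambda>a. \<iota> a) (\<lambda>a. \<iota> a)"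
abbreviation "dl \<equiv> sh_comult_letter R A l \<Delta>A"
abbreviation "dw \<equiv> sh_comult_word R A l \<Delta>A"
abbreviation "\<Delta> \<equiv> sh_comult R A l \<Delta>A"
abbreviation "Q \<equiv> tensor_map R S S (\<lambda>x. x) P"
abbreviation "pt \<equiv> pure_tensor R S S"

lemmas \<Delta>A_hom = bialgebra.comult_hom[OF bialgebra_A]
lemmas \<epsilon>A_hom = bialgebra.counit_hom[OF bialgebra_A]
lemmas A_coalgebra = coalgebra.axioms(1)[OF bialgebra.axioms(2)[OF bialgebra_A]]
lemmas \<Delta>A_linear = algebra_homsD(1)[OF \<Delta>A_hom]
lemmas \<iota>_linear = algebra_homsD(1)[OF \<iota>_hom]

sublocale T: algebra R T by (rule algebra_tensor[OF S_algebra S_algebra])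

lemmas \<iota>\<iota>_pure = tensor_map_pure[OF A.module A.module S_module S_module \<iota>_linear \<iota>_linear]
lemmas \<iota>\<iota>_hom = tensor_map_algebra_hom[OF algebra_A algebra_A S_algebra S_algebra \<iota>_hom \<iota>_hom]

section \<open>The comultiplication of words\<close>

lemma dl_hom: "dl \<in> algebra_homs R A T"
  unfolding sh_comult_letter_def[abs_def] by (rule algebra_homs_comp[OF \<Delta>A_hom \<iota>\<iota>_hom])

lemmas dl_linear = algebra_homsD(1)[OF dl_hom]
lemmas dl_mult = algebra_homsD(3)[OF dl_hom]

lemma dl_closed [simp]: "a \<in> carrier A \<Longrightarrow> dl a \<in> carrier T"
  by (rule linear_mapsD(1)[OF dl_linear])

lemmas Q_linear = tensor_map_linear[OF S_module S_module S_module S_module linear_maps_id P_linear]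
lemmas Q_pure = tensor_map_pure[OF S_module S_module S_module S_module linear_maps_id P_linear]

lemma Q_closed [simp]: "t \<in> carrier T \<Longrightarrow> Q t \<in> carrier T"
  by (rule linear_mapsD(1)[OF Q_linear])

lemmas pt_closed [simp] = pure_tensor_closed[OF S_module S_module]
lemmas pt_mult = tensor_mult_pure[OF S_algebra S_algebra]
lemmas T_one = tensor_one[OF S_algebra S_algebra]
lemmas T_linear_eqI = tensor_linear_eqI[OF S_module S_module]
lemmas T_spans = spans_tensor[OF S_module S_module]
lemmas pt_linear2 = bilinear_mapsD(1)[OF pure_tensor_bilinear[OF S_module S_module]]

text \<open>Restricted to nonempty tails: for \<open>w = []\<close> the right-hand side would be
  zero, while the value on a single letter is \<open>dl a\<close>.\<close>

lemma dw_Cons: "w \<in> SW \<Longrightarrow> dw (a # w) = dl a \<otimes>\<^bsub>T\<^esub> Q (dw w)"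
  by (elim sh_words_cases) simp

lemma dw_closed: "w \<in> SW \<Longrightarrow> dw w \<in> carrier T"
proof (induction w)
  case (Cons a w)
  hence a: "a \<in> carrier A" "w \<in> L" by (auto simp: sh_words_iff)
  show ?case
  proof (cases "w = []")
    case False
    hence "w \<in> SW" using a by (simp add: sh_words_iff)
    thus ?thesis using Cons.IH a by (simp add: dw_Cons)
  qed (simp add: a)
qed (simp add: sh_words_iff)

text \<open>If the altered letter comes first, linearity of \<open>dl\<close> is used; otherwise the
  sum passes through \<open>Q\<close> and the product by linearity. This is the condition for
  \<open>dw\<close> to descend to \<open>Sh(A)\<close>.\<close>

lemma dw_add:
  "\<lbrakk>u \<in> L; a \<in> carrier A; b \<in> carrier A; v \<in> L\<rbrakk> \<Longrightarrow>
    dw (u @ (a \<oplus>\<^bsub>A\<^esub> b) # v) = dw (u @ a # v) \<oplus>\<^bsub>T\<^esub> dw (u @ b # v)"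
proof (induction u)
  case Nil
  show ?case
  proof (cases "v = []")
    case True
    thus ?thesis using Nil by (simp add: linear_mapsD(2)[OF dl_linear])
  next
    case False
    hence "v \<in> SW" using Nil by (simp add: sh_words_iff)
    thus ?thesis using Nil
      by (simp add: dw_Cons linear_mapsD(2)[OF dl_linear] T.l_distr dw_closed)
  qed
next
  case (Cons d u)
  thus ?case
    by (simp add: dw_Cons insert_letter_word linear_mapsD(2)[OF Q_linear] dw_closed T.r_distr)
qed

lemma dw_smult:
  "\<lbrakk>u \<in> L; r \<in> carrier R; a \<in> carrier A; v \<in> L\<rbrakk> \<Longrightarrow>
    dw (u @ (r \<odot>\<^bsub>A\<^esub> a) # v) = r \<odot>\<^bsub>T\<^esub> dw (u @ a # v)"
proof (induction u)
  case Nil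
  show ?case
  proof (cases "v = []")
    case True
    thus ?thesis using Nil by (simp add: linear_mapsD(3)[OF dl_linear])
  next
    case False
    hence "v \<in> SW" using Nil by (simp add: sh_words_iff)
    thus ?thesis using Nil
      by (simp add: dw_Cons linear_mapsD(3)[OF dl_linear] T.smult_assoc2 dw_closed)
  qed
next
  case (Cons d u)
  thus ?case
    by (simp add: dw_Cons insert_letter_word linear_mapsD(3)[OF Q_linear] dw_closed
        linear_mapsD(3)[OF bilinear_mapsD(1)[OF T.mult_bilinear]])
qed

lemmas T_module = T.module

lemma \<Delta>_linear: "\<Delta> \<in> linear_maps R S T"
  and \<Delta>_pure: "w \<in> SW \<Longrightarrow> \<Delta> (sh_pure R A w) = dw w"
proof -
  show "\<Delta> \<in> linear_maps R S T"
    unfolding sh_comult_def by (rule sh_lift_linear[OF T_module dw_closed dw_add dw_smult])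
  show "w \<in> SW \<Longrightarrow> \<Delta> (sh_pure R A w) = dw w"
    unfolding sh_comult_def by (rule sh_lift_pure[OF T_module dw_closed dw_add dw_smult])
qed

lemma \<Delta>_closed [simp]: "x \<in> carrier S \<Longrightarrow> \<Delta> x \<in> carrier T"
  by (rule linear_mapsD(1)[OF \<Delta>_linear])

lemma \<Delta>_\<iota>: "a \<in> carrier A \<Longrightarrow> \<Delta> (\<iota> a) = dl a"
  by (subst \<Delta>_pure) (simp_all add: sh_words_iff)

section \<open>The recursion on arbitrary elements, and the cocycle identity\<close>

lemma \<Delta>_Cons:
  assumes a: "a \<in> carrier A" and x: "x \<in> carrier S"
  shows "\<Delta> (\<iota> a \<otimes>\<^bsub>S\<^esub> P x) = dl a \<otimes>\<^bsub>T\<^esub> Q (\<Delta> x)"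
proof (rule linear_maps_eqI[OF S_module T_module spans_S
      linear_maps_comp[OF linear_maps_comp[OF P_linear bilinear_mapsD(1)[OF S_mult_bilinear \<iota>_closed[OF a]]] \<Delta>_linear]
      linear_maps_comp[OF linear_maps_comp[OF \<Delta>_linear Q_linear] bilinear_mapsD(1)[OF T.mult_bilinear dl_closed[OF a]]]
      _ x])
  fix s assume "s \<in> sh_pure R A ` SW"
  then obtain w where w: "w \<in> SW" "s = sh_pure R A w" by (rule imageE)
  have "\<Delta> (sh_pure R A (a # w)) = dl a \<otimes>\<^bsub>T\<^esub> Q (dw w)"
    using a w(1) by (subst \<Delta>_pure) (simp_all add: sh_words_iff dw_Cons)
  thus "\<Delta> (\<iota> a \<otimes>\<^bsub>S\<^esub> P s) = dl a \<otimes>\<^bsub>T\<^esub> Q (\<Delta> s)"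
    using w a by (simp add: sh_pure_Cons \<Delta>_pure)
qed

lemma \<iota>_one: "\<iota> \<one>\<^bsub>A\<^esub> = \<one>\<^bsub>S\<^esub>"
  by (rule algebra_homsD(2)[OF \<iota>_hom])

lemma \<Delta>_one: "\<Delta> \<one>\<^bsub>S\<^esub> = \<one>\<^bsub>T\<^esub>"
  using \<Delta>_\<iota>[OF A.one_closed] algebra_homsD(2)[OF dl_hom] by (simp add: \<iota>_one)

text \<open>The case \<open>a = \<one>\<close> of the recursion, since \<open>\<iota> \<one>\<close>
  and \<open>dl \<one>\<close> are units. This is the cocycle identity.\<close>

lemma \<Delta>_P: "x \<in> carrier S \<Longrightarrow> \<Delta> (P x) = Q (\<Delta> x)"
  using \<Delta>_Cons[OF A.one_closed, of x] algebra_homsD(2)[OF dl_hom] by (simp add: \<iota>_one)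

text \<open>The operator \<open>id \<otimes> P\<close> satisfies the same identities as \<open>P\<close>, with \<open>1 \<otimes> \<kappa>\<close> in the
  role of \<open>\<kappa>\<close>.\<close>

definition \<kappa>T where "\<kappa>T = pt \<one>\<^bsub>S\<^esub> \<kappa>"

lemma \<kappa>T_closed [simp]: "\<kappa>T \<in> carrier T"
  by (simp add: \<kappa>T_def)

text \<open>By the cocycle identity \<open>\<Delta>\<close> sends \<open>P 1\<close> to
  \<open>Q (1 \<otimes> 1) = 1 \<otimes> P 1\<close>, and the scalar can be moved to the right
  factor.\<close>

lemma \<Delta>_\<kappa>: "\<Delta> \<kappa> = \<kappa>T"
proof -
  note lin = linear_maps_minus[OF S_module T_module \<Delta>_linear] linear_mapsD(3)[OF \<Delta>_linear]
    linear_maps_minus[OF S_module T_module pt_linear2] linear_mapsD(3)[OF pt_linear2]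
  show ?thesis by (simp add: \<kappa>_def \<kappa>T_def lin l_closed \<Delta>_P \<Delta>_one T_one Q_pure)
qed

lemma \<kappa>T_mult_Q: "t \<in> carrier T \<Longrightarrow> \<kappa>T \<otimes>\<^bsub>T\<^esub> Q t = Q (Q t)"
  by (rule T_linear_eqI[OF T_module linear_maps_comp[OF Q_linear bilinear_mapsD(1)[OF T.mult_bilinear \<kappa>T_closed]]
      linear_maps_comp[OF Q_linear Q_linear]])
    (simp_all add: Q_pure \<kappa>T_def pt_mult P_mult_\<kappa>)

lemma Q_mult_Q:
  assumes "s \<in> carrier T" "t \<in> carrier T"
  shows "Q s \<otimes>\<^bsub>T\<^esub> Q t = Q (s \<otimes>\<^bsub>T\<^esub> Q t \<oplus>\<^bsub>T\<^esub> Q s \<otimes>\<^bsub>T\<^esub> t \<ominus>\<^bsub>T\<^esub> \<kappa>T \<otimes>\<^bsub>T\<^esub> (s \<otimes>\<^bsub>T\<^esub> t))"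
proof (rule bilinear_maps_eqI[OF T_module T_module T_module T_spans T_spans _ _ _ assms])
  note id = linear_maps_id and b = T.mult_bilinear
  show "(\<lambda>x y. Q x \<otimes>\<^bsub>T\<^esub> Q y) \<in> bilinear_maps R T T T"
    by (rule bilinear_maps_comp[OF b Q_linear Q_linear id])
  have "(\<lambda>x y. x \<otimes>\<^bsub>T\<^esub> Q y \<oplus>\<^bsub>T\<^esub> Q x \<otimes>\<^bsub>T\<^esub> y \<oplus>\<^bsub>T\<^esub> (\<ominus>\<^bsub>T\<^esub> (\<kappa>T \<otimes>\<^bsub>T\<^esub> (x \<otimes>\<^bsub>T\<^esub> y)))) \<in> bilinear_maps R T T T"
    by (intro bilinear_maps_add T_module bilinear_maps_comp[OF b id Q_linear id]
        bilinear_maps_comp[OF b Q_linear id id] bilinear_maps_comp[OF b id id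
          linear_maps_a_inv_fun[OF T_module bilinear_mapsD(1)[OF b \<kappa>T_closed]]])
  from bilinear_maps_comp[OF this id id Q_linear]
  show "(\<lambda>x y. Q (x \<otimes>\<^bsub>T\<^esub> Q y \<oplus>\<^bsub>T\<^esub> Q x \<otimes>\<^bsub>T\<^esub> y \<ominus>\<^bsub>T\<^esub> \<kappa>T \<otimes>\<^bsub>T\<^esub> (x \<otimes>\<^bsub>T\<^esub> y))) \<in> bilinear_maps R T T T"
    by (simp add: a_minus_def)
  fix s t assume "s \<in> {pt x y |x y. x \<in> carrier S \<and> y \<in> carrier S}"
    "t \<in> {pt x y |x y. x \<in> carrier S \<and> y \<in> carrier S}"
  then obtain x y x' y' where *: "x \<in> carrier S" "y \<in> carrier S" "x' \<in> carrier S" "y' \<in> carrier S"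
    "s = pt x y" "t = pt x' y'" by blast
  \<comment> \<open>All three terms have the same left factor, the product of \<open>x\<close> and
    \<open>x'\<close>. The bracket is therefore a pure tensor, and the identity for \<open>P\<close>
    applies in the right factor.\<close>
  have "s \<otimes>\<^bsub>T\<^esub> Q t \<oplus>\<^bsub>T\<^esub> Q s \<otimes>\<^bsub>T\<^esub> t \<ominus>\<^bsub>T\<^esub> \<kappa>T \<otimes>\<^bsub>T\<^esub> (s \<otimes>\<^bsub>T\<^esub> t) =
      pt (x \<otimes>\<^bsub>S\<^esub> x') (y \<otimes>\<^bsub>S\<^esub> P y' \<oplus>\<^bsub>S\<^esub> P y \<otimes>\<^bsub>S\<^esub> y' \<ominus>\<^bsub>S\<^esub> \<kappa> \<otimes>\<^bsub>S\<^esub> (y \<otimes>\<^bsub>S\<^esub> y'))"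
    using * by (simp add: Q_pure \<kappa>T_def pt_mult linear_maps_minus[OF S_module T_module pt_linear2]
        linear_mapsD(2)[OF pt_linear2])
  thus "Q s \<otimes>\<^bsub>T\<^esub> Q t = Q (s \<otimes>\<^bsub>T\<^esub> Q t \<oplus>\<^bsub>T\<^esub> Q s \<otimes>\<^bsub>T\<^esub> t \<ominus>\<^bsub>T\<^esub> \<kappa>T \<otimes>\<^bsub>T\<^esub> (s \<otimes>\<^bsub>T\<^esub> t))"
    using * by (simp add: Q_pure pt_mult P_mult_P)
qed

section \<open>Multiplicativity of the comultiplication\<close>

lemma \<Delta>_\<iota>_mult:
  assumes a: "a \<in> carrier A" and y: "y \<in> carrier S"
  shows "\<Delta> (\<iota> a \<otimes>\<^bsub>S\<^esub> y) = dl a \<otimes>\<^bsub>T\<^esub> \<Delta> y"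
proof (rule S_linear_eqI[OF T_module linear_maps_comp[OF bilinear_mapsD(1)[OF S_mult_bilinear \<iota>_closed[OF a]] \<Delta>_linear]
      linear_maps_comp[OF \<Delta>_linear bilinear_mapsD(1)[OF T.mult_bilinear dl_closed[OF a]]] _ _ y])
  fix b assume b: "b \<in> carrier A"
  have "\<iota> a \<otimes>\<^bsub>S\<^esub> \<iota> b = \<iota> (a \<otimes>\<^bsub>A\<^esub> b)" using algebra_homsD(3)[OF \<iota>_hom a b] by simp
  thus "\<Delta> (\<iota> a \<otimes>\<^bsub>S\<^esub> \<iota> b) = dl a \<otimes>\<^bsub>T\<^esub> \<Delta> (\<iota> b)"
    using a b by (simp add: \<Delta>_\<iota> dl_mult)
next
  fix b w assume b: "b \<in> carrier A" and w: "w \<in> carrier S"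
  \<comment> \<open>The letter \<open>a\<close> merges with the leading letter \<open>b\<close>; the
    recursion applies to the result, and \<open>dl\<close> is multiplicative.\<close>
  have "\<iota> a \<otimes>\<^bsub>S\<^esub> (\<iota> b \<otimes>\<^bsub>S\<^esub> P w) = \<iota> (a \<otimes>\<^bsub>A\<^esub> b) \<otimes>\<^bsub>S\<^esub> P w"
    using algebra_homsD(3)[OF \<iota>_hom a b] a b w by (simp add: S.m_assoc)
  thus "\<Delta> (\<iota> a \<otimes>\<^bsub>S\<^esub> (\<iota> b \<otimes>\<^bsub>S\<^esub> P w)) = dl a \<otimes>\<^bsub>T\<^esub> \<Delta> (\<iota> b \<otimes>\<^bsub>S\<^esub> P w)"
    using a b w by (simp add: \<Delta>_Cons dl_mult T.m_assoc)
qed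

text \<open>\<open>\<kappa>\<close> involves a word of length two, so the term with
  \<open>\<kappa>\<close> in the product identity is out of reach of an induction on total length
  and is treated separately. Both \<open>\<kappa>\<close> and \<open>\<kappa>T\<close> pass the
  leading letter and double the operator that follows it.\<close>

lemma \<Delta>_\<kappa>_mult:
  assumes x: "x \<in> carrier S"
  shows "\<Delta> (\<kappa> \<otimes>\<^bsub>S\<^esub> x) = \<kappa>T \<otimes>\<^bsub>T\<^esub> \<Delta> x"
proof (rule S_linear_eqI[OF T_module linear_maps_comp[OF bilinear_mapsD(1)[OF S_mult_bilinear \<kappa>_closed] \<Delta>_linear]
      linear_maps_comp[OF \<Delta>_linear bilinear_mapsD(1)[OF T.mult_bilinear \<kappa>T_closed]] _ _ x])
  fix a assume a: "a \<in> carrier A"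
  thus "\<Delta> (\<kappa> \<otimes>\<^bsub>S\<^esub> \<iota> a) = \<kappa>T \<otimes>\<^bsub>T\<^esub> \<Delta> (\<iota> a)"
    using \<Delta>_\<iota>_mult[OF a \<kappa>_closed] by (simp add: S.m_comm[of \<kappa>] T.m_comm[of \<kappa>T] \<Delta>_\<iota> \<Delta>_\<kappa>)
next
  fix a w assume a: "a \<in> carrier A" and w: "w \<in> carrier S"
  have "\<kappa> \<otimes>\<^bsub>S\<^esub> (\<iota> a \<otimes>\<^bsub>S\<^esub> P w) = \<iota> a \<otimes>\<^bsub>S\<^esub> P (P w)"
    using a w by (simp add: P_mult_\<kappa>[symmetric] S.m_lcomm)
  moreover have "\<kappa>T \<otimes>\<^bsub>T\<^esub> (dl a \<otimes>\<^bsub>T\<^esub> Q (\<Delta> w)) = dl a \<otimes>\<^bsub>T\<^esub> Q (Q (\<Delta> w))"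
    using a w by (simp add: \<kappa>T_mult_Q[symmetric] T.m_lcomm)
  ultimately show "\<Delta> (\<kappa> \<otimes>\<^bsub>S\<^esub> (\<iota> a \<otimes>\<^bsub>S\<^esub> P w)) = \<kappa>T \<otimes>\<^bsub>T\<^esub> \<Delta> (\<iota> a \<otimes>\<^bsub>S\<^esub> P w)"
    using a w by (simp add: \<Delta>_Cons \<Delta>_P)
qed

lemma \<iota>_P_mult:
  assumes "a \<in> carrier A" "b \<in> carrier A" "x \<in> carrier S" "y \<in> carrier S"
  shows "(\<iota> a \<otimes>\<^bsub>S\<^esub> P x) \<otimes>\<^bsub>S\<^esub> (\<iota> b \<otimes>\<^bsub>S\<^esub> P y) =
    \<iota> (a \<otimes>\<^bsub>A\<^esub> b) \<otimes>\<^bsub>S\<^esub> P (x \<otimes>\<^bsub>S\<^esub> P y \<oplus>\<^bsub>S\<^esub> P x \<otimes>\<^bsub>S\<^esub> y \<ominus>\<^bsub>S\<^esub> \<kappa> \<otimes>\<^bsub>S\<^esub> (x \<otimes>\<^bsub>S\<^esub> y))"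
  using assms algebra_homsD(3)[OF \<iota>_hom assms(1,2)]
  by (simp add: P_mult_P[symmetric] S.m_assoc S.m_lcomm[of "P x"])

text \<open>The identity for \<open>P\<close> rewrites a product of two words with nonempty tails as
  a letter times \<open>P\<close> of three terms: two products shorter by one letter in total, and
  \<open>\<kappa>\<close> times a product shorter by two. The identity for \<open>Q\<close>
  reassembles their images. If a word is a single letter, \<open>\<Delta>_\<iota>_mult\<close>
  applies.\<close>

lemma \<Delta>_mult_pure:
  "\<lbrakk>u \<in> SW; v \<in> SW\<rbrakk> \<Longrightarrow> \<Delta> (sh_pure R A u \<otimes>\<^bsub>S\<^esub> sh_pure R A v) =
    \<Delta> (sh_pure R A u) \<otimes>\<^bsub>T\<^esub> \<Delta> (sh_pure R A v)"
proof (induction "length u + length v" arbitrary: u v rule: less_induct)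
  case less
  obtain a u' where u: "a \<in> carrier A" "u' \<in> L" "u = a # u'" using less.prems(1) by (rule sh_words_cases)
  obtain b v' where v: "b \<in> carrier A" "v' \<in> L" "v = b # v'" using less.prems(2) by (rule sh_words_cases)
  have cl: "sh_pure R A u \<in> carrier S" "sh_pure R A v \<in> carrier S"
    using less.prems by (simp_all add: sh_pure_closed)
  show ?case
  proof (cases "u' = [] \<or> v' = []")
    case True
    thus ?thesis
    proof
      assume "u' = []"
      thus ?thesis using \<Delta>_\<iota>_mult[OF u(1) cl(2)] u by (simp add: \<Delta>_\<iota>)
    next
      assume "v' = []"
      thus ?thesis using \<Delta>_\<iota>_mult[OF v(1) cl(1)] v cl
        by (simp add: \<Delta>_\<iota> S.m_comm[of "sh_pure R A u"] T.m_comm[of "\<Delta> (sh_pure R A u)"])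
    qed
  next
    case False
    define x where "x = sh_pure R A u'"
    define y where "y = sh_pure R A v'"
    have SW: "u' \<in> SW" "v' \<in> SW" "\<one>\<^bsub>A\<^esub> # u' \<in> SW" "\<one>\<^bsub>A\<^esub> # v' \<in> SW"
      using u v False by (auto simp: sh_words_iff)
    have xy: "x \<in> carrier S" "y \<in> carrier S" using SW by (simp_all add: x_def y_def sh_pure_closed)
    have eqs: "sh_pure R A u = \<iota> a \<otimes>\<^bsub>S\<^esub> P x" "sh_pure R A v = \<iota> b \<otimes>\<^bsub>S\<^esub> P y"
      using u v SW by (simp_all add: x_def y_def sh_pure_Cons)
    \<comment> \<open>\<open>P x\<close> and \<open>P y\<close> are classes of words exactly as long
      as \<open>u\<close> and \<open>v\<close>; the total length drops because the other factor has
      lost its first letter.\<close>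
    have IH: "\<Delta> (x \<otimes>\<^bsub>S\<^esub> P y) = \<Delta> x \<otimes>\<^bsub>T\<^esub> Q (\<Delta> y)" "\<Delta> (P x \<otimes>\<^bsub>S\<^esub> y) = Q (\<Delta> x) \<otimes>\<^bsub>T\<^esub> \<Delta> y"
      "\<Delta> (x \<otimes>\<^bsub>S\<^esub> y) = \<Delta> x \<otimes>\<^bsub>T\<^esub> \<Delta> y"
      using less.hyps[OF _ SW(1,4)] less.hyps[OF _ SW(3,2)] less.hyps[OF _ SW(1,2)] u v xy SW
      by (simp_all add: x_def y_def P_pure[symmetric] \<Delta>_P)
    let ?z = "x \<otimes>\<^bsub>S\<^esub> P y \<oplus>\<^bsub>S\<^esub> P x \<otimes>\<^bsub>S\<^esub> y \<ominus>\<^bsub>S\<^esub> \<kappa> \<otimes>\<^bsub>S\<^esub> (x \<otimes>\<^bsub>S\<^esub> y)"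
    have "\<Delta> ?z = \<Delta> x \<otimes>\<^bsub>T\<^esub> Q (\<Delta> y) \<oplus>\<^bsub>T\<^esub> Q (\<Delta> x) \<otimes>\<^bsub>T\<^esub> \<Delta> y \<ominus>\<^bsub>T\<^esub> \<kappa>T \<otimes>\<^bsub>T\<^esub> (\<Delta> x \<otimes>\<^bsub>T\<^esub> \<Delta> y)"
      using xy by (simp add: linear_maps_minus[OF S_module T_module \<Delta>_linear]
          linear_mapsD(2)[OF \<Delta>_linear] IH \<Delta>_\<kappa>_mult)
    hence *: "Q (\<Delta> ?z) = Q (\<Delta> x) \<otimes>\<^bsub>T\<^esub> Q (\<Delta> y)"
      using Q_mult_Q[of "\<Delta> x" "\<Delta> y"] xy by simp
    have "\<Delta> (sh_pure R A u \<otimes>\<^bsub>S\<^esub> sh_pure R A v) = dl (a \<otimes>\<^bsub>A\<^esub> b) \<otimes>\<^bsub>T\<^esub> Q (\<Delta> ?z)"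
      unfolding eqs \<iota>_P_mult[OF u(1) v(1) xy] using u v xy by (intro \<Delta>_Cons) simp_all
    also have "\<dots> = (dl a \<otimes>\<^bsub>T\<^esub> Q (\<Delta> x)) \<otimes>\<^bsub>T\<^esub> (dl b \<otimes>\<^bsub>T\<^esub> Q (\<Delta> y))"
      unfolding * using u v xy by (simp add: dl_mult T.m_assoc T.m_lcomm[of "Q (\<Delta> x)"])
    also have "\<dots> = \<Delta> (sh_pure R A u) \<otimes>\<^bsub>T\<^esub> \<Delta> (sh_pure R A v)"
      unfolding eqs using u v xy by (simp add: \<Delta>_Cons)
    finally show ?thesis .
  qed
qed

lemma \<Delta>_hom: "\<Delta> \<in> algebra_homs R S T"
proof (rule algebra_homs_spansI[OF S_algebra T.algebra_axioms \<Delta>_linear spans_S \<Delta>_one])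
  fix x y assume "x \<in> sh_pure R A ` SW" "y \<in> sh_pure R A ` SW"
  thus "\<Delta> (x \<otimes>\<^bsub>S\<^esub> y) = \<Delta> x \<otimes>\<^bsub>T\<^esub> \<Delta> y"
    by (elim imageE) (simp add: \<Delta>_mult_pure)
qed

section \<open>Coassociativity\<close>

lemma \<Delta>_coassoc:
  assumes x: "x \<in> carrier S"
  shows "tensor_assoc R S S S (tensor_map R T S \<Delta> (\<lambda>x. x) (\<Delta> x)) = tensor_map R S T (\<lambda>x. x) \<Delta> (\<Delta> x)"
proof -
  let ?T3 = "tensor R S T"
  interpret T3: algebra R ?T3 by (rule algebra_tensor[OF S_algebra T.algebra_axioms])
  note id = linear_maps_id and Sm = S_module and Tm = T_module
  \<comment> \<open>The two sides are regarded as maps on all of \<open>T\<close>, where they are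
    algebra homomorphisms. \<open>Q3\<close> is \<open>id \<otimes> id \<otimes> P\<close>, and
    \<open>I3\<close> is the threefold inclusion of letters.\<close>
  define Lh where "Lh t = tensor_assoc R S S S (tensor_map R T S \<Delta> (\<lambda>x. x) t)" for t
  define Rh where "Rh = tensor_map R S T (\<lambda>x. x) \<Delta>"
  define Q3 where "Q3 = tensor_map R S T (\<lambda>x. x) Q"
  define I3 where "I3 = tensor_map R S T (\<lambda>a. \<iota> a) \<iota>\<iota>"
  have Lh_hom: "Lh \<in> algebra_homs R T ?T3"
    unfolding Lh_def[abs_def]
    by (rule algebra_homs_comp[OF tensor_map_algebra_hom[OF S_algebra S_algebra T.algebra_axioms
          S_algebra \<Delta>_hom algebra_homs_id] tensor_assoc_algebra_hom[OF S_algebra S_algebra S_algebra]])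
  have Rh_hom: "Rh \<in> algebra_homs R T ?T3"
    unfolding Rh_def
    by (rule tensor_map_algebra_hom[OF S_algebra S_algebra S_algebra T.algebra_axioms
          algebra_homs_id \<Delta>_hom])
  note Lh_lin = algebra_homsD(1)[OF Lh_hom] and Rh_lin = algebra_homsD(1)[OF Rh_hom]
  note assoc_lin = tensor_assoc_linear[OF Sm Sm Sm] and assoc_pure = tensor_assoc_pure[OF Sm Sm Sm]
  note Q3_lin = tensor_map_linear[OF Sm Tm Sm Tm id Q_linear, folded Q3_def]
  note Q3_pure = tensor_map_pure[OF Sm Tm Sm Tm id Q_linear, folded Q3_def]
  have TA: "module R TA" by (rule module_tensor[OF A.module A.module])
  note I3_lin = tensor_map_linear[OF A.module TA Sm Tm \<iota>_linear algebra_homsD(1)[OF \<iota>\<iota>_hom], folded I3_def]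
  note I3_pure = tensor_map_pure[OF A.module TA Sm Tm \<iota>_linear algebra_homsD(1)[OF \<iota>\<iota>_hom], folded I3_def]
  have Lh_pure: "Lh (pt x y) = tensor_assoc R S S S (pure_tensor R T S (\<Delta> x) y)"
    if "x \<in> carrier S" "y \<in> carrier S" for x y
    unfolding Lh_def by (simp add: tensor_map_pure[OF Sm Sm Tm Sm \<Delta>_linear id] that)
  have Rh_pure: "Rh (pt x y) = pure_tensor R S T x (\<Delta> y)" if "x \<in> carrier S" "y \<in> carrier S" for x y
    unfolding Rh_def by (simp add: tensor_map_pure[OF Sm Sm Sm Tm id \<Delta>_linear] that)
  note ptT1 = bilinear_mapsD(2)[OF pure_tensor_bilinear[OF Tm Sm]]
  have LQ: "Lh (Q t) = Q3 (Lh t)" if t: "t \<in> carrier T" for t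
  proof (rule T_linear_eqI[OF T3.module linear_maps_comp[OF Q_linear Lh_lin] linear_maps_comp[OF Lh_lin Q3_lin] _ t])
    fix x y assume xy: "x \<in> carrier S" "y \<in> carrier S"
    \<comment> \<open>The associator is explicit only on pure tensors, and \<open>\<Delta> x\<close>
      need not be one; it is replaced by an arbitrary \<open>s\<close>, to which linearity
      applies.\<close>
    have "tensor_assoc R S S S (pure_tensor R T S s (P y)) = Q3 (tensor_assoc R S S S (pure_tensor R T S s y))"
      if s: "s \<in> carrier T" for s
      by (rule T_linear_eqI[OF T3.module linear_maps_comp[OF ptT1 assoc_lin]
            linear_maps_comp[OF linear_maps_comp[OF ptT1 assoc_lin] Q3_lin] _ s])
        (simp_all add: xy assoc_pure Q3_pure Q_pure)
    thus "Lh (Q (pt x y)) = Q3 (Lh (pt x y))" using xy by (simp add: Q_pure Lh_pure)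
  qed
  \<comment> \<open>Here \<open>P\<close> stands in the factor to which \<open>\<Delta>\<close> is
    applied, and the cocycle identity turns it into \<open>Q\<close>.\<close>
  have RQ: "Rh (Q t) = Q3 (Rh t)" if t: "t \<in> carrier T" for t
    by (rule T_linear_eqI[OF T3.module linear_maps_comp[OF Q_linear Rh_lin] linear_maps_comp[OF Rh_lin Q3_lin] _ t])
      (simp add: Q_pure Rh_pure Q3_pure \<Delta>_P)
  have \<Delta>Ac: "\<Delta>A a \<in> carrier TA" if "a \<in> carrier A" for a
    by (rule linear_mapsD(1)[OF \<Delta>A_linear that])
  \<comment> \<open>On letters the two sides are the images under \<open>I3\<close> of the two sides
    of coassociativity in \<open>A\<close>.\<close>
  have letter: "Lh (dl a) = Rh (dl a)" if a: "a \<in> carrier A" for a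
  proof -
    let ?L = "\<lambda>t. tensor_assoc R A A A (tensor_map R TA A \<Delta>A (\<lambda>x. x) t)"
    have L_lin: "?L \<in> linear_maps R TA (tensor R A TA)"
      by (rule linear_maps_comp[OF tensor_map_linear[OF A.module A.module TA A.module \<Delta>A_linear id]
            tensor_assoc_linear[OF A.module A.module A.module]])
    note L_pure = tensor_map_pure[OF A.module A.module TA A.module \<Delta>A_linear id]
    have R_lin: "tensor_map R A TA (\<lambda>x. x) \<Delta>A \<in> linear_maps R TA (tensor R A TA)"
      by (rule tensor_map_linear[OF A.module A.module A.module TA id \<Delta>A_linear])
    note R_pure = tensor_map_pure[OF A.module A.module A.module TA id \<Delta>A_linear]
    note \<iota>\<iota>_lin = algebra_homsD(1)[OF \<iota>\<iota>_hom]
    note ptA = bilinear_mapsD(2)[OF pure_tensor_bilinear[OF TA A.module]]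
    have 1: "Lh (\<iota>\<iota> t) = I3 (?L t)" if t: "t \<in> carrier TA" for t
    proof (rule tensor_linear_eqI[OF A.module A.module T3.module linear_maps_comp[OF \<iota>\<iota>_lin Lh_lin]
          linear_maps_comp[OF L_lin I3_lin] _ t])
      fix x y assume xy: "x \<in> carrier A" "y \<in> carrier A"
      have "tensor_assoc R S S S (pure_tensor R T S (\<iota>\<iota> s) (\<iota> y)) =
          I3 (tensor_assoc R A A A (pure_tensor R TA A s y))" if s: "s \<in> carrier TA" for s
        by (rule tensor_linear_eqI[OF A.module A.module T3.module
              linear_maps_comp[OF linear_maps_comp[OF \<iota>\<iota>_lin ptT1] assoc_lin]
              linear_maps_comp[OF linear_maps_comp[OF ptA tensor_assoc_linear[OF A.module A.module A.module]] I3_lin] _ s])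
          (simp_all add: xy \<iota>\<iota>_pure assoc_pure tensor_assoc_pure[OF A.module A.module A.module]
            I3_pure pure_tensor_closed[OF A.module A.module])
      from this[OF \<Delta>Ac[OF xy(1)]]
      show "Lh (\<iota>\<iota> (pure_tensor R A A x y)) = I3 (?L (pure_tensor R A A x y))"
        using xy by (simp add: \<iota>\<iota>_pure Lh_pure \<Delta>_\<iota> L_pure sh_comult_letter_def)
    qed
    have 2: "Rh (\<iota>\<iota> t) = I3 (tensor_map R A TA (\<lambda>x. x) \<Delta>A t)" if t: "t \<in> carrier TA" for t
      by (rule tensor_linear_eqI[OF A.module A.module T3.module linear_maps_comp[OF \<iota>\<iota>_lin Rh_lin]
          linear_maps_comp[OF R_lin I3_lin] _ t])
        (simp add: \<iota>\<iota>_pure Rh_pure \<Delta>_\<iota> R_pure I3_pure \<Delta>Ac sh_comult_letter_def)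
    show ?thesis
      unfolding sh_comult_letter_def 1[OF \<Delta>Ac[OF a]] 2[OF \<Delta>Ac[OF a]]
      by (simp add: left_counital_coalgebra.coassoc[OF A_coalgebra a])
  qed
  have "Lh (\<Delta> x) = Rh (\<Delta> x)"
  proof (rule S_linear_eqI[OF T3.module linear_maps_comp[OF \<Delta>_linear Lh_lin] linear_maps_comp[OF \<Delta>_linear Rh_lin] _ _ x])
    fix a assume "a \<in> carrier A"
    thus "Lh (\<Delta> (\<iota> a)) = Rh (\<Delta> (\<iota> a))" by (simp add: \<Delta>_\<iota> letter)
  next
    fix a w assume "a \<in> carrier A" "w \<in> carrier S" "Lh (\<Delta> w) = Rh (\<Delta> w)"
    thus "Lh (\<Delta> (\<iota> a \<otimes>\<^bsub>S\<^esub> P w)) = Rh (\<Delta> (\<iota> a \<otimes>\<^bsub>S\<^esub> P w))"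
      by (simp add: \<Delta>_Cons algebra_homsD(3)[OF Lh_hom] algebra_homsD(3)[OF Rh_hom] letter LQ RQ)
  qed
  thus ?thesis by (simp add: Lh_def Rh_def)
qed

section \<open>The counit\<close>

abbreviation "k \<equiv> self_module R"
abbreviation "\<epsilon> \<equiv> sh_counit R \<epsilon>A"

lemma k_algebra: "algebra R k"
  by (rule algebra_self_module[OF A.R.cring_axioms])

sublocale k: algebra R k by (rule k_algebra)

lemmas \<epsilon>A_linear = algebra_homsD(1)[OF \<epsilon>A_hom]

lemma \<epsilon>_linear: "\<epsilon> \<in> linear_maps R S k"
  and \<epsilon>_pure: "w \<in> SW \<Longrightarrow> \<epsilon> (sh_pure R A w) = (if length w = 1 then \<epsilon>A (hd w) else \<zero>\<^bsub>k\<^esub>)"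
proof -
  let ?\<phi> = "\<lambda>w. if length w = 1 then \<epsilon>A (hd w) else \<zero>\<^bsub>R\<^esub>"
  have z: "\<zero>\<^bsub>k\<^esub> = \<zero>\<^bsub>R\<^esub>" by (simp add: self_module_def)
  have 1: "?\<phi> w \<in> carrier k" if "w \<in> SW" for w
    using that linear_mapsD(1)[OF \<epsilon>A_linear] k.M.zero_closed
    by (elim sh_words_cases) (simp add: z)
  \<comment> \<open>If the altered letter is not the only one, all three values are zero.\<close>
  have 2: "?\<phi> (u @ (a \<oplus>\<^bsub>A\<^esub> b) # v) = ?\<phi> (u @ a # v) \<oplus>\<^bsub>k\<^esub> ?\<phi> (u @ b # v)"
    if "a \<in> carrier A" "b \<in> carrier A" for u a b v
    using that linear_mapsD(2)[OF \<epsilon>A_linear that] k.M.l_zero[OF k.M.zero_closed] by (simp add: z)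
  have 3: "?\<phi> (u @ (r \<odot>\<^bsub>A\<^esub> a) # v) = r \<odot>\<^bsub>k\<^esub> ?\<phi> (u @ a # v)"
    if "r \<in> carrier R" "a \<in> carrier A" for u r a v
    using that linear_mapsD(3)[OF \<epsilon>A_linear that] k.smult_r_null[OF that(1)] by (simp add: z)
  show "\<epsilon> \<in> linear_maps R S k"
    unfolding sh_counit_def by (rule sh_lift_linear[where \<phi> = ?\<phi>, OF k.module 1 2 3])
  show "\<epsilon> (sh_pure R A w) = (if length w = 1 then \<epsilon>A (hd w) else \<zero>\<^bsub>k\<^esub>)" if "w \<in> SW"
    unfolding sh_counit_def z by (rule sh_lift_pure[where \<phi> = ?\<phi>, OF k.module 1 2 3 that])
qed

lemma \<epsilon>_closed [simp]: "x \<in> carrier S \<Longrightarrow> \<epsilon> x \<in> carrier k"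
  by (rule linear_mapsD(1)[OF \<epsilon>_linear])

lemma \<epsilon>_\<iota>: "a \<in> carrier A \<Longrightarrow> \<epsilon> (\<iota> a) = \<epsilon>A a"
  by (subst \<epsilon>_pure) (simp_all add: sh_words_iff)

text \<open>When \<open>x\<close> is the class of a word, the argument is the class of a word of
  length at least two.\<close>

lemma \<epsilon>_Cons:
  assumes a: "a \<in> carrier A" and x: "x \<in> carrier S"
  shows "\<epsilon> (\<iota> a \<otimes>\<^bsub>S\<^esub> P x) = \<zero>\<^bsub>k\<^esub>"
proof (rule linear_maps_eqI[OF S_module k.module spans_S
      linear_maps_comp[OF linear_maps_comp[OF P_linear bilinear_mapsD(1)[OF S_mult_bilinear \<iota>_closed[OF a]]] \<epsilon>_linear]
      linear_maps_zero_fun[OF k.module] _ x])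
  fix s assume "s \<in> sh_pure R A ` SW"
  then obtain w where w: "w \<in> SW" "s = sh_pure R A w" by (rule imageE)
  thus "\<epsilon> (\<iota> a \<otimes>\<^bsub>S\<^esub> P s) = \<zero>\<^bsub>k\<^esub>"
    using a by (simp add: sh_pure_Cons[symmetric] \<epsilon>_pure sh_words_iff)
qed

lemma sh_pure_cases:
  assumes "x \<in> sh_pure R A ` SW"
  obtains a where "a \<in> carrier A" "x = \<iota> a"
  | a y where "a \<in> carrier A" "y \<in> carrier S" "x = \<iota> a \<otimes>\<^bsub>S\<^esub> P y"
proof -
  obtain w where w: "w \<in> SW" "x = sh_pure R A w" using assms by (rule imageE)
  obtain a u where u: "a \<in> carrier A" "u \<in> L" "w = a # u" using w(1) by (rule sh_words_cases)
  show thesis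
  proof (cases "u = []")
    case True
    thus ?thesis using that(1) w u by simp
  next
    case False
    hence "u \<in> SW" using u by (simp add: sh_words_iff)
    thus ?thesis using that(2)[OF u(1) sh_pure_closed] w u by (simp add: sh_pure_Cons)
  qed
qed

text \<open>An element of the form \<open>\<iota> b\<close> times \<open>P x\<close> keeps this form
  when multiplied by a letter or by another such element, and \<open>\<epsilon>\<close> vanishes on
  it. What remains are products of two letters, where \<open>\<epsilon>A\<close> is
  multiplicative.\<close>

lemma \<epsilon>_hom: "\<epsilon> \<in> algebra_homs R S k"
proof (rule algebra_homs_spansI[OF S_algebra k_algebra \<epsilon>_linear spans_S])
  show "\<epsilon> \<one>\<^bsub>S\<^esub> = \<one>\<^bsub>k\<^esub>"
    using \<epsilon>_\<iota>[OF A.one_closed] algebra_homsD(2)[OF \<epsilon>A_hom] by (simp add: \<iota>_one)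
  note \<iota>_mult = algebra_homsD(3)[OF \<iota>_hom]
  have letter: "\<epsilon> (\<iota> a \<otimes>\<^bsub>S\<^esub> y) = \<epsilon> (\<iota> a) \<otimes>\<^bsub>k\<^esub> \<epsilon> y" if a: "a \<in> carrier A" and y: "y \<in> sh_pure R A ` SW" for a y
    using y
  proof (cases rule: sh_pure_cases)
    case (1 b)
    thus ?thesis using a \<iota>_mult[OF a 1(1)] algebra_homsD(3)[OF \<epsilon>A_hom a 1(1)]
      by (simp add: \<epsilon>_\<iota>[symmetric])
  next
    case (2 b x)
    have "\<iota> a \<otimes>\<^bsub>S\<^esub> y = \<iota> (a \<otimes>\<^bsub>A\<^esub> b) \<otimes>\<^bsub>S\<^esub> P x"
      using a 2 \<iota>_mult[OF a 2(1)] by (simp add: S.m_assoc)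
    thus ?thesis using 2 a by (simp add: \<epsilon>_Cons)
  qed
  fix x y assume x: "x \<in> sh_pure R A ` SW" and y: "y \<in> sh_pure R A ` SW"
  have cl: "x \<in> carrier S" "y \<in> carrier S" using x y spans_closed[OF spans_S] by blast+
  from x show "\<epsilon> (x \<otimes>\<^bsub>S\<^esub> y) = \<epsilon> x \<otimes>\<^bsub>k\<^esub> \<epsilon> y"
  proof (cases rule: sh_pure_cases)
    case (1 a)
    thus ?thesis using 1(2) y letter by simp
  next
    case (2 a x')
    note x' = this
    from y show ?thesis
    proof (cases rule: sh_pure_cases)
      case (1 b)
      thus ?thesis using letter[OF 1(1) x] cl
        by (simp add: S.m_comm k.m_comm)
    next
      case (2 b y')
      thus ?thesis using x' by (simp add: \<iota>_P_mult \<epsilon>_Cons)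
    qed
  qed
qed

section \<open>The left counit law\<close>

lemma \<Delta>_left_counit:
  assumes x: "x \<in> carrier S"
  shows "tensor_map R k S \<epsilon> (\<lambda>x. x) (\<Delta> x) = pure_tensor R k S \<one>\<^bsub>R\<^esub> x"
proof -
  \<comment> \<open>\<open>self_module\<close> copies the unit of the ring, but the two constants
    are different terms, and the rules for the algebra \<open>k\<close> mention only its
    own.\<close>
  have one: "\<one>\<^bsub>R\<^esub> = \<one>\<^bsub>k\<^esub>" by (simp add: self_module_def)
  let ?U = "tensor R k S"
  interpret U: algebra R ?U by (rule algebra_tensor[OF k_algebra S_algebra])
  note id = linear_maps_id and Sm = S_module and km = k.module
  define e where "e = tensor_map R k S \<epsilon> (\<lambda>x. x)"
  define QU where "QU = tensor_map R k S (\<lambda>x. x) P"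
  have e_hom: "e \<in> algebra_homs R T ?U"
    unfolding e_def by (rule tensor_map_algebra_hom[OF S_algebra S_algebra k_algebra S_algebra \<epsilon>_hom algebra_homs_id])
  note e_lin = algebra_homsD(1)[OF e_hom]
  note e_pure = tensor_map_pure[OF Sm Sm km Sm \<epsilon>_linear id, folded e_def]
  note QU_lin = tensor_map_linear[OF km Sm km Sm id P_linear, folded QU_def]
  note QU_pure = tensor_map_pure[OF km Sm km Sm id P_linear, folded QU_def]
  \<comment> \<open>The counit acts on the left factor and \<open>P\<close> on the right one, so the
    two maps commute.\<close>
  have eQ: "e (Q t) = QU (e t)" if t: "t \<in> carrier T" for t
    by (rule T_linear_eqI[OF U.module linear_maps_comp[OF Q_linear e_lin] linear_maps_comp[OF e_lin QU_lin] _ t])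
      (simp add: Q_pure e_pure QU_pure)
  \<comment> \<open>Including letters commutes with applying the counit to the left factor, which
    reduces the claim to the left counit law of \<open>A\<close>.\<close>
  have letter: "e (dl a) = pure_tensor R k S \<one>\<^bsub>k\<^esub> (\<iota> a)" if a: "a \<in> carrier A" for a
  proof -
    note f_lin = tensor_map_linear[OF A.module A.module km A.module \<epsilon>A_linear id]
    note f_pure = tensor_map_pure[OF A.module A.module km A.module \<epsilon>A_linear id]
    note g_lin = tensor_map_linear[OF km A.module km Sm id \<iota>_linear]
    note g_pure = tensor_map_pure[OF km A.module km Sm id \<iota>_linear]
    have "e (\<iota>\<iota> t) = tensor_map R k S (\<lambda>x. x) (\<lambda>a. \<iota> a) (tensor_map R k A \<epsilon>A (\<lambda>x. x) t)"
      if t: "t \<in> carrier TA" for t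
      by (rule tensor_linear_eqI[OF A.module A.module U.module
            linear_maps_comp[OF algebra_homsD(1)[OF \<iota>\<iota>_hom] e_lin] linear_maps_comp[OF f_lin g_lin] _ t])
        (simp add: \<iota>\<iota>_pure e_pure f_pure g_pure \<epsilon>_\<iota> linear_mapsD(1)[OF \<epsilon>A_linear])
    from this[OF linear_mapsD(1)[OF \<Delta>A_linear a]]
    show ?thesis
      using left_counital_coalgebra.left_counit[OF A_coalgebra a] a
      by (simp add: sh_comult_letter_def g_pure one)
  qed
  note p_lin = bilinear_mapsD(1)[OF pure_tensor_bilinear[OF km Sm] k.one_closed]
  have "e (\<Delta> x) = pure_tensor R k S \<one>\<^bsub>k\<^esub> x"
  proof (rule S_linear_eqI[OF U.module linear_maps_comp[OF \<Delta>_linear e_lin] p_lin _ _ x])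
    fix a assume "a \<in> carrier A"
    thus "e (\<Delta> (\<iota> a)) = pure_tensor R k S \<one>\<^bsub>k\<^esub> (\<iota> a)" by (simp add: \<Delta>_\<iota> letter)
  next
    fix a w assume "a \<in> carrier A" "w \<in> carrier S" "e (\<Delta> w) = pure_tensor R k S \<one>\<^bsub>k\<^esub> w"
    thus "e (\<Delta> (\<iota> a \<otimes>\<^bsub>S\<^esub> P w)) = pure_tensor R k S \<one>\<^bsub>k\<^esub> (\<iota> a \<otimes>\<^bsub>S\<^esub> P w)"
      by (simp add: \<Delta>_Cons algebra_homsD(3)[OF e_hom] eQ letter QU_pure
          tensor_mult_pure[OF k_algebra S_algebra])
  qed
  thus ?thesis by (simp add: e_def one)
qed

section \<open>Assembly of the structure\<close>

lemma Sh_left_counital_cocycle_bialgebra: "left_counital_cocycle_bialgebra R S \<Delta> \<epsilon> P"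
  by (intro left_counital_cocycle_bialgebra.intro left_counital_operated_bialgebra.intro
      operated_algebra.intro operated_algebra_axioms.intro left_counital_coalgebra.intro
      left_counital_coalgebra_axioms.intro left_counital_operated_bialgebra_axioms.intro
      left_counital_cocycle_bialgebra_axioms.intro S_algebra S_module P_linear \<Delta>_linear \<Delta>_coassoc
      \<epsilon>_linear \<Delta>_left_counit \<Delta>_hom \<epsilon>_hom \<Delta>_P)

end

theorem theorem3p9:
  fixes R :: "('r, 'x) ring_scheme"
    and A :: "('r, 'a, 'y) module_scheme"
    and l :: 'r
    and \<Delta>A :: "'a \<Rightarrow> ('a \<times> 'a \<Rightarrow> 'r) set"
    and \<epsilon>A :: "'a \<Rightarrow> 'r"
  assumes "cring R"
    and "l \<in> carrier R"
    and "bialgebra R A \<Delta>A \<epsilon>A"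
  shows "left_counital_cocycle_bialgebra R (Sh R A l)
           (sh_comult R A l \<Delta>A) (sh_counit R \<epsilon>A) (sh_operator R A l)"
proof -
  have "td_bialgebra R A l \<Delta>A \<epsilon>A"
    using assms(2,3) bialgebra.axioms(1)[OF assms(3)]
    by (intro td_bialgebra.intro td_words.intro td_bialgebra_axioms.intro)
  thus ?thesis by (rule td_bialgebra.Sh_left_counital_cocycle_bialgebra)
qed

end
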